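(* Consider the system $$\dot x=f(x,w,t)+B(x,t)u,\qquad y=g(x,u,t),$$ with differential dynamics $$\dot\delta_x=A(x,u,w,t)\delta_x+B(x,t)\delta_u+B_w(x,w,t)\delta_w,\qquad \delta_y=C(x,t)\delta_x+D(x,t)\delta_u,$$ and let $\alpha>0$. Suppose there exist $W(x,t)=W(x,t)'>0$ and $Y(x,t,u)$, with $Y$ affine in $u$, such that $$\begin{bmatrix}\mathcal W & WC'+Y'D'\\ CW+DY & I\end{bmatrix}\ge 0\qquad\text{for all }x,u,w,t,$$ where $$\mathcal W=\dot W-WA'-AW-BY-Y'B'-\frac{1}{\alpha^2}B_wB_w',$$ and where $W^{-1}$ is a Riemannian metric for which any two points of $\mathbb{R}^n$ are joined by a smooth minimal geodesic (for each $t$). Then for any target solution $(u^\star,x^\star,w^\star)$, with output $y^\star$, there exists a state-feedback controller for which $$\int_0^T|y-y^\star|^2\,dt\le\alpha^2\int_0^T|w-w^\star|^2\,dt$$ for any external input $w$ and any $T>0$, where $x,y$ are the state and output of the closed-loop system driven by $w$ from the initial condition $x(0)=x^\star(0)$.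
   Context: Here $x(t)\in\mathbb{R}^n$ is the state, $u(t)\in\mathbb{R}^m$ the control, $w(t)$ the (finite-dimensional) external disturbance, $y(t)$ the output, $t\in[0,\infty)$; $f,B,g$ (and $W,Y$) are smooth. A prime denotes transpose; matrix inequalities are in the sense of symmetric matrices. The matrices of the differential dynamics are the Jacobians $A=\frac{\partial}{\partial x}\big(f(x,w,t)+B(x,t)u\big)$, $B_w=\frac{\partial f}{\partial w}$, $C=\frac{\partial g}{\partial x}$, $D=\frac{\partial g}{\partial u}$. $\dot W$ is the derivative along the system: $\dot W=\frac{\partial W}{\partial t}+\sum_{i=1}^n\frac{\partial W}{\partial x_i}\big(f(x,w,t)+B(x,t)u\big)_i$. A target solution $(u^\star,x^\star,w^\star)$ is a triple of signals on $[0,\infty)$ with $\dot x^\star=f(x^\star,w^\star,t)+B(x^\star,t)u^\star$, and $y^\star=g(x^\star,u^\star,t)$. A state-feedback controller is $u=k(x,t)$; it may depend on the target solution but not on $w$. A Riemannian metric is a symmetric positive definite matrix function $M(x,t)$, smooth in $x$, with inner product $\langle\delta_1,\delta_2\rangle_x=\delta_1'M(x,t)\delta_2$ on tangent vectors at $x$. A minimal geodesic between two points is a shortest smooth path $\gamma:[0,1]\to\mathbb{R}^n$ between them with respect to the length $\int_0^1\sqrt{\langle\gamma_s,\gamma_s\rangle_{\gamma(s)}}\,ds$, where $\gamma_s=\frac{\partial\gamma}{\partial s}$.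
   Formalization: Added hypothesis: for any two fixed points, the Riemannian distance of W^{-1}(.,t) is continuous in t (automatic for complete or time-independent metrics); without it the claim is false, since short paths may escape to infinity in finite time and the distance can jump up. *)

theory Defs
  imports "HOL-Analysis.Analysis"
begin

section \<open>Smooth maps\<close>

text \<open>
  Derivatives are taken within \<open>S\<close>. All uses below have \<open>S\<close> convex with nonempty interior (a whole
  space, times \<open>{0..}\<close> when time is an argument, or \<open>{0..1}\<close>), so they are unique and one-sided
  at the boundary.
\<close>

primrec Ck_on :: "nat \<Rightarrow> 'a::euclidean_space set \<Rightarrow> ('a \<Rightarrow> 'b::real_normed_vector) \<Rightarrow> bool" where
  "Ck_on 0 S f \<longleftrightarrow> continuous_on S f"
| "Ck_on (Suc k) S f \<longleftrightarrow>
     (\<exists>f'. (\<forall>x\<in>S. (f has_derivative f' x) (at x within S)) \<and> (\<forall>v. Ck_on k S (\<lambda>x. f' x v)))"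

definition smooth_on :: "'a::euclidean_space set \<Rightarrow> ('a \<Rightarrow> 'b::real_normed_vector) \<Rightarrow> bool" where
  "smooth_on S f \<longleftrightarrow> (\<forall>k. Ck_on k S f)"

section \<open>Symmetric and block matrices\<close>

definition pos_def :: "real^'n^'n \<Rightarrow> bool" where
  "pos_def P \<longleftrightarrow> transpose P = P \<and> (\<forall>v. v \<noteq> 0 \<longrightarrow> v \<bullet> (P *v v) > 0)"

definition pos_semidef :: "real^'n^'n \<Rightarrow> bool" where
  "pos_semidef P \<longleftrightarrow> transpose P = P \<and> (\<forall>v. v \<bullet> (P *v v) \<ge> 0)"

definition block_matrix ::
  "real^'a^'a \<Rightarrow> real^'b^'a \<Rightarrow> real^'a^'b \<Rightarrow> real^'b^'b \<Rightarrow> real^('a + 'b)^('a + 'b)" where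
  "block_matrix P Q R S = (\<chi> i j. case i of
      Inl a \<Rightarrow> (case j of Inl a' \<Rightarrow> P $ a $ a' | Inr b' \<Rightarrow> Q $ a $ b')
    | Inr b \<Rightarrow> (case j of Inl a' \<Rightarrow> R $ b $ a' | Inr b' \<Rightarrow> S $ b $ b'))"

section \<open>Riemannian metrics on \<open>\<real>\<^sup>n\<close> and minimal geodesics\<close>

definition riemannian_metric :: "(real^'n \<Rightarrow> real^'n^'n) \<Rightarrow> bool" where
  "riemannian_metric M \<longleftrightarrow> (\<forall>x. pos_def (M x)) \<and> smooth_on UNIV M"

definition smooth_path :: "real^'n \<Rightarrow> real^'n \<Rightarrow> (real \<Rightarrow> real^'n) \<Rightarrow> bool" where
  "smooth_path a b \<gamma> \<longleftrightarrow> smooth_on {0..1} \<gamma> \<and> \<gamma> 0 = a \<and> \<gamma> 1 = b"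

definition riem_length :: "(real^'n \<Rightarrow> real^'n^'n) \<Rightarrow> (real \<Rightarrow> real^'n) \<Rightarrow> real" where
  "riem_length M \<gamma> = integral {0..1} (\<lambda>s.
     let \<gamma>\<^sub>s = vector_derivative \<gamma> (at s within {0..1}) in sqrt (\<gamma>\<^sub>s \<bullet> (M (\<gamma> s) *v \<gamma>\<^sub>s)))"

definition minimal_geodesic ::
  "(real^'n \<Rightarrow> real^'n^'n) \<Rightarrow> real^'n \<Rightarrow> real^'n \<Rightarrow> (real \<Rightarrow> real^'n) \<Rightarrow> bool" where
  "minimal_geodesic M a b \<gamma> \<longleftrightarrow>
     smooth_path a b \<gamma> \<and> (\<forall>\<eta>. smooth_path a b \<eta> \<longrightarrow> riem_length M \<gamma> \<le> riem_length M \<eta>)"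

text \<open>
  For a metric that varies smoothly with a parameter, this distance is continuous in the parameter
  if the metrics are complete, but existence of minimal geodesics alone does not ensure it: a
  family of shortcuts may escape to infinity in finite parameter time.
\<close>

definition riem_dist :: "(real^'n \<Rightarrow> real^'n^'n) \<Rightarrow> real^'n \<Rightarrow> real^'n \<Rightarrow> real" where
  "riem_dist M a b = Inf (riem_length M ` {\<gamma>. smooth_path a b \<gamma>})"

section \<open>The control system and its differential dynamics\<close>

definition vfield ::
  "(real^'n \<Rightarrow> real^'p \<Rightarrow> real \<Rightarrow> real^'n) \<Rightarrow> (real^'n \<Rightarrow> real \<Rightarrow> real^'m^'n)
    \<Rightarrow> real^'n \<Rightarrow> real^'m \<Rightarrow> real^'p \<Rightarrow> real \<Rightarrow> real^'n" where
  "vfield f B x u w t = f x w t + B x t *v u"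

definition Amat ::
  "(real^'n \<Rightarrow> real^'p \<Rightarrow> real \<Rightarrow> real^'n) \<Rightarrow> (real^'n \<Rightarrow> real \<Rightarrow> real^'m^'n)
    \<Rightarrow> real^'n \<Rightarrow> real^'m \<Rightarrow> real^'p \<Rightarrow> real \<Rightarrow> real^'n^'n" where
  "Amat f B x u w t = jacobian (\<lambda>\<xi>. vfield f B \<xi> u w t) (at x)"

definition Bwmat ::
  "(real^'n \<Rightarrow> real^'p \<Rightarrow> real \<Rightarrow> real^'n) \<Rightarrow> real^'n \<Rightarrow> real^'p \<Rightarrow> real \<Rightarrow> real^'p^'n" where
  "Bwmat f x w t = jacobian (\<lambda>\<omega>. f x \<omega> t) (at w)"

definition Cmat ::
  "(real^'n \<Rightarrow> real^'m \<Rightarrow> real \<Rightarrow> real^'q) \<Rightarrow> real^'n \<Rightarrow> real^'m \<Rightarrow> real \<Rightarrow> real^'n^'q" where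
  "Cmat g x u t = jacobian (\<lambda>\<xi>. g \<xi> u t) (at x)"

definition Dmat ::
  "(real^'n \<Rightarrow> real^'m \<Rightarrow> real \<Rightarrow> real^'q) \<Rightarrow> real^'n \<Rightarrow> real^'m \<Rightarrow> real \<Rightarrow> real^'m^'q" where
  "Dmat g x u t = jacobian (\<lambda>\<upsilon>. g x \<upsilon> t) (at u)"

definition Wdot ::
  "(real^'n \<Rightarrow> real^'p \<Rightarrow> real \<Rightarrow> real^'n) \<Rightarrow> (real^'n \<Rightarrow> real \<Rightarrow> real^'m^'n)
    \<Rightarrow> (real^'n \<Rightarrow> real \<Rightarrow> real^'n^'n) \<Rightarrow> real^'n \<Rightarrow> real^'m \<Rightarrow> real^'p \<Rightarrow> real \<Rightarrow> real^'n^'n" where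
  "Wdot f B W x u w t =
     vector_derivative (\<lambda>\<tau>. W x \<tau>) (at t within {0..})
     + (\<Sum>i\<in>UNIV. (vfield f B x u w t $ i) *\<^sub>R frechet_derivative (\<lambda>\<xi>. W \<xi> t) (at x) (axis i 1))"

definition calW ::
  "real \<Rightarrow> (real^'n \<Rightarrow> real^'p \<Rightarrow> real \<Rightarrow> real^'n) \<Rightarrow> (real^'n \<Rightarrow> real \<Rightarrow> real^'m^'n)
    \<Rightarrow> (real^'n \<Rightarrow> real \<Rightarrow> real^'n^'n) \<Rightarrow> (real^'n \<Rightarrow> real \<Rightarrow> real^'m \<Rightarrow> real^'n^'m)
    \<Rightarrow> real^'n \<Rightarrow> real^'m \<Rightarrow> real^'p \<Rightarrow> real \<Rightarrow> real^'n^'n" where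
  "calW \<alpha> f B W Y x u w t =
     Wdot f B W x u w t
     - W x t ** transpose (Amat f B x u w t) - Amat f B x u w t ** W x t
     - B x t ** Y x t u - transpose (Y x t u) ** transpose (B x t)
     - (1 / \<alpha>\<^sup>2) *\<^sub>R (Bwmat f x w t ** transpose (Bwmat f x w t))"

definition lmi_matrix ::
  "real \<Rightarrow> (real^'n \<Rightarrow> real^'p \<Rightarrow> real \<Rightarrow> real^'n) \<Rightarrow> (real^'n \<Rightarrow> real \<Rightarrow> real^'m^'n)
    \<Rightarrow> (real^'n \<Rightarrow> real^'m \<Rightarrow> real \<Rightarrow> real^'q)
    \<Rightarrow> (real^'n \<Rightarrow> real \<Rightarrow> real^'n^'n) \<Rightarrow> (real^'n \<Rightarrow> real \<Rightarrow> real^'m \<Rightarrow> real^'n^'m)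
    \<Rightarrow> real^'n \<Rightarrow> real^'m \<Rightarrow> real^'p \<Rightarrow> real \<Rightarrow> real^('n + 'q)^('n + 'q)" where
  "lmi_matrix \<alpha> f B g W Y x u w t = block_matrix
     (calW \<alpha> f B W Y x u w t)
     (W x t ** transpose (Cmat g x u t) + transpose (Y x t u) ** transpose (Dmat g x u t))
     (Cmat g x u t ** W x t + Dmat g x u t ** Y x t u)
     (mat 1)"

section \<open>Signals and solutions\<close>

abbreviation signal :: "(real \<Rightarrow> real^'k) \<Rightarrow> bool" where
  "signal v \<equiv> v \<in> borel_measurable (lebesgue_on {0..})"

text \<open>
  Solutions in the sense of Caratheodory: absolutely continuous, with the differential equation
  holding almost everywhere. A feedback built from minimal geodesics need not be continuous.
\<close>

definition solution_on ::
  "(real^'n \<Rightarrow> real^'p \<Rightarrow> real \<Rightarrow> real^'n) \<Rightarrow> (real^'n \<Rightarrow> real \<Rightarrow> real^'m^'n)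
    \<Rightarrow> real \<Rightarrow> (real \<Rightarrow> real^'m) \<Rightarrow> (real \<Rightarrow> real^'n) \<Rightarrow> (real \<Rightarrow> real^'p) \<Rightarrow> bool" where
  "solution_on f B T u x w \<longleftrightarrow>
     (\<lambda>s. vfield f B (x s) (u s) (w s) s) absolutely_integrable_on {0..T} \<and>
     (\<forall>t\<in>{0..T}. x t = x 0 + integral {0..t} (\<lambda>s. vfield f B (x s) (u s) (w s) s))"

definition target_solution ::
  "(real^'n \<Rightarrow> real^'p \<Rightarrow> real \<Rightarrow> real^'n) \<Rightarrow> (real^'n \<Rightarrow> real \<Rightarrow> real^'m^'n)
    \<Rightarrow> (real \<Rightarrow> real^'m) \<Rightarrow> (real \<Rightarrow> real^'n) \<Rightarrow> (real \<Rightarrow> real^'p) \<Rightarrow> bool" where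
  "target_solution f B u x w \<longleftrightarrow> signal u \<and> signal w \<and> (\<forall>T>0. solution_on f B T u x w)"

text \<open>
  Joint measurability makes \<open>\<lambda>t. k (x t) t\<close> measurable along every continuous \<open>x\<close>.
\<close>

definition state_feedback :: "(real^'n \<Rightarrow> real \<Rightarrow> real^'m) \<Rightarrow> bool" where
  "state_feedback k \<longleftrightarrow> (\<lambda>(x, t). k x t) \<in> borel_measurable (borel \<Otimes>\<^sub>M lebesgue_on {0..})"

text \<open>
  The squared \<open>L\<^sup>2\<close> norm on \<open>[0,T]\<close>; the value is infinite when \<open>v\<close> is not square integrable.
\<close>

definition sq_norm_upto :: "real \<Rightarrow> (real \<Rightarrow> real^'k) \<Rightarrow> ennreal" where
  "sq_norm_upto T v = (\<integral>\<^sup>+ t. ennreal ((norm (v t))\<^sup>2) \<partial>lebesgue_on {0..T})"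

end

theory Submission
  imports Defs
begin

text \<open>
  Let \<open>d t\<close> be the Riemannian distance of the metric \<open>W(\<cdot>,t)\<inverse>\<close>. The control at \<open>x\<close> is obtained by
  integrating the differential feedback \<open>\<delta>\<^sub>u = Y W\<inverse> \<delta>\<^sub>x\<close> along a geodesic from \<open>x\<^sup>\<star>(t)\<close> to \<open>x\<close>,
  starting from \<open>u\<^sup>\<star>(t)\<close>. Transporting the geodesic by the flow, with the disturbance interpolated
  linearly between \<open>w\<^sup>\<star>\<close> and \<open>w\<close>, the matrix inequality bounds the derivative of the squared distance
  \<open>V t = (d t (x\<^sup>\<star> t) (x t))\<^sup>2\<close> by \<open>\<alpha>\<^sup>2 \<bar>w - w\<^sup>\<star>\<bar>\<^sup>2 - \<bar>y - y\<^sup>\<star>\<bar>\<^sup>2\<close>, and \<open>V 0 = 0 \<le> V T\<close> gives the claim.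

  Two points need care. A measurable choice of geodesics is replaced by a Borel selection of the
  final control value from the closure of the values reached by lifting paths of prescribed speed;
  that closure is a countable union of closed sets with compact sections, and nearly shortest paths
  suffice for the derivative estimate. And \<open>V\<close> is only known to be continuous with one-sided upper
  bounds on its increments, so it is integrated by a Dini derivative argument for the gauge integral.
\<close>

text \<open>The control at \<open>x\<close> is a path integral that involves \<open>xs\<close>,
  \<open>us\<close> and the metric but no disturbance. \<open>w\<close> appears only when a path is
  transported, and as the inequality holds for every \<open>w\<close>, all intermediate values of
  the interpolation are admissible, with the constant velocity \<open>w - ws\<close>.
  \<open>Y\<close> affine in \<open>u\<close> keeps the lifted control from blowing up along the
  path. The obstacle is that geodesics and their lifts need not vary continuously with their ends,
  so \<open>V\<close> cannot be differentiated by a first variation formula. A transported path is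
  only a competitor for the distance at the later time, hence the one-sided bounds. A competitor
  need not be minimal, and the error constants are uniform on balls; this is why limits of lifted
  paths serve as well as geodesics. Where the trajectories have no derivative, a bound for
  \<open>V\<close> with finite slope survives after subtracting a multiple of \<open>G\<close>, the
  integral of the two speeds, and a finite slope is all the gauge integral asks for on a null set.
  The output is not known beforehand to be square integrable, so its square is truncated
  first.\<close>

section \<open>Integrating one-sided derivative bounds\<close>

text \<open>
  \<open>H c\<close> is the supremum of the Henstock errors of partial divisions of \<open>[a,c]\<close>; it gains at least
  the error of each new interval tagged at its left end, so \<open>F t - integral {a..t} \<phi> - H t - e * (t - a)\<close>
  cannot increase on short steps to the right. As the integral is the gauge integral, \<open>\<phi>\<close> may take
  arbitrary finite values on a null set.
\<close>

lemma dini_integral_bound: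
  fixes F \<phi> :: "real \<Rightarrow> real"
  assumes "a \<le> b" and contF: "continuous_on {a..b} F" and int: "\<phi> integrable_on {a..b}"
    and step: "\<And>t e. t \<in> {a..<b} \<Longrightarrow> e > 0 \<Longrightarrow>
      \<exists>d>0. \<forall>h. 0 < h \<and> h < d \<and> t + h \<le> b \<longrightarrow> F (t + h) \<le> F t + h * (\<phi> t + e)"
  shows "F b - F a \<le> integral {a..b} \<phi>"
proof -
  have *: "F b - F a \<le> integral {a..b} \<phi> + e + e * (b - a)" if e: "e > 0" for e
  proof -
    obtain \<gamma> where g: "gauge \<gamma>" and hen: "\<And>p. \<lbrakk>p tagged_partial_division_of (cbox a b); \<gamma> fine p\<rbrakk> \<Longrightarrow>
             sum (\<lambda>(x,k). norm(measure lborel k *\<^sub>R \<phi> x - integral k \<phi>)) p < e"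
      using Henstock_lemma[of \<phi> a b e] int e by auto
    define T where "T c = {p. p tagged_partial_division_of (cbox a c) \<and> \<gamma> fine p}" for c
    define err where "err p = sum (\<lambda>(x,k). norm(measure lborel k *\<^sub>R \<phi> x - integral k \<phi>)) p" for p
    define H where "H c = Sup (err ` T c)" for c
    have T_mono: "T c \<subseteq> T d" if "c \<le> d" for c d
      using that unfolding T_def tagged_partial_division_of_def by fastforce
    have T_ne: "{} \<in> T c" for c
      unfolding T_def by (auto simp: tagged_partial_division_of_def fine_def)
    have err_le: "err p \<le> e" if "p \<in> T c" "c \<le> b" for p c
      using hen[of p] T_mono[OF that(2)] that(1) unfolding T_def err_def by force
    have bdd: "bdd_above (err ` T c)" if "c \<le> b" for c
      using err_le that by (auto intro!: bdd_aboveI2)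
    have H_le: "H c \<le> e" if "c \<le> b" for c
      unfolding H_def using err_le[OF _ that] T_ne by (intro cSup_least) auto
    have H_nonneg: "H c \<ge> 0" if "c \<le> b" for c
      using cSup_upper[OF _ bdd[OF that], of "err {}"] T_ne[of c] unfolding H_def err_def by force
    have H_mono: "H c \<le> H d" if "c \<le> d" "d \<le> b" for c d
      unfolding H_def using T_mono[OF that(1)] T_ne bdd[OF that(2)]
      by (intro cSup_subset_mono) auto
    have H_step: "H c + norm ((d - c) *\<^sub>R \<phi> c - integral {c..d} \<phi>) \<le> H d"
      if cd: "a \<le> c" "c < d" "d \<le> b" "{c..d} \<subseteq> \<gamma> c" for c d
    proof -
      let ?n = "norm ((d - c) *\<^sub>R \<phi> c - integral {c..d} \<phi>)"
      have "err p + ?n \<le> H d" if p: "p \<in> T c" for p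
      proof -
        have sub: "K \<subseteq> {a..c}" if "(x, K) \<in> p" for x K
          using p that unfolding T_def tagged_partial_division_of_def by auto
        have fin: "finite p" using p unfolding T_def tagged_partial_division_of_def by auto
        have notin: "(c, {c..d}) \<notin> p"
          using sub[of c "{c..d}"] cd by auto
        have disj: "interior K \<inter> interior {c..d} = {}" if "(x, K) \<in> p" for x K
        proof -
          have "interior K \<subseteq> {a..c}" using sub[OF that] interior_subset by blast
          then show ?thesis by (fastforce simp: interior_atLeastAtMost_real)
        qed
        have "insert (c, {c..d}) p \<in> T d"
          unfolding T_def tagged_partial_division_of_def
        proof (intro CollectI conjI allI impI)
          show "finite (insert (c, {c..d}) p)" using fin by simp
          fix x K assume xK: "(x, K) \<in> insert (c, {c..d}) p"
          then show "x \<in> K" "\<exists>u v. K = cbox u v"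
            using p cd unfolding T_def tagged_partial_division_of_def by (auto simp flip: box_real(2))
          have "K \<subseteq> {a..c} \<or> K = {c..d}" using xK sub[of x K] by blast
          then show "K \<subseteq> cbox a d" using cd by fastforce
        next
          fix x1 K1 x2 K2
          assume "(x1, K1) \<in> insert (c, {c..d}) p \<and> (x2, K2) \<in> insert (c, {c..d}) p \<and> (x1, K1) \<noteq> (x2, K2)"
          moreover have "interior K1 \<inter> interior K2 = {}" if "(x1, K1) \<in> p" "(x2, K2) \<in> p" "(x1, K1) \<noteq> (x2, K2)"
            using p that unfolding T_def tagged_partial_division_of_def by blast
          ultimately show "interior K1 \<inter> interior K2 = {}"
            using disj by blast
        next
          show "\<gamma> fine insert (c, {c..d}) p"
            using p cd unfolding T_def fine_def by auto
        qed
        moreover have "err (insert (c, {c..d}) p) = err p + ?n"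
          unfolding err_def using fin notin cd by simp
        ultimately show ?thesis
          using cSup_upper[OF imageI bdd[OF cd(3)], of "insert (c, {c..d}) p"] unfolding H_def by metis
      qed
      then have "H c \<le> H d - ?n"
        unfolding H_def[of c] using T_ne[of c] by (intro cSup_least) (auto simp: field_simps)
      then show ?thesis by simp
    qed
    define P where "P c = F c - F a - integral {a..c} \<phi> - e * (c - a)" for c
    have contP: "continuous_on {a..b} P"
      unfolding P_def using contF int by (intro continuous_intros indefinite_integral_continuous_1)
    define S where "S = {c \<in> {a..b}. P c \<le> H c}"
    have aS: "a \<in> S" unfolding S_def P_def using H_nonneg \<open>a \<le> b\<close> by auto
    have bS: "bdd_above S" unfolding S_def by auto
    define s where "s = Sup S"
    have s_up: "c \<le> s" if "c \<in> S" for c unfolding s_def using that bS by (rule cSup_upper)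
    have sb: "s \<le> b" unfolding s_def using aS by (intro cSup_least) (auto simp: S_def)
    have sa: "a \<le> s" using s_up aS .
    \<comment> \<open>\<open>H\<close> may jump, so \<open>S\<close> need not be closed.
      Monotonicity replaces \<open>H c\<close> by the constant \<open>H s\<close>, and a sublevel
      set of the continuous \<open>P\<close> is closed.\<close>
    have "s \<in> {c \<in> {a..b}. P c \<le> H s}"
    proof -
      have "closed {c \<in> {a..b}. P c \<le> H s}"
        using continuous_closed_preimage[OF contP closed_real_atLeastAtMost closed_atMost[of "H s"]]
        by (simp add: vimage_def Int_def)
      moreover have "S \<subseteq> {c \<in> {a..b}. P c \<le> H s}"
        using H_mono s_up sb unfolding S_def by fastforce
      ultimately show ?thesis
        unfolding s_def using aS bS closed_subset_contains_Sup by blast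
    qed
    then have sS: "P s \<le> H s" by simp
    have "s = b"
    proof (rule ccontr)
      assume "s \<noteq> b"
      with sb have sb: "s < b" by simp
      from step[of s e] obtain d1 where d1: "d1 > 0"
        "\<And>h. 0 < h \<Longrightarrow> h < d1 \<Longrightarrow> s + h \<le> b \<Longrightarrow> F (s + h) \<le> F s + h * (\<phi> s + e)"
        using sa sb e by auto
      from g obtain d2 where d2: "d2 > 0" "ball s d2 \<subseteq> \<gamma> s"
        unfolding gauge_def by (meson openE)
      define h where "h = min (min (d1/2) (d2/2)) (b - s)"
      have h: "0 < h" "h < d1" "h < d2" "s + h \<le> b" using d1 d2 sb unfolding h_def by auto
      have "{s..s+h} \<subseteq> \<gamma> s" using d2 h by (auto simp: subset_iff dist_real_def)
      from H_step[OF sa _ h(4) this] h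
      have hs: "H s + norm (h *\<^sub>R \<phi> s - integral {s..s+h} \<phi>) \<le> H (s + h)" by simp
      have "integral {a..s} \<phi> + integral {s..s+h} \<phi> = integral {a..s+h} \<phi>"
        using sa h int by (intro Henstock_Kurzweil_Integration.integral_combine)
          (auto intro: integrable_subinterval_real)
      moreover have "h * \<phi> s - integral {s..s+h} \<phi> \<le> norm (h *\<^sub>R \<phi> s - integral {s..s+h} \<phi>)" by simp
      moreover have "F (s + h) \<le> F s + h * \<phi> s + h * e" using d1(2)[OF h(1,2,4)] by (simp add: algebra_simps)
      ultimately have "P (s + h) \<le> H (s + h)"
        using hs sS unfolding P_def by (simp add: algebra_simps)
      then have "s + h \<in> S" unfolding S_def using sa h by auto
      then show False using s_up h by force
    qed
    \<comment> \<open>At \<open>b\<close> all Henstock error sums are at most \<open>e\<close>, so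
      \<open>H\<close> disappears from the bound.\<close>
    with sS H_le[of b] show ?thesis unfolding P_def by simp
  qed
  show ?thesis
  proof (rule field_le_epsilon)
    fix e :: real assume e: "e > 0"
    define e' where "e' = e / (1 + (b - a))"
    have "e' > 0" "e' * (1 + (b - a)) = e"
      using e \<open>a \<le> b\<close> unfolding e'_def by auto
    then have "e' > 0" "e' + e' * (b - a) = e" by (auto simp: distrib_left)
    with *[of e'] show "F b - F a \<le> integral {a..b} \<phi> + e" by linarith
  qed
qed

text \<open>The exceptional set comes before \<open>e\<close>, so one null set serves every
  tolerance.\<close>

lemma indefinite_integral_right_derivative_ae:
  fixes f :: "real \<Rightarrow> 'b::euclidean_space"
  assumes "f integrable_on {a..b}"
  obtains N where "negligible N"
    "\<And>t e. t \<in> {a..<b} - N \<Longrightarrow> e > 0 \<Longrightarrow> \<exists>d>0. \<forall>h. 0 < h \<and> h < d \<and> t + h \<le> b \<longrightarrow>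
       norm (integral {a..t+h} f - integral {a..t} f - h *\<^sub>R f t) \<le> e * h"
proof -
  \<comment> \<open>Extension by zero gives an integrable function on the line that cannot be told
    from \<open>f\<close> on the intervals \<open>{t..t+h}\<close> in question.\<close>
  define g where "g x = (if x \<in> {a..b} then f x else 0)" for x
  have "g integrable_on UNIV"
    unfolding g_def using assms by (subst integrable_restrict_UNIV)
  then have "g integrable_on cbox c d" for c d
    by (rule integrable_on_subcbox) auto
  from integrable_ccontinuous_explicit[OF this]
  obtain N where N: "negligible N" and
    D: "\<And>x e. \<lbrakk>x \<notin> N; 0 < e\<rbrakk> \<Longrightarrow> \<exists>d>0. \<forall>h. 0 < h \<and> h < d \<longrightarrow>
                         norm(integral (cbox x (x + h *\<^sub>R One)) g /\<^sub>R h ^ DIM(real) - g x) < e"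
    by metis
  show thesis
  proof (rule that[OF N])
    fix t e :: real assume t: "t \<in> {a..<b} - N" and e: "e > 0"
    from D[of t e] t e obtain d where d: "d > 0"
      "\<And>h. 0 < h \<Longrightarrow> h < d \<Longrightarrow> norm(integral {t..t+h} g /\<^sub>R h - g t) < e" by auto
    show "\<exists>d>0. \<forall>h. 0 < h \<and> h < d \<and> t + h \<le> b \<longrightarrow>
       norm (integral {a..t+h} f - integral {a..t} f - h *\<^sub>R f t) \<le> e * h"
    proof (intro exI[of _ d] conjI allI impI)
      fix h assume h: "0 < h \<and> h < d \<and> t + h \<le> b"
      have "integral {a..t} f + integral {t..t+h} f = integral {a..t+h} f"
        using t h assms by (intro Henstock_Kurzweil_Integration.integral_combine)
          (auto intro: integrable_subinterval_real)
      moreover have "integral {t..t+h} g = integral {t..t+h} f"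
        using t h by (intro integral_cong) (auto simp: g_def)
      moreover have "g t = f t" using t by (simp add: g_def)
      moreover have "norm (h *\<^sub>R (integral {t..t+h} g /\<^sub>R h - g t)) \<le> h * e"
        using d(2)[of h] h by (subst norm_scaleR) auto
      ultimately have "norm (integral {t..t+h} f - h *\<^sub>R f t) \<le> e * h"
        using h by (simp add: scaleR_diff_right mult.commute)
      moreover have "integral {t..t+h} f - h *\<^sub>R f t = integral {a..t+h} f - integral {a..t} f - h *\<^sub>R f t"
        using \<open>integral {a..t} f + integral {t..t+h} f = integral {a..t+h} f\<close> by (metis add_diff_cancel_left')
      ultimately show "norm (integral {a..t+h} f - integral {a..t} f - h *\<^sub>R f t) \<le> e * h"
        by simp
    qed (use d in auto)
  qed
qed

section \<open>C1 paths\<close>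

definition C1_path :: "(real \<Rightarrow> 'a::real_normed_vector) \<Rightarrow> (real \<Rightarrow> 'a) \<Rightarrow> bool" where
  "C1_path \<gamma> \<gamma>' \<longleftrightarrow>
     (\<forall>s\<in>{0..1}. (\<gamma> has_vector_derivative \<gamma>' s) (at s within {0..1})) \<and> continuous_on {0..1} \<gamma>'"

lemma C1_path_continuous: "C1_path \<gamma> \<gamma>' \<Longrightarrow> continuous_on {0..1} \<gamma>"
  unfolding C1_path_def by (meson continuous_on_eq_continuous_within has_vector_derivative_continuous)

lemma C1_path_integral:
  fixes \<gamma> :: "real \<Rightarrow> 'a::banach"
  assumes "C1_path \<gamma> \<gamma>'" "s \<in> {0..1}"
  shows "(\<gamma>' has_integral (\<gamma> s - \<gamma> 0)) {0..s}"
proof (rule fundamental_theorem_of_calculus)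
  fix r assume "r \<in> {0..s}"
  with assms have "(\<gamma> has_vector_derivative \<gamma>' r) (at r within {0..1})" unfolding C1_path_def by auto
  then show "(\<gamma> has_vector_derivative \<gamma>' r) (at r within {0..s})"
    using assms(2) by (auto intro: has_vector_derivative_within_subset)
qed (use assms in auto)

text \<open>The difference of the two sides is the variance of \<open>q\<close> over the unit
  interval.\<close>

lemma square_integral_le_integral_square:
  fixes q :: "real \<Rightarrow> real"
  assumes "continuous_on {0..1} q"
  shows "(integral {0..1} q)\<^sup>2 \<le> integral {0..1} (\<lambda>s. (q s)\<^sup>2)"
proof -
  define m where "m = integral {0..1} q"
  have 1: "(q has_integral m) {0..1}" "((\<lambda>s. (q s)\<^sup>2) has_integral integral {0..1} (\<lambda>s. (q s)\<^sup>2)) {0..1}"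
    unfolding m_def using assms by (auto intro!: integrable_integral integrable_continuous_real continuous_intros)
  have "((\<lambda>s. m\<^sup>2) has_integral m\<^sup>2) {0..1::real}" using has_integral_const_real[of "m\<^sup>2" 0 1] by simp
  from has_integral_add[OF has_integral_diff[OF 1(2) has_integral_mult_right[OF 1(1), of "2 * m"]] this]
  have i2: "((\<lambda>s. (q s - m)\<^sup>2) has_integral (integral {0..1} (\<lambda>s. (q s)\<^sup>2) - 2 * m * m + m\<^sup>2)) {0..1}"
    by (rule has_integral_eq[rotated]) (simp add: power2_diff)
  have "0 \<le> integral {0..1} (\<lambda>s. (q s)\<^sup>2) - 2 * m * m + m\<^sup>2"
    using has_integral_nonneg[OF i2] by simp
  then show ?thesis unfolding m_def by (simp add: power2_eq_square)
qed

text \<open>Applied to the output path, this turns dissipation along the path into the squared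
  difference of the outputs at its ends.\<close>

lemma C1_path_increment_le:
  fixes \<gamma> :: "real \<Rightarrow> 'a::euclidean_space"
  assumes "C1_path \<gamma> \<gamma>'"
  shows "(norm (\<gamma> 1 - \<gamma> 0))\<^sup>2 \<le> integral {0..1} (\<lambda>s. (norm (\<gamma>' s))\<^sup>2)"
proof -
  have c: "continuous_on {0..1} \<gamma>'" using assms unfolding C1_path_def by auto
  have "(\<gamma>' has_integral (\<gamma> 1 - \<gamma> 0)) {0..1}" using C1_path_integral[OF assms, of 1] by auto
  then have "norm (\<gamma> 1 - \<gamma> 0) \<le> integral {0..1} (\<lambda>s. norm (\<gamma>' s))"
    using c by (metis continuous_on_norm integrable_continuous_real integral_norm_bound_integral integral_unique order_refl)
  then have "(norm (\<gamma> 1 - \<gamma> 0))\<^sup>2 \<le> (integral {0..1} (\<lambda>s. norm (\<gamma>' s)))\<^sup>2"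
    by (intro power_mono) auto
  also have "\<dots> \<le> integral {0..1} (\<lambda>s. (norm (\<gamma>' s))\<^sup>2)"
    using c by (intro square_integral_le_integral_square continuous_intros)
  finally show ?thesis .
qed

text \<open>For \<open>\<sigma>\<close> the speed of a path, \<open>\<psi>\<close> is the arc length
  parametrization, regularised by \<open>\<epsilon>\<close> because the speed may vanish. The new
  speed \<open>\<psi>' s * \<sigma> (\<psi> s)\<close> is the length plus \<open>\<epsilon>\<close>,
  times a factor at most 1. \<open>\<psi>\<close> arises as the inverse of the normalised integral
  of \<open>\<sigma> + \<epsilon>\<close>.\<close>

lemma reparametrization_by_weight:
  fixes \<sigma> :: "real \<Rightarrow> real"
  assumes cont: "continuous_on {0..1} \<sigma>" and nonneg: "\<And>s. s \<in> {0..1} \<Longrightarrow> \<sigma> s \<ge> 0"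
    and "\<epsilon> > 0"
  obtains \<psi> \<psi>' where "C1_path \<psi> \<psi>'" "\<psi> 0 = 0" "\<psi> 1 = 1" "\<And>s. s \<in> {0..1} \<Longrightarrow> \<psi> s \<in> {0..1}"
    "\<And>s. s \<in> {0..1} \<Longrightarrow> \<psi>' s = (integral {0..1} \<sigma> + \<epsilon>) / (\<sigma> (\<psi> s) + \<epsilon>)"
proof -
  define l where "l = integral {0..1} \<sigma>"
  have l0: "l \<ge> 0" unfolding l_def using nonneg cont by (intro integral_nonneg integrable_continuous_real) auto
  \<comment> \<open>Clamping extends the weight beyond \<open>{0..1}\<close>, so that the inverse
    function rule applies at the end points too.\<close>
  define c where "c s = max 0 (min 1 s)" for s :: real
  define w where "w s = (\<sigma> (c s) + \<epsilon>) / (l + \<epsilon>)" for s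
  have contw: "continuous_on A w" for A
    unfolding w_def c_def using l0 \<open>\<epsilon> > 0\<close>
    by (intro continuous_intros continuous_on_compose2[OF cont]) auto
  have wpos: "w s > 0" for s
    unfolding w_def using nonneg[of "c s"] l0 \<open>\<epsilon> > 0\<close> by (auto simp: c_def intro!: divide_pos_pos add_nonneg_pos)
  define S where "S s = integral {-1..s} w - integral {-1..0} w" for s
  have dS: "(S has_vector_derivative w s) (at s)" if "s \<in> {-1<..<2}" for s
  proof -
    have "((\<lambda>u. integral {-1..u} w) has_vector_derivative w s) (at s within {-1..2})"
      using that contw by (intro integral_has_vector_derivative) auto
    then have "((\<lambda>u. integral {-1..u} w) has_vector_derivative w s) (at s)"
      using that by (metis at_within_Icc_at greaterThanLessThan_iff)
    then show ?thesis unfolding S_def by (auto intro!: derivative_eq_intros)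
  qed
  have S_mono: "S s < S t" if "-1 < s" "s < t" "t < 2" for s t
  proof (rule DERIV_pos_imp_increasing[OF that(2)])
    fix x assume "s \<le> x" "x \<le> t"
    then show "\<exists>y. (S has_real_derivative y) (at x) \<and> 0 < y"
      using dS[of x] wpos[of x] that by (auto simp: has_real_derivative_iff_has_vector_derivative)
  qed
  have contS: "continuous_on {-1<..<2} S"
    using dS by (meson continuous_at_imp_continuous_on has_vector_derivative_continuous)
  have S0: "S 0 = 0" unfolding S_def by simp
  have S1: "S 1 = 1"
  proof -
    have "integral {-1..0} w + integral {0..1} w = integral {-1..1} w"
      using contw by (intro Henstock_Kurzweil_Integration.integral_combine integrable_continuous_real) auto
    moreover have "integral {0..1} w = integral {0..1} (\<lambda>s. (\<sigma> s + \<epsilon>) / (l + \<epsilon>))"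
      by (intro integral_cong) (auto simp: w_def c_def)
    moreover have "\<dots> = (l + \<epsilon>) / (l + \<epsilon>)"
      using cont by (simp add: l_def integral_add integrable_continuous_real)
    ultimately show ?thesis unfolding S_def using l0 \<open>\<epsilon> > 0\<close> by simp
  qed
  have inj: "inj_on S {-1<..<2}"
    using S_mono by (intro linorder_inj_onI) fastforce+
  define \<psi> where "\<psi> = the_inv_into {-1<..<2} S"
  have psiS: "\<psi> (S s) = s" if "s \<in> {-1<..<2}" for s
    unfolding \<psi>_def using inj that by (rule the_inv_into_f_f)
  have surj: "\<exists>s\<in>{0..1}. S s = y" if "y \<in> {0..1}" for y
    using IVT'[of S 0 y 1] that S0 S1 contS by (force intro: continuous_on_subset)
  have Spsi: "\<psi> y \<in> {0..1}" "S (\<psi> y) = y" if "y \<in> {0..1}" for y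
    using surj[OF that] psiS by force+
  have dpsi: "(\<psi> has_vector_derivative (l + \<epsilon>) / (\<sigma> (\<psi> y) + \<epsilon>)) (at y)" if y: "y \<in> {0..1}" for y
  proof -
    define s where "s = \<psi> y"
    have s: "s \<in> {-1<..<2}" "s \<in> {0..1}" "S s = y" using Spsi[OF y] unfolding s_def by auto
    have "(\<psi> has_derivative (\<lambda>h. h / w s)) (at (S s))"
    proof (rule has_derivative_inverse_strong[OF _ s(1) contS])
      show "(S has_derivative (\<lambda>h. h * w s)) (at s)"
        using dS[OF s(1)] by (simp add: has_vector_derivative_def)
      show "(\<lambda>h. h * w s) \<circ> (\<lambda>h. h / w s) = id" using wpos[of s] by auto
    qed (use psiS in auto)
    moreover have "1 / w s = (l + \<epsilon>) / (\<sigma> (\<psi> y) + \<epsilon>)"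
      using s(2) unfolding w_def c_def s_def by simp
    then have "h / w s = h * ((l + \<epsilon>) / (\<sigma> (\<psi> y) + \<epsilon>))" for h
      by (metis times_divide_eq_right mult.right_neutral)
    ultimately show ?thesis using s by (simp add: has_vector_derivative_def)
  qed
  show thesis
  proof (rule that[of \<psi> "\<lambda>y. (l + \<epsilon>) / (\<sigma> (\<psi> y) + \<epsilon>)"])
    have cpsi: "continuous_on {0..1} \<psi>"
      using dpsi by (meson continuous_at_imp_continuous_on has_vector_derivative_continuous)
    have "continuous_on {0..1} (\<lambda>y. \<sigma> (\<psi> y))"
      using Spsi by (intro continuous_on_compose2[OF cont cpsi]) auto
    moreover have "\<sigma> (\<psi> y) + \<epsilon> \<noteq> 0" if "y \<in> {0..1}" for y
      using nonneg[of "\<psi> y"] Spsi[OF that] \<open>\<epsilon> > 0\<close> by auto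
    ultimately show "C1_path \<psi> (\<lambda>y. (l + \<epsilon>) / (\<sigma> (\<psi> y) + \<epsilon>))"
      unfolding C1_path_def using dpsi
      by (auto intro!: continuous_intros intro: has_vector_derivative_at_within)
    show "\<psi> 0 = 0" "\<psi> 1 = 1" using psiS[of 0] psiS[of 1] S0 S1 by auto
  qed (use Spsi in \<open>auto simp: l_def\<close>)
qed

lemma C1_path_compose:
  assumes "C1_path \<gamma> \<gamma>'" "C1_path \<psi> \<psi>'" and sub: "\<And>s. s \<in> {0..1} \<Longrightarrow> \<psi> s \<in> {0..1}"
  shows "C1_path (\<lambda>s. \<gamma> (\<psi> s)) (\<lambda>s. \<psi>' s *\<^sub>R \<gamma>' (\<psi> s))"
proof -
  have "((\<gamma> \<circ> \<psi>) has_vector_derivative \<psi>' s *\<^sub>R \<gamma>' (\<psi> s)) (at s within {0..1})" if s: "s \<in> {0..1}" for s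
  proof (rule vector_diff_chain_within)
    show "(\<psi> has_vector_derivative \<psi>' s) (at s within {0..1})"
      using assms(2) s unfolding C1_path_def by blast
    have "(\<gamma> has_vector_derivative \<gamma>' (\<psi> s)) (at (\<psi> s) within {0..1})"
      using assms(1) sub[OF s] unfolding C1_path_def by blast
    then show "(\<gamma> has_vector_derivative \<gamma>' (\<psi> s)) (at (\<psi> s) within \<psi> ` {0..1})"
      by (rule has_vector_derivative_within_subset) (rule image_subsetI, rule sub)
  qed
  moreover have "continuous_on {0..1} (\<lambda>s. \<gamma>' (\<psi> s))"
    using assms(1) unfolding C1_path_def
    by (intro continuous_on_compose2[OF _ C1_path_continuous[OF assms(2)]]) (use sub in blast)+
  moreover have "continuous_on {0..1} \<psi>'" using assms(2) unfolding C1_path_def by blast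
  ultimately show ?thesis unfolding C1_path_def by (simp add: o_def continuous_on_scaleR)
qed

section \<open>Differential equations with a global Lipschitz bound\<close>

text \<open>With the weight \<open>exp (- \<mu> s)\<close> the Picard operator contracts on the whole interval.\<close>

lemma global_lipschitz_ode:
  fixes G :: "real \<Rightarrow> 'a::euclidean_space \<Rightarrow> 'a"
  assumes cont: "continuous_on ({0..1} \<times> UNIV) (\<lambda>(s, u). G s u)"
    and lip: "\<And>s u v. s \<in> {0..1} \<Longrightarrow> norm (G s u - G s v) \<le> L * norm (u - v)"
  obtains u where "u 0 = u0" "C1_path u (\<lambda>s. G s (u s))"
proof -
  \<comment> \<open>Twice \<open>L\<close> makes the contraction factor \<open>L / \<mu>\<close> at
    most 1/2; the maximum with 1 keeps \<open>\<mu>\<close> positive.\<close>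
  define \<mu> where "\<mu> = 2 * max L 1"
  have lam: "\<mu> > 0" "L \<le> \<mu> / 2" unfolding \<mu>_def by auto
  \<comment> \<open>Bounded continuous functions are defined on the whole line; with the clamp every
    \<open>T z\<close> is constant outside \<open>{0..1}\<close>.\<close>
  define c where "c s = max 0 (min 1 s)" for s :: real
  have c01: "c s \<in> {0..1}" for s unfolding c_def by auto
  have contc: "continuous_on UNIV c" unfolding c_def by (intro continuous_intros)
  \<comment> \<open>\<open>z\<close> stands for the solution divided by
    \<open>exp (\<mu> * r)\<close>; for it the weighted norm is the plain supremum norm.\<close>
  define I where "I z r = G r (exp (\<mu> * r) *\<^sub>R z r)" for z r
  define T where "T z s = exp (- \<mu> * c s) *\<^sub>R (u0 + integral {0..c s} (I z))" for z s
  have contI: "continuous_on {0..1} (I z)" if "continuous_on UNIV z" for z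
    unfolding I_def using continuous_on_subset[OF that, of "{0..1}"]
    by (intro continuous_on_compose2[OF cont, where f="\<lambda>r. (r, exp (\<mu> * r) *\<^sub>R z r)", simplified]) (auto intro!: continuous_intros)
  have contT: "continuous_on UNIV (T z)" if "continuous_on UNIV z" for z
  proof -
    have "continuous_on {0..1} (\<lambda>s. integral {0..s} (I z))"
      using contI[OF that] by (intro indefinite_integral_continuous_1 integrable_continuous_real)
    then have "continuous_on UNIV (\<lambda>s. integral {0..c s} (I z))"
      by (rule continuous_on_compose2[OF _ contc]) (use c01 in auto)
    then show ?thesis unfolding T_def using contc by (intro continuous_intros) auto
  qed
  have Tb: "T z \<in> bcontfun" if "continuous_on UNIV z" for z
  proof -
    have "compact (T z ` {0..1})"
      using contT[OF that] by (intro compact_continuous_image) (auto intro: continuous_on_subset)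
    then obtain B where B: "\<forall>x\<in>T z ` {0..1}. norm x \<le> B" using compact_imp_bounded bounded_iff by blast
    have "T z s = T z (c s)" for s unfolding T_def c_def by simp
    then have "norm (T z s) \<le> B" for s using B c01[of s] by (metis image_eqI)
    then show ?thesis using contT[OF that] by (rule bcontfun_normI[rotated])
  qed
  define TT where "TT z = Bcontfun (T (apply_bcontfun z))" for z :: "real \<Rightarrow>\<^sub>C 'a"
  have app: "apply_bcontfun (TT z) = T (apply_bcontfun z)" for z
    unfolding TT_def using Tb[of "apply_bcontfun z"] by (simp add: Bcontfun_inverse)
  have contr: "dist (TT z) (TT z') \<le> (1/2) * dist z z'" for z z'
  proof (rule dist_bound)
    fix s
    have iz: "I z integrable_on {0..c s}" for z :: "real \<Rightarrow>\<^sub>C 'a"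
      using contI[of z] c01[of s] by (auto intro!: integrable_continuous_real intro: continuous_on_subset)
    have e: "((\<lambda>r. L * exp (\<mu> * r) * dist z z') has_integral
       (L * dist z z' / \<mu>) * exp (\<mu> * c s) - (L * dist z z' / \<mu>) * exp (\<mu> * 0)) {0..c s}"
      using c01[of s] lam
      by (intro fundamental_theorem_of_calculus)
        (auto intro!: derivative_eq_intros simp flip: has_real_derivative_iff_has_vector_derivative)
    have "dist (T z s) (T z' s) = norm (exp (- \<mu> * c s) *\<^sub>R (integral {0..c s} (I z) - integral {0..c s} (I z')))"
      unfolding T_def dist_norm by (simp add: algebra_simps)
    also have "\<dots> = exp (- \<mu> * c s) * norm (integral {0..c s} (\<lambda>r. I z r - I z' r))"
      by (simp add: integral_diff iz)
    also have "norm (integral {0..c s} (\<lambda>r. I z r - I z' r)) \<le> integral {0..c s} (\<lambda>r. L * exp (\<mu> * r) * dist z z')"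
    proof (rule integral_norm_bound_integral)
      fix r assume r: "r \<in> {0..c s}"
      then have r01: "r \<in> {0..1}" using c01[of s] by auto
      have "norm (I z r - I z' r) \<le> L * norm (exp (\<mu> * r) *\<^sub>R z r - exp (\<mu> * r) *\<^sub>R z' r)"
        unfolding I_def using lip[OF r01] .
      also have "\<dots> = L * exp (\<mu> * r) * dist (z r) (z' r)"
        by (simp add: dist_norm flip: scaleR_diff_right)
      also have "\<dots> \<le> L * exp (\<mu> * r) * dist z z'"
      proof (cases "z r = z' r")
        case True
        have "0 \<le> L" using lip[OF r01, of "One" 0] by (metis One_non_0 diff_zero norm_ge_zero order_trans zero_le_mult_iff zero_less_norm_iff not_le)
        then show ?thesis using True by simp
      next
        case False
        have "0 \<le> L * norm (z r - z' r)" using lip[OF r01, of "z r" "z' r"] by (meson norm_ge_zero order_trans)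
        then have "0 \<le> L" using False by (simp add: zero_le_mult_iff)
        then show ?thesis by (intro mult_left_mono dist_bounded) auto
      qed
      finally show "norm (I z r - I z' r) \<le> L * exp (\<mu> * r) * dist z z'" .
    qed (use iz e in \<open>auto intro!: integrable_diff\<close>)
    also have "\<dots> = (L * dist z z' / \<mu>) * (exp (\<mu> * c s) - 1)"
      using integral_unique[OF e] by (simp add: right_diff_distrib)
    also have "exp (- \<mu> * c s) * \<dots> = (L / \<mu>) * dist z z' * (1 - exp (- \<mu> * c s))"
    proof -
      have "exp (- \<mu> * c s) * (exp (\<mu> * c s) - 1) = 1 - exp (- \<mu> * c s)"
        by (simp add: right_diff_distrib flip: exp_add)
      then show ?thesis by (metis mult.left_commute times_divide_eq_left)
    qed
    also have "\<dots> \<le> (1/2) * dist z z' * 1"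
    proof (rule mult_mono)
      show "L / \<mu> * dist z z' \<le> 1 / 2 * dist z z'"
        using lam by (intro mult_right_mono) (auto simp: field_simps)
      show "0 \<le> 1 - exp (- \<mu> * c s)" using lam c01[of s] by simp
    qed auto
    finally show "dist (TT z s) (TT z' s) \<le> (1/2) * dist z z'"
      by (simp add: app mult_left_mono)
  qed
  have "\<exists>!z. TT z = z" using contr by (intro banach_fix_type[of "1/2"]) auto
  then obtain z where "TT z = z" by blast
  then have z: "T z = apply_bcontfun z" using app[of z] by simp
  define u where "u s = u0 + integral {0..c s} (I z)" for s
  have uz: "exp (\<mu> * s) *\<^sub>R z s = u s" if "s \<in> {0..1}" for s
  proof -
    have "c s = s" using that unfolding c_def by auto
    then have "z s = exp (- \<mu> * s) *\<^sub>R u s" using fun_cong[OF z, of s] unfolding u_def T_def by simp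
    then show ?thesis by (simp flip: exp_add)
  qed
  have du: "(u has_vector_derivative G s (u s)) (at s within {0..1})" if s: "s \<in> {0..1}" for s
  proof -
    have "((\<lambda>s. integral {0..s} (I z)) has_vector_derivative I z s) (at s within {0..1})"
      using contI[of z] s by (intro integral_has_vector_derivative) auto
    then have "((\<lambda>s. u0 + integral {0..s} (I z)) has_vector_derivative I z s) (at s within {0..1})"
      by (auto intro!: derivative_eq_intros)
    then have "(u has_vector_derivative I z s) (at s within {0..1})"
      by (rule has_vector_derivative_transform[OF s, rotated]) (simp add: u_def c_def)
    then show ?thesis unfolding I_def uz[OF s] .
  qed
  show thesis
  proof (rule that)
    show "u 0 = u0" unfolding u_def c_def by simp
    have "continuous_on {0..1} u"
      using du by (meson continuous_on_eq_continuous_within has_vector_derivative_continuous)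
    then have "continuous_on {0..1} (\<lambda>s. G s (u s))"
      by (intro continuous_on_compose2[OF cont, where f="\<lambda>r. (r, u r)", simplified]) (auto intro!: continuous_intros)
    then show "C1_path u (\<lambda>s. G s (u s))" unfolding C1_path_def using du by auto
  qed
qed

section \<open>Measurable selection\<close>

text \<open>
  A selection is obtained by minimising the coordinates one after another. Comparing minima over
  \<open>S x\<close> and over \<open>S x \<inter> C\<close> needs only the rational sublevel sets, so hitting sets stay measurable.
\<close>

lemma measurable_selection_compact:
  fixes S :: "'a \<Rightarrow> (real^'m) set"
  assumes comp: "\<And>x. x \<in> space N \<Longrightarrow> compact (S x) \<and> S x \<noteq> {}"
    and hit: "\<And>C. closed C \<Longrightarrow> {x \<in> space N. S x \<inter> C \<noteq> {}} \<in> sets N"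
  obtains k where "k \<in> borel_measurable N" "\<And>x. x \<in> space N \<Longrightarrow> k x \<in> S x"
proof -
  \<comment> \<open>\<open>I\<close> collects the coordinates already decided, that is, constant on
    \<open>R x\<close>. Measurability of the hitting sets is part of the induction, since the next
    minimisation consumes it.\<close>
  have "\<exists>R. (\<forall>x\<in>space N. compact (R x) \<and> R x \<noteq> {} \<and> R x \<subseteq> S x \<and> (\<forall>i\<in>I. \<forall>u\<in>R x. \<forall>v\<in>R x. u $ i = v $ i))
      \<and> (\<forall>C. closed C \<longrightarrow> {x \<in> space N. R x \<inter> C \<noteq> {}} \<in> sets N)" for I :: "'m set"
  proof (use finite[of I] in \<open>induction I rule: finite_induct\<close>)
    case empty
    show ?case by (rule exI[of _ S]) (use comp hit in simp)
  next
    case (insert i I)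
    from insert.IH obtain R where
      R': "\<forall>x\<in>space N. compact (R x) \<and> R x \<noteq> {} \<and> R x \<subseteq> S x \<and> (\<forall>i\<in>I. \<forall>u\<in>R x. \<forall>v\<in>R x. u $ i = v $ i)"
      and Rhit': "\<forall>C. closed C \<longrightarrow> {x \<in> space N. R x \<inter> C \<noteq> {}} \<in> sets N"
      by (elim exE conjE)
    note R = bspec[OF R'] and Rhit = Rhit'[rule_format]
    define Q where "Q x = {u \<in> R x. \<forall>v\<in>R x. u $ i \<le> v $ i}" for x
    have cont: "continuous_on A (\<lambda>u :: real^'m. u $ i)" for A by (intro continuous_intros)
    have min_ex: "\<exists>u\<in>R x \<inter> C. \<forall>v\<in>R x \<inter> C. u $ i \<le> v $ i"
      if "x \<in> space N" "closed C" "R x \<inter> C \<noteq> {}" for x C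
      using R[OF that(1)] that(2,3) cont by (intro continuous_attains_inf) (auto intro: compact_Int_closed)
    have closed_half: "closed {u :: real^'m. u $ i \<le> r}" for r
      by (intro closed_Collect_le continuous_intros)
    have Qc: "compact (Q x)" if x: "x \<in> space N" for x
    proof -
      obtain u where u: "u \<in> R x" "\<forall>v\<in>R x. u $ i \<le> v $ i" using min_ex[OF x, of UNIV] R[OF x] by auto
      then have "Q x = R x \<inter> {v. v $ i \<le> u $ i}" unfolding Q_def by force
      then show ?thesis using R[OF that] closed_half by (auto intro: compact_Int_closed)
    qed
    have Qne: "Q x \<noteq> {}" if "x \<in> space N" for x
      using min_ex[OF that, of UNIV] R[OF that] unfolding Q_def by auto
    have Qhit: "{x \<in> space N. Q x \<inter> C \<noteq> {}} \<in> sets N" if C: "closed C" for C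
    proof -
      have eq: "Q x \<inter> C \<noteq> {} \<longleftrightarrow> R x \<inter> C \<noteq> {} \<and>
         (\<forall>r\<in>\<rat>. R x \<inter> {u. u $ i \<le> r} \<noteq> {} \<longrightarrow> R x \<inter> (C \<inter> {u. u $ i \<le> r}) \<noteq> {})" (is "?L \<longleftrightarrow> ?R")
        if x: "x \<in> space N" for x
      proof
        assume ?L then show ?R unfolding Q_def by fastforce
      next
        assume r: ?R
        obtain u where u: "u \<in> R x" "u \<in> C" "\<forall>v\<in>R x \<inter> C. u $ i \<le> v $ i" using min_ex[OF x C] r by auto
        \<comment> \<open>\<open>u\<close> is minimal on \<open>R x \<inter> C\<close> only. A
          smaller value on \<open>R x\<close> would be separated from it by a rational level, and
          the condition at that level produces a point of \<open>C\<close> below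
          \<open>u\<close>.\<close>
        have "u $ i \<le> v $ i" if v: "v \<in> R x" for v
        proof (rule ccontr)
          assume "\<not> u $ i \<le> v $ i"
          then obtain r where "r \<in> \<rat>" "v $ i < r" "r < u $ i" using Rats_dense_in_real[of "v $ i" "u $ i"] by auto
          with r v have "R x \<inter> (C \<inter> {u. u $ i \<le> r}) \<noteq> {}" by fastforce
          then obtain u' where "u' \<in> R x \<inter> C" "u' $ i \<le> r" by blast
          with u(3) \<open>r < u $ i\<close> show False by force
        qed
        then show ?L using u unfolding Q_def by blast
      qed
      have "{x \<in> space N. Q x \<inter> C \<noteq> {}} = {x \<in> space N. R x \<inter> C \<noteq> {} \<and>
         (\<forall>r\<in>\<rat>. R x \<inter> {u. u $ i \<le> r} \<noteq> {} \<longrightarrow> R x \<inter> (C \<inter> {u. u $ i \<le> r}) \<noteq> {})}"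
        using eq by blast
      also have "\<dots> \<in> sets N"
        using Rhit closed_half C countable_rat
        by (intro sets.sets_Collect sets.sets_Collect_countable_All' Rhit closed_Int) auto
      finally show ?thesis .
    qed
    show ?case
    proof (rule exI[of _ Q], rule conjI)
      show "\<forall>x\<in>space N. compact (Q x) \<and> Q x \<noteq> {} \<and> Q x \<subseteq> S x \<and>
          (\<forall>j\<in>insert i I. \<forall>u\<in>Q x. \<forall>v\<in>Q x. u $ j = v $ j)"
      proof (intro ballI conjI)
        fix x assume x: "x \<in> space N"
        show "compact (Q x)" "Q x \<noteq> {}" using Qc Qne x by blast+
        show "Q x \<subseteq> S x" using R[OF x] unfolding Q_def by blast
        fix j u v assume uv: "j \<in> insert i I" "u \<in> Q x" "v \<in> Q x"
        have le: "u $ i \<le> v $ i" "v $ i \<le> u $ i" and uvR: "u \<in> R x" "v \<in> R x"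
          using uv(2,3) unfolding Q_def by simp_all
        have "\<forall>i\<in>I. \<forall>u\<in>R x. \<forall>v\<in>R x. u $ i = v $ i" using R[OF x] by (elim conjE)
        then show "u $ j = v $ j" using uv(1) uvR le by auto
      qed
      show "\<forall>C. closed C \<longrightarrow> {x \<in> space N. Q x \<inter> C \<noteq> {}} \<in> sets N" using Qhit by blast
    qed
  qed
  from this[of UNIV] obtain R where
    R': "\<forall>x\<in>space N. compact (R x) \<and> R x \<noteq> {} \<and> R x \<subseteq> S x \<and> (\<forall>i\<in>UNIV. \<forall>u\<in>R x. \<forall>v\<in>R x. u $ i = v $ i)"
    and Rhit': "\<forall>C. closed C \<longrightarrow> {x \<in> space N. R x \<inter> C \<noteq> {}} \<in> sets N"
    by (elim exE conjE)
  note Rhit = Rhit'[rule_format]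
  have R: "R x \<noteq> {} \<and> R x \<subseteq> S x \<and> (\<forall>u\<in>R x. \<forall>v\<in>R x. u = v)" if "x \<in> space N" for x
  proof -
    note RR = bspec[OF R' that]
    have "u = v" if uv: "u \<in> R x" "v \<in> R x" for u v
    proof (subst vec_eq_iff, rule allI)
      fix i
      from RR have "\<forall>i\<in>UNIV. \<forall>u\<in>R x. \<forall>v\<in>R x. u $ i = v $ i" by (elim conjE)
      from bspec[OF bspec[OF bspec[OF this UNIV_I] uv(1)] uv(2)] show "u $ i = v $ i" .
    qed
    with RR show ?thesis by (intro conjI ballI) (elim conjE, assumption | assumption)+
  qed
  define k where "k x = (SOME u. u \<in> R x)" for x
  have k: "k x \<in> R x" "R x = {k x}" if "x \<in> space N" for x
  proof -
    show "k x \<in> R x" unfolding k_def using R[OF that] by (simp add: some_in_eq)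
    then show "R x = {k x}" using R[OF that] by blast
  qed
  show thesis
  proof
    show "k \<in> borel_measurable N"
    proof (rule borel_measurableI)
      fix U :: "(real^'m) set" assume "open U"
      then have "{x \<in> space N. R x \<inter> (- U) \<noteq> {}} \<in> sets N" by (intro Rhit) auto
      then have "space N - {x \<in> space N. R x \<inter> (- U) \<noteq> {}} \<in> sets N" by blast
      also have "space N - {x \<in> space N. R x \<inter> (- U) \<noteq> {}} = k -` U \<inter> space N" using k by auto
      finally show "k -` U \<inter> space N \<in> sets N" .
    qed
    show "\<And>x. x \<in> space N \<Longrightarrow> k x \<in> S x" using k R by blast
  qed
qed

section \<open>Uniform linearization\<close>

lemma smooth_onE:
  assumes "smooth_on S f"
  obtains f' where "\<And>x. x \<in> S \<Longrightarrow> (f has_derivative f' x) (at x within S)"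
    "\<And>v. continuous_on S (\<lambda>x. f' x v)"
proof -
  have "Ck_on (Suc 0) S f" using assms unfolding smooth_on_def by blast
  then show thesis using that by auto
qed

lemma smooth_on_continuous: "smooth_on S f \<Longrightarrow> continuous_on S f"
  unfolding smooth_on_def using Ck_on.simps(1) by blast

text \<open>Expanding \<open>v\<close> in the basis leaves finitely many terms, each a coordinate of
  \<open>v\<close> times a function continuous in \<open>x\<close>.\<close>

lemma linear_family_continuous:
  fixes f' :: "'a::euclidean_space \<Rightarrow> 'c::euclidean_space \<Rightarrow> 'b::real_normed_vector"
  assumes lin: "\<And>x. x \<in> S \<Longrightarrow> linear (f' x)" and cont: "\<And>v. continuous_on S (\<lambda>x. f' x v)"
  shows "continuous_on (S \<times> UNIV) (\<lambda>(x, v). f' x v)"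
proof (rule continuous_on_eq)
  have "continuous_on (S \<times> UNIV) (\<lambda>z. f' (fst z) b)" for b
    by (rule continuous_on_compose2[OF cont]) (auto intro!: continuous_intros)
  then show "continuous_on (S \<times> UNIV) (\<lambda>z. \<Sum>b\<in>Basis. (snd z \<bullet> b) *\<^sub>R f' (fst z) b)"
    by (intro continuous_intros)
  fix z assume "z \<in> S \<times> (UNIV :: 'c set)"
  then have "linear (f' (fst z))" using lin by auto
  then have "f' (fst z) (\<Sum>b\<in>Basis. (snd z \<bullet> b) *\<^sub>R b) = (\<Sum>b\<in>Basis. (snd z \<bullet> b) *\<^sub>R f' (fst z) b)"
    by (simp add: linear_sum linear_cmul)
  then show "(\<Sum>b\<in>Basis. (snd z \<bullet> b) *\<^sub>R f' (fst z) b) = (case z of (x, v) \<Rightarrow> f' x v)"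
    by (simp add: euclidean_representation split_beta)
qed

lemma compact_norm_bound:
  assumes "compact K" "continuous_on K f"
  obtains C where "C > 0" "\<And>x. x \<in> K \<Longrightarrow> norm (f x) \<le> C"
proof -
  have "bounded (f ` K)" using assms by (intro compact_imp_bounded compact_continuous_image)
  then show thesis using that unfolding bounded_pos by auto
qed

lemma linear_family_bounded:
  fixes f' :: "'a::euclidean_space \<Rightarrow> 'c::euclidean_space \<Rightarrow> 'b::real_normed_vector"
  assumes lin: "\<And>x. x \<in> S \<Longrightarrow> linear (f' x)" and cont: "\<And>v. continuous_on S (\<lambda>x. f' x v)"
    and K: "compact K" "K \<subseteq> S"
  obtains C where "C > 0" "\<And>x v. x \<in> K \<Longrightarrow> norm (f' x v) \<le> C * norm v"
proof -
  have "continuous_on (K \<times> sphere 0 1) (\<lambda>(x, v). f' x v)"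
    using K by (intro continuous_on_subset[OF linear_family_continuous[OF lin cont]]) auto
  moreover have "compact (K \<times> sphere (0::'c) 1)" using K by (intro compact_Times) auto
  ultimately obtain C where C: "C > 0" "\<And>z. z \<in> K \<times> sphere 0 1 \<Longrightarrow> norm (case z of (x, v) \<Rightarrow> f' x v) \<le> C"
    using compact_norm_bound by blast
  show thesis
  proof (rule that[OF C(1)])
    fix x v assume x: "x \<in> K"
    show "norm (f' x v) \<le> C * norm v"
    proof (cases "v = 0")
      case True then show ?thesis using lin[of x] x K linear_0 by fastforce
    next
      case False
      have "norm (f' x (v /\<^sub>R norm v)) \<le> C" using C(2)[of "(x, v /\<^sub>R norm v)"] x False by auto
      moreover have "f' x (v /\<^sub>R norm v) = f' x v /\<^sub>R norm v" using lin[of x] x K by (auto simp: linear_cmul)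
      ultimately show ?thesis using False by (simp add: field_simps)
    qed
  qed
qed

text \<open>The derivative is uniformly continuous on a compact enlargement of \<open>K\<close>, and
  the mean value inequality turns its oscillation into the linearisation error. Convexity of
  \<open>S\<close> keeps segments inside, which covers the boundary time 0.\<close>

lemma C1_uniform_linearization:
  fixes f :: "'a::euclidean_space \<Rightarrow> 'b::real_normed_vector"
  assumes S: "convex S" "closed S"
    and der: "\<And>x. x \<in> S \<Longrightarrow> (f has_derivative f' x) (at x within S)"
    and cont: "\<And>v. continuous_on S (\<lambda>x. f' x v)"
    and K: "compact K" "K \<subseteq> S" and e: "e > 0"
  obtains d where "d > 0"
    "\<And>x y. x \<in> K \<Longrightarrow> y \<in> S \<Longrightarrow> norm (y - x) < d \<Longrightarrow> norm (f y - f x - f' x (y - x)) \<le> e * norm (y - x)"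
proof -
  obtain R where R: "\<And>x. x \<in> K \<Longrightarrow> norm x \<le> R" using compact_imp_bounded[OF K(1)] unfolding bounded_iff by auto
  \<comment> \<open>Segments start in \<open>K\<close> but may leave it; since
    \<open>d \<le> 1\<close>, one extra unit of radius contains them.\<close>
  define K1 where "K1 = S \<inter> cball 0 (R + 1)"
  have K1: "compact K1" unfolding K1_def using S by (intro closed_Int_compact) auto
  have "\<exists>d>0. \<forall>x\<in>K1. \<forall>y\<in>K1. dist y x < d \<longrightarrow> dist (f' y b) (f' x b) < e / DIM('a)" for b
  proof -
    have "K1 \<subseteq> S" unfolding K1_def by blast
    then have "uniformly_continuous_on K1 (\<lambda>x. f' x b)"
      by (intro compact_uniformly_continuous[OF _ K1] continuous_on_subset[OF cont])
    moreover have "e / DIM('a) > 0" using e by simp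
    ultimately show ?thesis unfolding uniformly_continuous_on_def by blast
  qed
  then obtain dd where dd: "\<And>b. dd b > 0"
    "\<And>b x y. x \<in> K1 \<Longrightarrow> y \<in> K1 \<Longrightarrow> dist y x < dd b \<Longrightarrow> dist (f' y b) (f' x b) < e / DIM('a)" by metis
  define d where "d = min 1 (Min (dd ` Basis))"
  have d: "d > 0" "d \<le> 1" "\<And>b. b \<in> Basis \<Longrightarrow> d \<le> dd b"
    unfolding d_def using dd(1) by (auto simp: min_le_iff_disj)
  show thesis
  proof (rule that[OF d(1)])
    fix x y assume x: "x \<in> K" and y: "y \<in> S" "norm (y - x) < d"
    define T where "T = S \<inter> ball x d"
    have xT: "x \<in> T" "y \<in> T" using x y K d unfolding T_def by (auto simp: dist_norm norm_minus_commute)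
    have "convex T" unfolding T_def using S by (intro convex_Int convex_ball)
    have TK1: "T \<subseteq> K1"
    proof
      fix z assume "z \<in> T"
      then have "z \<in> S" "norm (z - x) < d" unfolding T_def by (auto simp: dist_norm norm_minus_commute)
      moreover have "norm z \<le> norm (z - x) + norm x" using norm_triangle_ineq[of "z - x" x] by simp
      ultimately show "z \<in> K1" using R[OF x] d unfolding K1_def by auto
    qed
    have der': "(f has_derivative f' z) (at z within T)" if "z \<in> T" for z
      using that der unfolding T_def by (auto intro: has_derivative_subset)
    have "norm (f y - f x - f' x (y - x)) \<le> norm (y - x) * e"
    proof (rule differentiable_bound_linearization[where S = T])
      show "x + t *\<^sub>R (y - x) \<in> T" if "t \<in> {0..1}" for t
        using \<open>convex T\<close> xT that unfolding convex_alt by (auto simp: algebra_simps)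
      fix z assume z: "z \<in> T"
      have "bounded_linear (f' z - f' x)"
        using der'[OF z] der'[OF xT(1)] has_derivative_bounded_linear bounded_linear_sub
        by (fastforce simp: fun_diff_def)
      \<comment> \<open>The operator norm is at most the sum over the basis, hence the tolerance
        \<open>e / DIM('a)\<close> for each direction.\<close>
      then have "onorm (f' z - f' x) \<le> (\<Sum>b\<in>Basis. norm ((f' z - f' x) b))"
        by (rule onorm_componentwise)
      also have "\<dots> \<le> (\<Sum>b\<in>(Basis::'a set). e / DIM('a))"
      proof (rule sum_mono)
        fix b :: 'a assume b: "b \<in> Basis"
        have "dist z x < dd b" using z d(3)[OF b] unfolding T_def by (auto simp: dist_commute)
        with dd(2)[of x z b] subsetD[OF TK1 xT(1)] subsetD[OF TK1 z]
        have "dist (f' z b) (f' x b) < e / DIM('a)" by blast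
        then show "norm ((f' z - f' x) b) \<le> e / DIM('a)" by (simp add: dist_norm)
      qed
      also have "\<dots> = e" by simp
      finally show "onorm (f' z - f' x) \<le> e" .
    qed (use xT der' in auto)
    then show "norm (f y - f x - f' x (y - x)) \<le> e * norm (y - x)" by (simp add: mult.commute)
  qed
qed

section \<open>Riemannian distance\<close>

lemma bounded_bilinear_matrix_vector_mult:
  "bounded_bilinear ((*v) :: real^'n^'m \<Rightarrow> real^'n \<Rightarrow> real^'m)"
  unfolding bilinear_conv_bounded_bilinear[symmetric] bilinear_def
  by (auto intro!: linearI simp: matrix_vector_right_distrib matrix_vector_mult_add_rdistrib
      matrix_vector_mult_scaleR scaleR_matrix_vector_assoc)

lemmas continuous_on_matrix_vector_mult =
  bounded_bilinear.continuous_on[OF bounded_bilinear_matrix_vector_mult]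

lemma smooth_path_C1:
  assumes "smooth_path a b \<gamma>"
  obtains \<gamma>' where "C1_path \<gamma> \<gamma>'"
proof -
  from assms have "smooth_on {0..1} \<gamma>" unfolding smooth_path_def by blast
  from smooth_onE[OF this] obtain f' where f': "\<And>x. x \<in> {0..1} \<Longrightarrow> (\<gamma> has_derivative f' x) (at x within {0..1})"
    "\<And>v. continuous_on {0..1} (\<lambda>x. f' x v)" by metis
  have "(\<gamma> has_vector_derivative f' x 1) (at x within {0..1})" if "x \<in> {0..1}" for x
  proof -
    have "linear (f' x)" using f'(1)[OF that] has_derivative_linear by blast
    then have "f' x r = r *\<^sub>R f' x 1" for r using linear_cmul[of "f' x" r 1] by simp
    then have "f' x = (\<lambda>r. r *\<^sub>R f' x 1)" by (rule ext)
    with f'(1)[OF that] show ?thesis unfolding has_vector_derivative_def by metis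
  qed
  then show thesis using that[of "\<lambda>x. f' x 1"] f'(2) unfolding C1_path_def by blast
qed

lemma riem_length_C1:
  assumes "C1_path \<gamma> \<gamma>'"
  shows "riem_length M \<gamma> = integral {0..1} (\<lambda>s. sqrt (\<gamma>' s \<bullet> (M (\<gamma> s) *v \<gamma>' s)))"
  unfolding riem_length_def
proof (rule integral_cong)
  fix s :: real assume s: "s \<in> {0..1}"
  then have "vector_derivative \<gamma> (at s within {0..1}) = \<gamma>' s"
    using vector_derivative_within_cbox[of 0 1 s \<gamma> "\<gamma>' s"] assms unfolding C1_path_def by auto
  then show "(let \<gamma>\<^sub>s = vector_derivative \<gamma> (at s within {0..1}) in sqrt (\<gamma>\<^sub>s \<bullet> (M (\<gamma> s) *v \<gamma>\<^sub>s)))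
      = sqrt (\<gamma>' s \<bullet> (M (\<gamma> s) *v \<gamma>' s))" by (simp add: Let_def)
qed

lemma continuous_on_speed:
  fixes M :: "real^'n \<Rightarrow> real^'n^'n"
  assumes "continuous_on UNIV M" "C1_path \<gamma> \<gamma>'"
  shows "continuous_on {0..1} (\<lambda>s. sqrt (\<gamma>' s \<bullet> (M (\<gamma> s) *v \<gamma>' s)))"
    and "continuous_on {0..1} (\<lambda>s. \<gamma>' s \<bullet> (M (\<gamma> s) *v \<gamma>' s))"
proof -
  have "continuous_on {0..1} \<gamma>'" using assms unfolding C1_path_def by blast
  moreover have "continuous_on {0..1} (\<lambda>s. M (\<gamma> s))"
    by (rule continuous_on_compose2[OF assms(1) C1_path_continuous[OF assms(2)]]) auto
  ultimately have "continuous_on {0..1} (\<lambda>s. \<gamma>' s \<bullet> (M (\<gamma> s) *v \<gamma>' s))"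
    by (intro continuous_on_inner continuous_on_matrix_vector_mult)
  then show "continuous_on {0..1} (\<lambda>s. sqrt (\<gamma>' s \<bullet> (M (\<gamma> s) *v \<gamma>' s)))"
    "continuous_on {0..1} (\<lambda>s. \<gamma>' s \<bullet> (M (\<gamma> s) *v \<gamma>' s))"
    by (auto intro: continuous_on_real_sqrt)
qed

section \<open>Smooth paths with polynomial velocity\<close>

lemma polynomial_function_smooth:
  fixes p :: "real \<Rightarrow> 'a::euclidean_space"
  assumes "polynomial_function p"
  shows "Ck_on k S p"
  using assms
proof (induction k arbitrary: p)
  case 0
  then show ?case using continuous_on_polymonial_function by auto
next
  case (Suc k)
  obtain p' where p': "polynomial_function p'" "\<And>x. (p has_vector_derivative p' x) (at x)"
    using has_vector_derivative_polynomial_function[OF Suc.prems] by blast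
  have "Ck_on k S (\<lambda>x. v *\<^sub>R p' x)" for v
    using p'(1) by (intro Suc.IH) auto
  moreover have "(p has_derivative (\<lambda>v. v *\<^sub>R p' x)) (at x within S)" for x
    using p'(2)[of x] unfolding has_vector_derivative_def by (rule has_derivative_at_withinI)
  ultimately show ?case by (auto intro!: exI[of _ "\<lambda>x v. v *\<^sub>R p' x"])
qed

text \<open>Approximating the velocity and integrating controls velocity and position at once; a
  polynomial velocity makes the integral smooth, hence a competitor in
  \<open>riem_dist\<close>.\<close>

lemma polynomial_antiderivative_smooth_path:
  fixes p :: "real \<Rightarrow> real^'n"
  assumes p: "polynomial_function p" and b: "a + integral {0..1} p = b"
  shows "smooth_path a b (\<lambda>s. a + integral {0..s} p)" "C1_path (\<lambda>s. a + integral {0..s} p) p"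
proof -
  have cont: "continuous_on A p" for A using p by (rule continuous_on_polymonial_function)
  have der: "((\<lambda>s. a + integral {0..s} p) has_vector_derivative p s) (at s within {0..1})" if "s \<in> {0..1}" for s
  proof -
    have "((\<lambda>s. integral {0..s} p) has_vector_derivative p s) (at s within {0..1})"
      using that cont by (intro integral_has_vector_derivative) auto
    then show ?thesis by (auto intro!: derivative_eq_intros)
  qed
  then show C1: "C1_path (\<lambda>s. a + integral {0..s} p) p" unfolding C1_path_def using cont by blast
  have "Ck_on k {0..1} (\<lambda>s. a + integral {0..s} p)" for k
  proof (cases k)
    case 0 then show ?thesis using C1_path_continuous[OF C1] by simp
  next
    case (Suc j)
    have "Ck_on j {0..1} (\<lambda>x. v *\<^sub>R p x)" for v using p by (intro polynomial_function_smooth) auto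
    then show ?thesis unfolding Suc using der
      by (auto simp: has_vector_derivative_def intro!: exI[of _ "\<lambda>x v. v *\<^sub>R p x"])
  qed
  then show "smooth_path a b (\<lambda>s. a + integral {0..s} p)"
    unfolding smooth_path_def smooth_on_def using b by simp
qed

lemma riem_length_nonneg:
  assumes "continuous_on UNIV M" "\<And>x v. v \<bullet> (M x *v v) \<ge> 0" "smooth_path a b \<gamma>"
  shows "riem_length M \<gamma> \<ge> 0"
proof -
  obtain \<gamma>' where g: "C1_path \<gamma> \<gamma>'" using smooth_path_C1[OF assms(3)] .
  show ?thesis unfolding riem_length_C1[OF g]
    using assms(2) by (intro integral_nonneg integrable_continuous_real continuous_on_speed[OF assms(1) g]) auto
qed

lemma riem_dist_le_smooth:
  assumes "continuous_on UNIV M" "\<And>x v. v \<bullet> (M x *v v) \<ge> 0" "smooth_path a b \<gamma>"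
  shows "riem_dist M a b \<le> riem_length M \<gamma>"
  unfolding riem_dist_def
  by (rule cInf_lower) (use assms riem_length_nonneg[OF assms(1,2)] in \<open>auto intro!: bdd_belowI2\<close>)

lemma C1_path_close:
  fixes \<gamma> :: "real \<Rightarrow> 'a::euclidean_space"
  assumes "C1_path \<gamma> \<gamma>'" "C1_path \<eta> \<eta>'" "\<gamma> 0 = \<eta> 0" "\<And>s. s \<in> {0..1} \<Longrightarrow> norm (\<gamma>' s - \<eta>' s) \<le> e" "s \<in> {0..1}"
  shows "norm (\<gamma> s - \<eta> s) \<le> e"
proof -
  have "0 \<le> e" using order_trans[OF norm_ge_zero assms(4)[of 0]] by simp
  have "((\<lambda>r. \<gamma>' r - \<eta>' r) has_integral ((\<gamma> s - \<gamma> 0) - (\<eta> s - \<eta> 0))) {0..s}"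
    using C1_path_integral[OF assms(1,5)] C1_path_integral[OF assms(2,5)] by (rule has_integral_diff)
  then have "norm ((\<gamma> s - \<gamma> 0) - (\<eta> s - \<eta> 0)) \<le> e * measure lborel (cbox 0 s)"
    using assms(4,5) \<open>0 \<le> e\<close> by (intro has_integral_bound) (auto simp: box_real)
  also have "\<dots> \<le> e * 1" using assms(5) \<open>0 \<le> e\<close> by (intro mult_left_mono) auto
  finally show ?thesis using assms(3) by simp
qed

text \<open>A C1 path is approximated in the C1 sense by polynomial paths with the same end points.\<close>

lemma riem_dist_le_C1:
  fixes M :: "real^'n \<Rightarrow> real^'n^'n"
  assumes M: "continuous_on UNIV M" "\<And>x v. v \<bullet> (M x *v v) \<ge> 0" and g: "C1_path \<gamma> \<gamma>'"
  shows "riem_dist M (\<gamma> 0) (\<gamma> 1) \<le> integral {0..1} (\<lambda>s. sqrt (\<gamma>' s \<bullet> (M (\<gamma> s) *v \<gamma>' s)))"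
proof (rule field_le_epsilon)
  fix \<epsilon> :: real assume \<epsilon>: "\<epsilon> > 0"
  have cg: "continuous_on {0..1} \<gamma>" "continuous_on {0..1} \<gamma>'"
    using g C1_path_continuous[OF g] unfolding C1_path_def by auto
  obtain R1 where R1: "R1 > 0" "\<And>s. s \<in> {0..1} \<Longrightarrow> norm (\<gamma> s) \<le> R1" using compact_norm_bound[OF compact_Icc cg(1)] by metis
  obtain R2 where R2: "R2 > 0" "\<And>s. s \<in> {0..1} \<Longrightarrow> norm (\<gamma>' s) \<le> R2" using compact_norm_bound[OF compact_Icc cg(2)] by metis
  define q where "q z = sqrt (snd z \<bullet> (M (fst z) *v snd z))" for z :: "(real^'n) \<times> (real^'n)"
  define K where "K = cball (0::real^'n) (R1 + 1) \<times> cball (0::real^'n) (R2 + 1)"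
  have "compact K" unfolding K_def by (intro compact_Times) auto
  moreover have "continuous_on K q" unfolding q_def
    by (intro continuous_on_real_sqrt continuous_on_inner continuous_on_matrix_vector_mult continuous_on_compose2[OF M(1)])
      (auto intro!: continuous_intros)
  ultimately have "uniformly_continuous_on K q" by (intro compact_uniformly_continuous)
  then obtain d where d: "d > 0" "\<And>z z'. z \<in> K \<Longrightarrow> z' \<in> K \<Longrightarrow> dist z' z < d \<Longrightarrow> dist (q z') (q z) < \<epsilon>"
    unfolding uniformly_continuous_on_def using \<epsilon> by metis
  \<comment> \<open>Position and velocity will each move by at most \<open>2 * e\<close>:
    \<open>4 * e < d\<close> gives closeness in the product, and \<open>2 * e \<le> 1\<close> keeps
    the approximation in \<open>K\<close>.\<close>
  define e where "e = min (1/2) (d / 5)"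
  have e: "e > 0" "2 * e \<le> 1" "4 * e < d" unfolding e_def using d(1) by auto
  obtain p0 where p0: "polynomial_function p0" "\<And>s. s \<in> {0..1} \<Longrightarrow> norm (\<gamma>' s - p0 s) < e"
    using Stone_Weierstrass_polynomial_function[OF compact_Icc cg(2) e(1)] by blast
  have ip0: "p0 integrable_on {0..1}" using continuous_on_polymonial_function[OF p0(1)] by (intro integrable_continuous_real)
  \<comment> \<open>\<open>c\<close> is the end point error left by integrating \<open>p0\<close>;
    adding it to the velocity restores the end point at the cost of another
    \<open>e\<close>.\<close>
  define c where "c = integral {0..1} (\<lambda>s. \<gamma>' s - p0 s)"
  have ig: "(\<gamma>' has_integral (\<gamma> 1 - \<gamma> 0)) {0..1}" using C1_path_integral[OF g, of 1] by simp
  have cc: "c = (\<gamma> 1 - \<gamma> 0) - integral {0..1} p0"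
    unfolding c_def using integral_diff[OF has_integral_integrable[OF ig] ip0] integral_unique[OF ig] by simp
  have "norm c \<le> integral {0..1::real} (\<lambda>s. e)"
    unfolding c_def using p0(2) by (intro integral_norm_bound_integral integrable_diff has_integral_integrable[OF ig] ip0) (auto intro: less_imp_le)
  then have nc: "norm c \<le> e" by simp
  define p where "p s = p0 s + c" for s
  have p: "polynomial_function p" unfolding p_def using p0(1) by auto
  have "integral {0..1} p = integral {0..1} p0 + c" unfolding p_def by (subst integral_add) (use ip0 in auto)
  then have pe: "\<gamma> 0 + integral {0..1} p = \<gamma> 1" using cc by simp
  define \<eta> where "\<eta> s = \<gamma> 0 + integral {0..s} p" for s
  have eta: "smooth_path (\<gamma> 0) (\<gamma> 1) \<eta>" "C1_path \<eta> p"
    unfolding \<eta>_def using polynomial_antiderivative_smooth_path[OF p pe] by auto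
  have cl': "norm (p s - \<gamma>' s) \<le> 2 * e" if "s \<in> {0..1}" for s
  proof -
    have "norm (p s - \<gamma>' s) \<le> norm (p0 s - \<gamma>' s) + norm c"
      unfolding p_def using norm_triangle_ineq[of "p0 s - \<gamma>' s" c] by (simp add: algebra_simps)
    then show ?thesis using p0(2)[OF that] nc by (simp add: norm_minus_commute)
  qed
  have cl: "norm (\<eta> s - \<gamma> s) \<le> 2 * e" if "s \<in> {0..1}" for s
    using C1_path_close[OF eta(2) g _ cl' that] by (simp add: \<eta>_def)
  have pt: "q (\<eta> s, p s) \<le> q (\<gamma> s, \<gamma>' s) + \<epsilon>" if s: "s \<in> {0..1}" for s
  proof -
    have "norm (\<eta> s) \<le> norm (\<eta> s - \<gamma> s) + norm (\<gamma> s)" "norm (p s) \<le> norm (p s - \<gamma>' s) + norm (\<gamma>' s)"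
      using norm_triangle_ineq[of "\<eta> s - \<gamma> s" "\<gamma> s"] norm_triangle_ineq[of "p s - \<gamma>' s" "\<gamma>' s"] by auto
    then have "(\<eta> s, p s) \<in> K" "(\<gamma> s, \<gamma>' s) \<in> K"
      unfolding K_def using cl[OF s] cl'[OF s] R1(2)[OF s] R2(2)[OF s] e by auto
    moreover have "dist (\<eta> s, p s) (\<gamma> s, \<gamma>' s) \<le> dist (\<eta> s) (\<gamma> s) + dist (p s) (\<gamma>' s)"
      unfolding dist_prod_def by (simp add: sqrt_sum_squares_le_sum)
    then have "dist (\<eta> s, p s) (\<gamma> s, \<gamma>' s) < d" using cl[OF s] cl'[OF s] e by (simp add: dist_norm)
    ultimately have "dist (q (\<eta> s, p s)) (q (\<gamma> s, \<gamma>' s)) < \<epsilon>" using d(2) by blast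
    then show ?thesis by (simp add: dist_real_def)
  qed
  have "riem_dist M (\<gamma> 0) (\<gamma> 1) \<le> integral {0..1} (\<lambda>s. sqrt (p s \<bullet> (M (\<eta> s) *v p s)))"
    using riem_dist_le_smooth[OF M eta(1)] unfolding riem_length_C1[OF eta(2)] .
  also have "\<dots> \<le> integral {0..1} (\<lambda>s. sqrt (\<gamma>' s \<bullet> (M (\<gamma> s) *v \<gamma>' s)) + \<epsilon>)"
    using pt continuous_on_speed(1)[OF M(1) eta(2)] continuous_on_speed(1)[OF M(1) g]
    by (intro integral_le integrable_continuous_real continuous_on_add continuous_on_const) (auto simp: q_def)
  also have "\<dots> = integral {0..1} (\<lambda>s. sqrt (\<gamma>' s \<bullet> (M (\<gamma> s) *v \<gamma>' s))) + \<epsilon>"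
    using continuous_on_speed(1)[OF M(1) g] by (subst integral_add) (auto intro: integrable_continuous_real)
  finally show "riem_dist M (\<gamma> 0) (\<gamma> 1) \<le> integral {0..1} (\<lambda>s. sqrt (\<gamma>' s \<bullet> (M (\<gamma> s) *v \<gamma>' s))) + \<epsilon>" .
qed

text \<open>The energy has no square root, so the energy of a transported path can be expanded to
  first order even where its velocity vanishes. At the start of the transport the speed bound in
  \<open>lifted\<close> makes it at most \<open>D\<^sup>2\<close>.\<close>

lemma riem_dist_sq_le_energy:
  fixes M :: "real^'n \<Rightarrow> real^'n^'n"
  assumes M: "continuous_on UNIV M" "\<And>x v. v \<bullet> (M x *v v) \<ge> 0" and g: "C1_path \<gamma> \<gamma>'"
    and "riem_dist M (\<gamma> 0) (\<gamma> 1) \<ge> 0"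
  shows "(riem_dist M (\<gamma> 0) (\<gamma> 1))\<^sup>2 \<le> integral {0..1} (\<lambda>s. \<gamma>' s \<bullet> (M (\<gamma> s) *v \<gamma>' s))"
proof -
  have "(riem_dist M (\<gamma> 0) (\<gamma> 1))\<^sup>2 \<le> (integral {0..1} (\<lambda>s. sqrt (\<gamma>' s \<bullet> (M (\<gamma> s) *v \<gamma>' s))))\<^sup>2"
    using riem_dist_le_C1[OF M g] assms(4) by (rule power_mono)
  also have "\<dots> \<le> integral {0..1} (\<lambda>s. (sqrt (\<gamma>' s \<bullet> (M (\<gamma> s) *v \<gamma>' s)))\<^sup>2)"
    by (rule square_integral_le_integral_square[OF continuous_on_speed(1)[OF M(1) g]])
  also have "\<dots> = integral {0..1} (\<lambda>s. \<gamma>' s \<bullet> (M (\<gamma> s) *v \<gamma>' s))"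
    using M(2) by simp
  finally show ?thesis .
qed

lemma affine_smooth_path: "smooth_path a b (\<lambda>s. a + s *\<^sub>R (b - a))" "C1_path (\<lambda>s. a + s *\<^sub>R (b - a)) (\<lambda>_. b - a)"
proof -
  have "polynomial_function (\<lambda>s::real. b - a)" by blast
  from polynomial_antiderivative_smooth_path[OF this, of a b]
  have *: "smooth_path a b (\<lambda>s. a + integral {0..s} (\<lambda>_. b - a))" by simp
  have "Ck_on k {0..1} (\<lambda>s. a + s *\<^sub>R (b - a))" for k
    by (intro polynomial_function_smooth) auto
  then show "smooth_path a b (\<lambda>s. a + s *\<^sub>R (b - a))" unfolding smooth_path_def smooth_on_def by simp
  show "C1_path (\<lambda>s. a + s *\<^sub>R (b - a)) (\<lambda>_. b - a)"
    unfolding C1_path_def by (auto intro!: derivative_eq_intros)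
qed

lemma riem_dist_nonneg:
  assumes "continuous_on UNIV M" "\<And>x v. v \<bullet> (M x *v v) \<ge> 0"
  shows "riem_dist M a b \<ge> 0"
  unfolding riem_dist_def
  by (rule cInf_greatest) (use affine_smooth_path(1)[of a b] riem_length_nonneg[OF assms] in auto)

text \<open>The straight segment stays in the ball on which the metric is bounded.\<close>

lemma riem_dist_le_norm:
  fixes M :: "real^'n \<Rightarrow> real^'n^'n"
  assumes M: "continuous_on UNIV M" "\<And>x v. v \<bullet> (M x *v v) \<ge> 0"
    and C: "C \<ge> 0" "\<And>x v. norm x \<le> R \<Longrightarrow> v \<bullet> (M x *v v) \<le> C\<^sup>2 * (norm v)\<^sup>2"
    and ab: "norm a \<le> R" "norm b \<le> R"
  shows "riem_dist M a b \<le> C * norm (b - a)"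
proof -
  let ?\<gamma> = "\<lambda>s. a + s *\<^sub>R (b - a)"
  have "norm (?\<gamma> s) \<le> R" if "s \<in> {0..1}" for s
  proof -
    have "convex (cball (0::real^'n) R)" by simp
    then have "?\<gamma> s \<in> cball 0 R" using ab that unfolding convex_alt by (force simp: algebra_simps)
    then show ?thesis by simp
  qed
  then have "sqrt ((b - a) \<bullet> (M (?\<gamma> s) *v (b - a))) \<le> C * norm (b - a)" if "s \<in> {0..1}" for s
    using C that by (intro real_le_lsqrt) (auto simp: power_mult_distrib)
  then have "integral {0..1} (\<lambda>s. sqrt ((b - a) \<bullet> (M (?\<gamma> s) *v (b - a)))) \<le> integral {0..1::real} (\<lambda>s. C * norm (b - a))"
    using continuous_on_speed(1)[OF M(1) affine_smooth_path(2)]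
    by (intro integral_le integrable_continuous_real continuous_on_const) auto
  then show ?thesis using riem_dist_le_C1[OF M affine_smooth_path(2)[of a b]] by simp
qed

text \<open>This C1 ramp is the building block of the clocks that concatenate two paths.\<close>

lemma has_field_derivative_square_pos_part:
  "((\<lambda>x::real. (max 0 x)\<^sup>2) has_field_derivative 2 * max 0 x) (at x within S)"
proof -
  have "((\<lambda>x::real. (max 0 x)\<^sup>2) has_field_derivative 2 * max 0 x) (at x)"
  proof (cases "x = 0")
    case True
    have "isCont (\<lambda>z::real. max 0 z) 0" by (intro continuous_intros)
    moreover have "(max 0 z)\<^sup>2 = max 0 z * z" for z :: real by (auto simp: max_def power2_eq_square)
    ultimately show ?thesis using True by (subst CARAT_DERIV) (auto intro!: exI[of _ "\<lambda>z. max 0 z"])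
  next
    case False
    show ?thesis
    proof (cases "x > 0")
      case True
      have "((\<lambda>x::real. x\<^sup>2) has_field_derivative 2 * x) (at x)" by (auto intro!: derivative_eq_intros)
      then have "((\<lambda>x::real. (max 0 x)\<^sup>2) has_field_derivative 2 * x) (at x)"
        by (rule has_field_derivative_transform_within_open[where S = "{0<..}"]) (use True in auto)
      then show ?thesis using True by simp
    next
      case f: False
      have "((\<lambda>x::real. 0) has_field_derivative 0) (at x)" by simp
      then have "((\<lambda>x::real. (max 0 x)\<^sup>2) has_field_derivative 0) (at x)"
        by (rule has_field_derivative_transform_within_open[where S = "{..<0}"]) (use f False in \<open>auto simp: max_def\<close>)
      then show ?thesis using f by simp
    qed
  qed
  then show ?thesis by (rule has_field_derivative_at_within)
qed

text \<open>
  The two paths are run through one after the other by C1 clocks \<open>\<theta>\<^sub>1\<close>, \<open>\<theta>\<^sub>2\<close> that rest on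
  \<open>[1/2,1]\<close> and \<open>[0,1/2]\<close>, so the concatenation is again C1.
\<close>

lemma riem_dist_triangle:
  fixes M :: "real^'n \<Rightarrow> real^'n^'n"
  assumes M: "continuous_on UNIV M" "\<And>x v. v \<bullet> (M x *v v) \<ge> 0"
  shows "riem_dist M a c \<le> riem_dist M a b + riem_dist M b c"
proof (rule field_le_epsilon)
  fix \<epsilon> :: real assume \<epsilon>: "\<epsilon> > 0"
  have near: "\<exists>\<gamma>. smooth_path p q \<gamma> \<and> riem_length M \<gamma> < riem_dist M p q + \<epsilon> / 2" for p q
  proof (rule ccontr)
    assume "\<not> ?thesis"
    then have "\<And>\<gamma>. smooth_path p q \<gamma> \<Longrightarrow> riem_dist M p q + \<epsilon> / 2 \<le> riem_length M \<gamma>" by force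
    then have "riem_dist M p q + \<epsilon> / 2 \<le> riem_dist M p q"
      unfolding riem_dist_def[of M p q] using affine_smooth_path(1)[of p q] by (intro cInf_greatest) auto
    then show False using \<epsilon> by simp
  qed
  obtain \<gamma>1 where g1: "smooth_path a b \<gamma>1" "riem_length M \<gamma>1 < riem_dist M a b + \<epsilon> / 2" using near by blast
  obtain \<gamma>2 where g2: "smooth_path b c \<gamma>2" "riem_length M \<gamma>2 < riem_dist M b c + \<epsilon> / 2" using near by blast
  obtain d1 where d1: "C1_path \<gamma>1 d1" using smooth_path_C1[OF g1(1)] .
  obtain d2 where d2: "C1_path \<gamma>2 d2" using smooth_path_C1[OF g2(1)] .
  \<comment> \<open>The factor 4 normalises \<open>(1/2)\<^sup>2\<close>: each clock runs from 0 to
    1 within half of the interval and has velocity 0 at the switch.\<close>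
  define \<theta>1 where "\<theta>1 s = 1 - 4 * (max 0 (1/2 - s))\<^sup>2" for s :: real
  define \<theta>1' where "\<theta>1' s = 8 * max 0 (1/2 - s)" for s :: real
  define \<theta>2 where "\<theta>2 s = 4 * (max 0 (s - 1/2))\<^sup>2" for s :: real
  define \<theta>2' where "\<theta>2' s = 8 * max 0 (s - 1/2)" for s :: real
  have D1: "(\<theta>1 has_field_derivative \<theta>1' s) (at s within {0..1})" for s
  proof -
    have "((\<lambda>s. 1/2 - s) has_field_derivative -1) (at s within {0..1})" by (auto intro!: derivative_eq_intros)
    from DERIV_diff[OF DERIV_const[of 1] DERIV_cmult[OF DERIV_chain2[OF has_field_derivative_square_pos_part this], of 4]]
    show ?thesis unfolding \<theta>1_def[abs_def] \<theta>1'_def by simp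
  qed
  have D2: "(\<theta>2 has_field_derivative \<theta>2' s) (at s within {0..1})" for s
  proof -
    have "((\<lambda>s. s - 1/2) has_field_derivative 1) (at s within {0..1})" by (auto intro!: derivative_eq_intros)
    from DERIV_cmult[OF DERIV_chain2[OF has_field_derivative_square_pos_part this], of 4]
    show ?thesis unfolding \<theta>2_def[abs_def] \<theta>2'_def by simp
  qed
  have C: "C1_path \<theta>1 \<theta>1'" "C1_path \<theta>2 \<theta>2'"
    unfolding C1_path_def using D1 D2
    by (auto simp: has_real_derivative_iff_has_vector_derivative \<theta>1'_def \<theta>2'_def intro!: continuous_intros)
  have sq: "(max 0 x)\<^sup>2 \<le> 1/4" if "x \<le> 1/2" for x :: real
  proof -
    have "(max 0 x)\<^sup>2 \<le> (1/2)\<^sup>2" using that by (intro power_mono) auto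
    then show ?thesis by (simp add: power2_eq_square)
  qed
  have R1: "\<theta>1 s \<in> {0..1}" if "s \<in> {0..1}" for s using sq[of "1/2 - s"] that unfolding \<theta>1_def by auto
  have R2: "\<theta>2 s \<in> {0..1}" if "s \<in> {0..1}" for s using sq[of "s - 1/2"] that unfolding \<theta>2_def by auto
  have ends: "\<theta>1 0 = 0" "\<theta>1 1 = 1" "\<theta>2 0 = 0" "\<theta>2 1 = 1"
    unfolding \<theta>1_def \<theta>2_def by (auto simp: max_def power2_eq_square)
  \<comment> \<open>At every time one of the two summands rests at the common point
    \<open>b\<close>, which is subtracted once.\<close>
  define \<gamma> where "\<gamma> s = \<gamma>1 (\<theta>1 s) + \<gamma>2 (\<theta>2 s) - b" for s
  define \<gamma>' where "\<gamma>' s = \<theta>1' s *\<^sub>R d1 (\<theta>1 s) + \<theta>2' s *\<^sub>R d2 (\<theta>2 s)" for s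
  have e1: "C1_path (\<lambda>s. \<gamma>1 (\<theta>1 s)) (\<lambda>s. \<theta>1' s *\<^sub>R d1 (\<theta>1 s))" by (rule C1_path_compose[OF d1 C(1) R1])
  have e2: "C1_path (\<lambda>s. \<gamma>2 (\<theta>2 s)) (\<lambda>s. \<theta>2' s *\<^sub>R d2 (\<theta>2 s))" by (rule C1_path_compose[OF d2 C(2) R2])
  have g: "C1_path \<gamma> \<gamma>'"
    using e1 e2 unfolding C1_path_def \<gamma>_def \<gamma>'_def
    by (auto intro!: continuous_on_add has_vector_derivative_add simp: has_vector_derivative_diff_const)
  define h1 where "h1 s = sqrt (d1 s \<bullet> (M (\<gamma>1 s) *v d1 s))" for s
  define h2 where "h2 s = sqrt (d2 s \<bullet> (M (\<gamma>2 s) *v d2 s))" for s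
  have i1: "((\<lambda>s. \<theta>1' s * h1 (\<theta>1 s)) has_integral riem_length M \<gamma>1) {0..1}"
    using has_integral_substitution[of 0 1 \<theta>1 0 1 h1 \<theta>1'] R1 D1 ends continuous_on_speed(1)[OF M(1) d1]
    by (auto simp: h1_def[abs_def] riem_length_C1[OF d1] image_subset_iff)
  have i2: "((\<lambda>s. \<theta>2' s * h2 (\<theta>2 s)) has_integral riem_length M \<gamma>2) {0..1}"
    using has_integral_substitution[of 0 1 \<theta>2 0 1 h2 \<theta>2'] R2 D2 ends continuous_on_speed(1)[OF M(1) d2]
    by (auto simp: h2_def[abs_def] riem_length_C1[OF d2] image_subset_iff)
  have b: "\<gamma>1 1 = b" "\<gamma>2 0 = b" using g1 g2 unfolding smooth_path_def by auto
  have pt: "sqrt (\<gamma>' s \<bullet> (M (\<gamma> s) *v \<gamma>' s)) = \<theta>1' s * h1 (\<theta>1 s) + \<theta>2' s * h2 (\<theta>2 s)" for s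
  proof (cases "s \<le> 1/2")
    case True
    then have "\<theta>2 s = 0" "\<theta>2' s = 0" "\<theta>1' s \<ge> 0" unfolding \<theta>2_def \<theta>2'_def \<theta>1'_def by auto
    then show ?thesis using b by (simp add: \<gamma>_def \<gamma>'_def h1_def matrix_vector_mult_scaleR real_sqrt_mult)
  next
    case False
    then have "\<theta>1 s = 1" "\<theta>1' s = 0" "\<theta>2' s \<ge> 0" unfolding \<theta>1_def \<theta>1'_def \<theta>2'_def by auto
    then show ?thesis using b by (simp add: \<gamma>_def \<gamma>'_def h2_def matrix_vector_mult_scaleR real_sqrt_mult)
  qed
  have "\<gamma> 0 = a" "\<gamma> 1 = c" using g1 g2 b ends unfolding \<gamma>_def smooth_path_def by auto
  then have "riem_dist M a c \<le> riem_length M \<gamma>1 + riem_length M \<gamma>2"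
    using riem_dist_le_C1[OF M g] integral_unique[OF has_integral_add[OF i1 i2]] unfolding pt by simp
  then show "riem_dist M a c \<le> riem_dist M a b + riem_dist M b c + \<epsilon>" using g1 g2 by simp
qed

section \<open>The matrix inequality\<close>

text \<open>Fixes one derivative field on \<open>S\<close>, boundary points included, whose value in
  each direction is continuous; the differentials of the data can then be named by
  constants.\<close>

definition deriv_on :: "'a::euclidean_space set \<Rightarrow> ('a \<Rightarrow> 'b::real_normed_vector) \<Rightarrow> 'a \<Rightarrow> 'a \<Rightarrow> 'b" where
  "deriv_on S f = (SOME f'. (\<forall>x\<in>S. (f has_derivative f' x) (at x within S)) \<and> (\<forall>v. continuous_on S (\<lambda>x. f' x v)))"

lemma smooth_on_deriv_on:
  assumes "smooth_on S f"
  shows "x \<in> S \<Longrightarrow> (f has_derivative deriv_on S f x) (at x within S)"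
    and "continuous_on S (\<lambda>x. deriv_on S f x v)"
    and "x \<in> S \<Longrightarrow> linear (deriv_on S f x)"
proof -
  have "\<exists>f'. (\<forall>x\<in>S. (f has_derivative f' x) (at x within S)) \<and> (\<forall>v. continuous_on S (\<lambda>x. f' x v))"
    using smooth_onE[OF assms] by metis
  from someI_ex[OF this] have *: "\<forall>x\<in>S. (f has_derivative deriv_on S f x) (at x within S)"
    "\<forall>v. continuous_on S (\<lambda>x. deriv_on S f x v)" unfolding deriv_on_def by blast+
  show "x \<in> S \<Longrightarrow> (f has_derivative deriv_on S f x) (at x within S)"
    "continuous_on S (\<lambda>x. deriv_on S f x v)" using * by blast+
  then show "x \<in> S \<Longrightarrow> linear (deriv_on S f x)" using has_derivative_linear by blast
qed

lemma has_derivative_along: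
  assumes "\<And>z. z \<in> S \<Longrightarrow> (F has_derivative F' z) (at z within S)"
    and "(h has_derivative h') (at x within T)" "x \<in> T" "h ` T \<subseteq> S"
  shows "((\<lambda>\<xi>. F (h \<xi>)) has_derivative (\<lambda>\<delta>. F' (h x) (h' \<delta>))) (at x within T)"
  by (rule has_derivative_in_compose2[where t = S]) (use assms in auto)

lemma jacobian_eq:
  fixes f :: "real^'n \<Rightarrow> real^'m"
  assumes "(f has_derivative f') (at x)"
  shows "jacobian f (at x) *v h = f' h"
proof -
  have "f differentiable (at x)" using assms unfolding differentiable_def by blast
  then have "(f has_derivative (\<lambda>h. jacobian f (at x) *v h)) (at x)" using jacobian_works by blast
  from has_derivative_unique[OF this assms] show ?thesis by metis
qed

lemma block_matrix_quadratic:
  fixes P :: "real^'a^'a" and Q :: "real^'b^'a" and R :: "real^'a^'b" and S :: "real^'b^'b"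
  defines "v \<equiv> \<lambda>p q. (\<chi> i. case i of Inl a \<Rightarrow> p $ a | Inr b \<Rightarrow> q $ b) :: real^('a + 'b)"
  shows "v p q \<bullet> (block_matrix P Q R S *v v p q) = p \<bullet> (P *v p) + p \<bullet> (Q *v q) + q \<bullet> (R *v p) + q \<bullet> (S *v q)"
proof -
  have sum: "(\<Sum>i\<in>UNIV. h i) = (\<Sum>a\<in>UNIV. h (Inl a)) + (\<Sum>b\<in>UNIV. h (Inr b))" for h :: "'a + 'b \<Rightarrow> real"
    using sum.Plus[of "UNIV :: 'a set" "UNIV :: 'b set" h] by (simp add: o_def)
  have "(block_matrix P Q R S *v v p q) $ Inl a = (P *v p) $ a + (Q *v q) $ a"
    "(block_matrix P Q R S *v v p q) $ Inr b = (R *v p) $ b + (S *v q) $ b" for a b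
    by (simp_all add: matrix_vector_mult_def block_matrix_def v_def sum)
  moreover have "v p q $ Inl a = p $ a" "v p q $ Inr b = q $ b" for a b by (simp_all add: v_def)
  ultimately show ?thesis
    unfolding inner_vec_def by (simp add: sum distrib_left sum.distrib)
qed

lemma pos_def_inv:
  fixes A :: "real^'n^'n"
  assumes "pos_def A"
  shows "A *v (matrix_inv A *v v) = v" "matrix_inv A *v (A *v v) = v"
    "v \<bullet> (matrix_inv A *v w) = (matrix_inv A *v v) \<bullet> w"
    "v \<bullet> (matrix_inv A *v v) \<ge> 0"
    "v \<bullet> (A *v w) = (A *v v) \<bullet> w"
    "v \<bullet> (A *v v) \<ge> 0"
proof -
  have ker: "A *v x = 0 \<Longrightarrow> x = 0" for x
    using assms unfolding pos_def_def by (metis inner_zero_right less_irrefl)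
  have "\<exists>B. B ** A = mat 1" using ker by (subst matrix_left_invertible_ker) blast
  then have "invertible A" by (simp add: invertible_left_inverse)
  then have ex: "\<exists>A'. A ** A' = mat 1 \<and> A' ** A = mat 1" unfolding invertible_def .
  from someI_ex[OF ex] have inv: "A ** matrix_inv A = mat 1" "matrix_inv A ** A = mat 1"
    unfolding matrix_inv_def by blast+
  show 1: "A *v (matrix_inv A *v v) = v" "matrix_inv A *v (A *v v) = v" for v
    using inv by (simp_all add: matrix_vector_mul_assoc)
  show sym: "v \<bullet> (A *v w) = (A *v v) \<bullet> w" for v w
  proof -
    have "(transpose A *v v) \<bullet> w = v \<bullet> (A *v w)" by (simp add: dot_lmul_matrix)
    then show ?thesis using assms unfolding pos_def_def by simp
  qed
  show nonneg: "v \<bullet> (A *v v) \<ge> 0" for v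
    using assms unfolding pos_def_def by (cases "v = 0") (auto intro: less_imp_le)
  show "v \<bullet> (matrix_inv A *v w) = (matrix_inv A *v v) \<bullet> w"
    using sym[of "matrix_inv A *v v" "matrix_inv A *v w"] by (simp add: 1)
  show "v \<bullet> (matrix_inv A *v v) \<ge> 0"
    using nonneg[of "matrix_inv A *v v"] by (simp add: 1 inner_commute)
qed

text \<open>Linearises the inverse quadratic form at \<open>p\<close> without differentiating the inverse; the error is quadratic in \<open>v - A *v p\<close>.\<close>

lemma pos_def_inv_quadratic:
  fixes A :: "real^'n^'n"
  assumes "pos_def A"
  shows "v \<bullet> (matrix_inv A *v v) = 2 * (p \<bullet> v) - p \<bullet> (A *v p) + (v - A *v p) \<bullet> (matrix_inv A *v (v - A *v p))"
proof -
  have "v \<bullet> p = (matrix_inv A *v v) \<bullet> (A *v p)"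
    using pos_def_inv(3)[OF assms, of v "A *v p"] pos_def_inv(2)[OF assms, of p] by simp
  moreover have "matrix_inv A *v (v - A *v p) = matrix_inv A *v v - p"
    by (simp add: matrix_vector_mult_diff_distrib pos_def_inv(2)[OF assms])
  ultimately show ?thesis
    by (simp add: inner_diff_left inner_diff_right inner_commute)
qed

lemma inner_transpose: "x \<bullet> (transpose A *v y) = (A *v x) \<bullet> y" for A :: "real^'n^'m"
  by (simp add: inner_commute[of x] dot_lmul_matrix) (simp add: inner_commute)

section \<open>Standing hypotheses and the differentials of the data\<close>

locale rccm =
  fixes f :: "real^'n \<Rightarrow> real^'p \<Rightarrow> real \<Rightarrow> real^'n"
    and B :: "real^'n \<Rightarrow> real \<Rightarrow> real^'m^'n"
    and g :: "real^'n \<Rightarrow> real^'m \<Rightarrow> real \<Rightarrow> real^'q"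
    and W :: "real^'n \<Rightarrow> real \<Rightarrow> real^'n^'n"
    and Y :: "real^'n \<Rightarrow> real \<Rightarrow> real^'m \<Rightarrow> real^'n^'m"
    and \<alpha> :: real
  assumes f_smooth: "smooth_on (UNIV \<times> UNIV \<times> {0..}) (\<lambda>(x, w, t). f x w t)"
    and B_smooth: "smooth_on (UNIV \<times> {0..}) (\<lambda>(x, t). B x t)"
    and g_smooth: "smooth_on (UNIV \<times> UNIV \<times> {0..}) (\<lambda>(x, u, t). g x u t)"
    and W_smooth: "smooth_on (UNIV \<times> {0..}) (\<lambda>(x, t). W x t)"
    and Y_smooth: "smooth_on (UNIV \<times> {0..} \<times> UNIV) (\<lambda>(x, t, u). Y x t u)"
    and alpha_pos: "\<alpha> > 0"
    and W_pos_def: "\<And>x t. t \<ge> 0 \<Longrightarrow> pos_def (W x t)"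
    and Y_affine: "\<And>x t. t \<ge> 0 \<Longrightarrow> linear (\<lambda>u. Y x t u - Y x t 0)"
    and LMI: "\<And>x u w t. t \<ge> 0 \<Longrightarrow> pos_semidef (lmi_matrix \<alpha> f B g W Y x u w t)"
    and metric: "\<And>t. t \<ge> 0 \<Longrightarrow> riemannian_metric (\<lambda>x. matrix_inv (W x t))"
    and geodesics: "\<And>t a b. t \<ge> 0 \<Longrightarrow> \<exists>\<gamma>. minimal_geodesic (\<lambda>x. matrix_inv (W x t)) a b \<gamma>"
    and dist_continuous_in_time:
      "\<And>a b. continuous_on {0..} (\<lambda>t. riem_dist (\<lambda>x. matrix_inv (W x t)) a b)"
begin

abbreviation M :: "real^'n \<Rightarrow> real \<Rightarrow> real^'n^'n" where "M x t \<equiv> matrix_inv (W x t)"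

definition fD where "fD = deriv_on (UNIV \<times> UNIV \<times> {0..}) (\<lambda>(x, w, t). f x w t)"
definition BD where "BD = deriv_on (UNIV \<times> {0..}) (\<lambda>(x, t). B x t)"
definition gD where "gD = deriv_on (UNIV \<times> UNIV \<times> {0..}) (\<lambda>(x, u, t). g x u t)"
definition WD where "WD = deriv_on (UNIV \<times> {0..}) (\<lambda>(x, t). W x t)"

lemmas fD = smooth_on_deriv_on[OF f_smooth, folded fD_def]
lemmas BD = smooth_on_deriv_on[OF B_smooth, folded BD_def]
lemmas gD = smooth_on_deriv_on[OF g_smooth, folded gD_def]
lemmas WD = smooth_on_deriv_on[OF W_smooth, folded WD_def]

lemma vfield_derivative_x:
  assumes "t \<ge> 0"
  shows "((\<lambda>\<xi>. vfield f B \<xi> u w t) has_derivative (\<lambda>\<delta>. fD (x, w, t) (\<delta>, 0, 0) + BD (x, t) (\<delta>, 0) *v u)) (at x)"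
proof -
  have "((\<lambda>\<xi>. (\<xi>, w, t)) has_derivative (\<lambda>\<delta>. (\<delta>, 0, 0))) (at x)" by (auto intro!: derivative_eq_intros simp: zero_prod_def)
  from has_derivative_along[OF fD(1) this] assms
  have 1: "((\<lambda>\<xi>. f \<xi> w t) has_derivative (\<lambda>\<delta>. fD (x, w, t) (\<delta>, 0, 0))) (at x)" by auto
  have "((\<lambda>\<xi>. (\<xi>, t)) has_derivative (\<lambda>\<delta>. (\<delta>, 0))) (at x)" by (auto intro!: derivative_eq_intros simp: zero_prod_def)
  from has_derivative_along[OF BD(1) this] assms
  have 2: "((\<lambda>\<xi>. B \<xi> t) has_derivative (\<lambda>\<delta>. BD (x, t) (\<delta>, 0))) (at x)" by auto
  show ?thesis unfolding vfield_def
    using has_derivative_add[OF 1 bounded_bilinear.FDERIV[OF bounded_bilinear_matrix_vector_mult 2 has_derivative_const[of u]]]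
    by simp
qed

lemma Amat_eq: "t \<ge> 0 \<Longrightarrow> Amat f B x u w t *v \<delta> = fD (x, w, t) (\<delta>, 0, 0) + BD (x, t) (\<delta>, 0) *v u"
  unfolding Amat_def using jacobian_eq[OF vfield_derivative_x] by blast

lemma Bwmat_eq:
  assumes "t \<ge> 0"
  shows "Bwmat f x w t *v \<omega> = fD (x, w, t) (0, \<omega>, 0)"
proof -
  have "((\<lambda>\<xi>. (x, \<xi>, t)) has_derivative (\<lambda>\<delta>. (0, \<delta>, 0))) (at w)" by (auto intro!: derivative_eq_intros simp: zero_prod_def)
  from has_derivative_along[OF fD(1) this] assms
  have "((\<lambda>\<xi>. f x \<xi> t) has_derivative (\<lambda>\<delta>. fD (x, w, t) (0, \<delta>, 0))) (at w)" by auto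
  from jacobian_eq[OF this] show ?thesis unfolding Bwmat_def .
qed

lemma Cmat_eq:
  assumes "t \<ge> 0"
  shows "Cmat g x u t *v \<delta> = gD (x, u, t) (\<delta>, 0, 0)"
proof -
  have "((\<lambda>\<xi>. (\<xi>, u, t)) has_derivative (\<lambda>\<delta>. (\<delta>, 0, 0))) (at x)" by (auto intro!: derivative_eq_intros simp: zero_prod_def)
  from has_derivative_along[OF gD(1) this] assms
  have "((\<lambda>\<xi>. g \<xi> u t) has_derivative (\<lambda>\<delta>. gD (x, u, t) (\<delta>, 0, 0))) (at x)" by auto
  from jacobian_eq[OF this] show ?thesis unfolding Cmat_def .
qed

lemma Dmat_eq:
  assumes "t \<ge> 0"
  shows "Dmat g x u t *v \<upsilon> = gD (x, u, t) (0, \<upsilon>, 0)"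
proof -
  have "((\<lambda>\<xi>. (x, \<xi>, t)) has_derivative (\<lambda>\<delta>. (0, \<delta>, 0))) (at u)" by (auto intro!: derivative_eq_intros simp: zero_prod_def)
  from has_derivative_along[OF gD(1) this] assms
  have "((\<lambda>\<xi>. g x \<xi> t) has_derivative (\<lambda>\<delta>. gD (x, u, t) (0, \<delta>, 0))) (at u)" by auto
  from jacobian_eq[OF this] show ?thesis unfolding Dmat_def .
qed

text \<open>Differentiating along the system is applying the joint differential to the direction
  with time component 1. At time 0 the time derivative is one-sided, and still unique because 0 is a
  limit point of \<open>{0..}\<close>.\<close>

lemma Wdot_eq:
  assumes t: "t \<ge> 0"
  shows "Wdot f B W x u w t = WD (x, t) (vfield f B x u w t, 1)"
proof -
  have xt: "(x, t) \<in> UNIV \<times> {0..}" using t by simp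
  note lin = WD(3)[OF xt]
  have "((\<lambda>\<tau>. (x, \<tau>)) has_derivative (\<lambda>h. (0, h))) (at t within {0..})" by (auto intro!: derivative_eq_intros simp: zero_prod_def)
  from has_derivative_along[OF WD(1) this] t
  have "((\<lambda>\<tau>. W x \<tau>) has_derivative (\<lambda>h. WD (x, t) (0, h))) (at t within {0..})" by auto
  moreover have "(\<lambda>h. WD (x, t) (0, h)) = (\<lambda>h. h *\<^sub>R WD (x, t) (0, 1))"
  proof
    fix h show "WD (x, t) (0, h) = h *\<^sub>R WD (x, t) (0, 1)"
      using linear_cmul[OF lin, of h "(0, 1)"] by (simp only: scaleR_Pair scaleR_zero_right real_scaleR_def mult_1_right)
  qed
  ultimately have "((\<lambda>\<tau>. W x \<tau>) has_vector_derivative WD (x, t) (0, 1)) (at t within {0..})"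
    by (simp only: has_vector_derivative_def)
  moreover have "at t within {0..} \<noteq> bot"
  proof -
    have "t islimpt {t..t+1}" by (rule islimpt_Icc[THEN iffD2]) auto
    moreover have "{t..t+1} \<subseteq> {0..}" using t by auto
    ultimately have "t islimpt {0..}" by (rule islimpt_subset)
    then show ?thesis by (simp add: trivial_limit_within)
  qed
  ultimately have 1: "vector_derivative (\<lambda>\<tau>. W x \<tau>) (at t within {0..}) = WD (x, t) (0, 1)"
    by (intro vector_derivative_within)
  have "((\<lambda>\<xi>. (\<xi>, t)) has_derivative (\<lambda>\<delta>. (\<delta>, 0))) (at x)" by (auto intro!: derivative_eq_intros simp: zero_prod_def)
  from has_derivative_along[OF WD(1) this] t
  have "((\<lambda>\<xi>. W \<xi> t) has_derivative (\<lambda>\<delta>. WD (x, t) (\<delta>, 0))) (at x)" by auto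
  from frechet_derivative_at[OF this] have 2: "frechet_derivative (\<lambda>\<xi>. W \<xi> t) (at x) = (\<lambda>\<delta>. WD (x, t) (\<delta>, 0))" by simp
  let ?v = "vfield f B x u w t"
  have "(?v, 0) = (\<Sum>i\<in>UNIV. (?v $ i) *\<^sub>R (axis i 1, 0::real))"
  proof (rule prod_eqI)
    have "?v = (\<Sum>i\<in>UNIV. (?v $ i) *\<^sub>R axis i 1)"
      using basis_expansion[of ?v] by (simp only: scalar_mult_eq_scaleR)
    then show "fst (?v, 0::real) = fst (\<Sum>i\<in>UNIV. (?v $ i) *\<^sub>R (axis i 1, 0::real))" by (simp add: fst_sum)
  qed (simp add: snd_sum)
  then have "WD (x, t) (?v, 0) = (\<Sum>i\<in>UNIV. (?v $ i) *\<^sub>R WD (x, t) (axis i 1, 0))"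
    by (simp only: linear_sum[OF lin] linear_cmul[OF lin])
  moreover have "WD (x, t) (?v, 1) = WD (x, t) (0, 1) + WD (x, t) (?v, 0)"
    using linear_add[OF lin, of "(0, 1)" "(?v, 0)"] by simp
  ultimately show ?thesis unfolding Wdot_def 1 2 by simp
qed

text \<open>
  Testing the matrix inequality with \<open>(p, - (C W + D Y) p)\<close> eliminates the output block; completing
  the square removes the disturbance.
\<close>

lemma LMI_dissipation:
  assumes t: "t \<ge> 0" and \<delta>: "\<delta> = W x t *v p" and \<upsilon>: "\<upsilon> = Y x t u *v p"
  shows "2 * (p \<bullet> (fD (x, w, t) (\<delta>, \<omega>, 0) + BD (x, t) (\<delta>, 0) *v u + B x t *v \<upsilon>))
      - p \<bullet> (WD (x, t) (vfield f B x u w t, 1) *v p)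
    \<le> \<alpha>\<^sup>2 * (norm \<omega>)\<^sup>2 - (norm (gD (x, u, t) (\<delta>, \<upsilon>, 0)))\<^sup>2"
proof -
  \<comment> \<open>With \<open>p = M \<delta>\<close> for \<open>M\<close> the inverse of
    \<open>W\<close>, the left side is the derivative of
    \<open>\<delta> \<bullet> M \<delta>\<close> along the differential dynamics, because the
    derivative of \<open>M\<close> is minus \<open>M\<close> times that of \<open>W\<close> times
    \<open>M\<close>.\<close>
  let ?A = "Amat f B x u w t" and ?Bw = "Bwmat f x w t" and ?C = "Cmat g x u t" and ?D = "Dmat g x u t"
    and ?W = "W x t" and ?Y = "Y x t u" and ?B = "B x t" and ?Wd = "Wdot f B W x u w t"
  define z where "z = ?C *v \<delta> + ?D *v \<upsilon>"
  define b where "b = transpose ?Bw *v p"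
  note Wp = pos_def_inv[OF W_pos_def[OF t, of x]]
  have "0 \<le> p \<bullet> (calW \<alpha> f B W Y x u w t *v p) +
     p \<bullet> ((?W ** transpose ?C + transpose ?Y ** transpose ?D) *v (- z))
     + (- z) \<bullet> ((?C ** ?W + ?D ** ?Y) *v p) + (- z) \<bullet> (mat 1 *v (- z))"
    using LMI[OF t, of x u w] unfolding pos_semidef_def lmi_matrix_def block_matrix_quadratic[symmetric] by blast
  also have "(?C ** ?W + ?D ** ?Y) *v p = z"
    by (simp add: z_def \<delta> \<upsilon> matrix_vector_mult_add_rdistrib matrix_vector_mul_assoc)
  also have "p \<bullet> ((?W ** transpose ?C + transpose ?Y ** transpose ?D) *v (- z)) = - (z \<bullet> z)"
  proof -
    have "p \<bullet> ((?W ** transpose ?C + transpose ?Y ** transpose ?D) *v (- z))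
      = p \<bullet> (?W *v (transpose ?C *v (- z))) + p \<bullet> (transpose ?Y *v (transpose ?D *v (- z)))"
      by (simp only: matrix_vector_mult_add_rdistrib matrix_vector_mul_assoc inner_add_right)
    also have "\<dots> = (?C *v \<delta>) \<bullet> (- z) + (?D *v \<upsilon>) \<bullet> (- z)"
      by (simp only: Wp(5) inner_transpose \<delta> \<upsilon>)
    also have "\<dots> = - (z \<bullet> z)" unfolding inner_add_left[symmetric] z_def[symmetric] by simp
    finally show ?thesis .
  qed
  also have "p \<bullet> (calW \<alpha> f B W Y x u w t *v p) =
     p \<bullet> (?Wd *v p) - 2 * (p \<bullet> (?A *v \<delta>)) - 2 * (p \<bullet> (?B *v \<upsilon>)) - (1 / \<alpha>\<^sup>2) * (b \<bullet> b)"
  proof -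
    have "p \<bullet> ((?W ** transpose ?A) *v p) = p \<bullet> (?A *v \<delta>)"
      by (simp only: matrix_vector_mul_assoc[symmetric] Wp(5) inner_transpose \<delta>) (simp add: inner_commute)
    moreover have "p \<bullet> ((?A ** ?W) *v p) = p \<bullet> (?A *v \<delta>)"
      by (simp only: matrix_vector_mul_assoc[symmetric] \<delta>)
    moreover have "p \<bullet> ((?B ** ?Y) *v p) = p \<bullet> (?B *v \<upsilon>)"
      by (simp only: matrix_vector_mul_assoc[symmetric] \<upsilon>)
    moreover have "p \<bullet> ((transpose ?Y ** transpose ?B) *v p) = p \<bullet> (?B *v \<upsilon>)"
      by (simp only: matrix_vector_mul_assoc[symmetric] inner_transpose \<upsilon>) (simp add: inner_commute)
    moreover have "p \<bullet> ((?Bw ** transpose ?Bw) *v p) = b \<bullet> b"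
      using inner_transpose[of b ?Bw p] by (simp only: matrix_vector_mul_assoc[symmetric] b_def) (simp add: inner_commute)
    ultimately show ?thesis
      unfolding calW_def
      by (simp only: matrix_vector_mult_diff_rdistrib inner_diff_right scaleR_matrix_vector_assoc[symmetric] inner_scaleR_right)
  qed
  finally have 1: "2 * (p \<bullet> (?A *v \<delta>)) + 2 * (p \<bullet> (?B *v \<upsilon>)) - p \<bullet> (?Wd *v p) \<le> - (z \<bullet> z) - (1 / \<alpha>\<^sup>2) * (b \<bullet> b)"
    by simp
  have "0 \<le> (\<alpha> *\<^sub>R \<omega> - (1/\<alpha>) *\<^sub>R b) \<bullet> (\<alpha> *\<^sub>R \<omega> - (1/\<alpha>) *\<^sub>R b)" by simp
  also have "\<dots> = \<alpha>\<^sup>2 * (\<omega> \<bullet> \<omega>) - 2 * (b \<bullet> \<omega>) + (1/\<alpha>\<^sup>2) * (b \<bullet> b)"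
    using alpha_pos by (simp add: inner_diff_left inner_diff_right power2_eq_square inner_commute)
  also have "b \<bullet> \<omega> = p \<bullet> (?Bw *v \<omega>)" unfolding b_def by (simp add: dot_lmul_matrix)
  finally have 2: "2 * (p \<bullet> (?Bw *v \<omega>)) \<le> \<alpha>\<^sup>2 * (\<omega> \<bullet> \<omega>) + (1/\<alpha>\<^sup>2) * (b \<bullet> b)" by simp
  have fs: "fD (x, w, t) (\<delta>, \<omega>, 0) = fD (x, w, t) (\<delta>, 0, 0) + fD (x, w, t) (0, \<omega>, 0)"
    using linear_add[OF fD(3), of "(x, w, t)" "(\<delta>, 0, 0)" "(0, \<omega>, 0)"] t by simp
  have gs: "gD (x, u, t) (\<delta>, \<upsilon>, 0) = gD (x, u, t) (\<delta>, 0, 0) + gD (x, u, t) (0, \<upsilon>, 0)"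
    using linear_add[OF gD(3), of "(x, u, t)" "(\<delta>, 0, 0)" "(0, \<upsilon>, 0)"] t by simp
  have z: "z = gD (x, u, t) (\<delta>, \<upsilon>, 0)" unfolding z_def gs Cmat_eq[OF t] Dmat_eq[OF t] ..
  have "p \<bullet> (fD (x, w, t) (\<delta>, \<omega>, 0) + BD (x, t) (\<delta>, 0) *v u + B x t *v \<upsilon>)
      = p \<bullet> (?A *v \<delta>) + p \<bullet> (?Bw *v \<omega>) + p \<bullet> (?B *v \<upsilon>)"
    unfolding fs Amat_eq[OF t] Bwmat_eq[OF t] by (simp add: inner_add_right)
  then show ?thesis using 1 2 unfolding Wdot_eq[OF t] z power2_norm_eq_inner by simp
qed

section \<open>Geodesics and their lifts\<close>

definition d :: "real \<Rightarrow> real^'n \<Rightarrow> real^'n \<Rightarrow> real" where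
  "d t a b = riem_dist (\<lambda>x. M x t) a b"

lemma M_cont: "t \<ge> 0 \<Longrightarrow> continuous_on UNIV (\<lambda>x. M x t)"
  using metric smooth_on_continuous unfolding riemannian_metric_def by blast

lemma M_nonneg: "t \<ge> 0 \<Longrightarrow> v \<bullet> (M x t *v v) \<ge> 0"
  using pos_def_inv(4)[OF W_pos_def] by blast

lemma d_nonneg: "t \<ge> 0 \<Longrightarrow> d t a b \<ge> 0"
  unfolding d_def using riem_dist_nonneg M_cont M_nonneg by blast

lemma d_triangle: "t \<ge> 0 \<Longrightarrow> d t a c \<le> d t a b + d t b c"
  unfolding d_def using riem_dist_triangle[OF M_cont M_nonneg] by blast

lemma W_cont: "continuous_on (UNIV \<times> {0..}) (\<lambda>z. W (fst z) (snd z))"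
  using smooth_on_continuous[OF W_smooth] by (simp add: split_beta)

text \<open>\<open>1 / c\<close> is the least value of the quadratic form of \<open>W\<close> over
  \<open>K\<close> and the unit sphere. Substituting \<open>p = M x t *v v\<close> transfers it to
  the inverse, without continuity of the inverse. It serves to bound the covector
  \<open>M \<gamma>'\<close> of a path by the speed of the path.\<close>

lemma M_bound_sq:
  assumes K: "compact K" "K \<subseteq> UNIV \<times> {0..}"
  obtains c where "c > 0" "\<And>x t v. (x, t) \<in> K \<Longrightarrow> (norm (M x t *v v))\<^sup>2 \<le> c * (v \<bullet> (M x t *v v))"
proof (cases "K = {}")
  case True then show thesis using that[of 1] by simp
next
  case False
  define F where "F z = snd z \<bullet> (W (fst (fst z)) (snd (fst z)) *v snd z)" for z :: "((real^'n) \<times> real) \<times> (real^'n)"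
  have "continuous_on (K \<times> sphere 0 1) (\<lambda>z. W (fst (fst z)) (snd (fst z)))"
    by (rule continuous_on_compose2[OF W_cont, where f = fst]) (use K in \<open>auto intro!: continuous_intros\<close>)
  then have "continuous_on (K \<times> sphere 0 1) F" unfolding F_def
    by (intro continuous_on_inner continuous_on_matrix_vector_mult) (auto intro!: continuous_intros)
  moreover have "compact (K \<times> sphere (0::real^'n) 1)" using K by (intro compact_Times) auto
  moreover have "K \<times> sphere (0::real^'n) 1 \<noteq> {}" using False by auto
  ultimately obtain z0 where z0: "z0 \<in> K \<times> sphere 0 1" "\<And>z. z \<in> K \<times> sphere 0 1 \<Longrightarrow> F z0 \<le> F z"
    using continuous_attains_inf by metis
  have Fpos: "F z0 > 0"
  proof -
    have "snd (fst z0) \<ge> 0" "snd z0 \<noteq> 0" using z0(1) K by auto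
    then show ?thesis using W_pos_def unfolding F_def pos_def_def by blast
  qed
  show thesis
  proof (rule that[of "1 / F z0"])
    fix x t v assume xt: "(x, t) \<in> K"
    then have t: "t \<ge> 0" using K by auto
    define p where "p = M x t *v v"
    show "(norm (M x t *v v))\<^sup>2 \<le> 1 / F z0 * (v \<bullet> (M x t *v v))"
    proof (cases "p = 0")
      case True then show ?thesis using Fpos unfolding p_def by simp
    next
      case False
      have "F z0 \<le> F ((x, t), p /\<^sub>R norm p)" using xt False by (intro z0(2)) auto
      also have "\<dots> = (p \<bullet> (W x t *v p)) / (norm p)\<^sup>2"
        unfolding F_def by (simp add: matrix_vector_mult_scaleR power2_eq_square field_simps)
      finally have "F z0 * (norm p)\<^sup>2 \<le> p \<bullet> (W x t *v p)" using False by (simp add: field_simps)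
      also have "W x t *v p = v" unfolding p_def using pos_def_inv(1)[OF W_pos_def[OF t]] .
      finally show ?thesis using Fpos unfolding p_def by (simp add: field_simps inner_commute)
    qed
  qed (use Fpos in simp)
qed

lemma M_bound:
  assumes K: "compact K" "K \<subseteq> UNIV \<times> {0..}"
  obtains c where "c > 0" "\<And>x t v. (x, t) \<in> K \<Longrightarrow> norm (M x t *v v) \<le> c * norm v"
proof -
  obtain c where c: "c > 0" "\<And>x t v. (x, t) \<in> K \<Longrightarrow> (norm (M x t *v v))\<^sup>2 \<le> c * (v \<bullet> (M x t *v v))"
    using M_bound_sq[OF K] by blast
  show thesis
  proof (rule that[OF c(1)])
    fix x t v assume "(x, t) \<in> K"
    from c(2)[OF this, of v] have "(norm (M x t *v v))\<^sup>2 \<le> c * (norm v * norm (M x t *v v))"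
      using c(1) norm_cauchy_schwarz[of v "M x t *v v"] by (meson less_imp_le mult_left_mono order_trans)
    then show "norm (M x t *v v) \<le> c * norm v"
      using c(1) by (cases "M x t *v v = 0") (auto simp: power2_eq_square)
  qed
qed

text \<open>For \<open>p\<close> the value at the base point, \<open>M v - p = M (v - W p)\<close>;
  local boundedness of \<open>M\<close> and continuity of \<open>W\<close> do the rest.\<close>

lemma M_vec_continuous: "continuous_on (UNIV \<times> {0..}) (\<lambda>z. M (fst z) (snd z) *v v)"
  unfolding continuous_on_def
proof
  fix z0 :: "(real^'n) \<times> real" assume z0: "z0 \<in> UNIV \<times> {0..}"
  let ?S = "UNIV \<times> {0..} :: ((real^'n) \<times> real) set"
  have clS: "closed ?S" by (intro closed_Times) auto
  obtain c where c: "c > 0" "\<And>x t v. (x, t) \<in> cball z0 1 \<inter> ?S \<Longrightarrow> norm (M x t *v v) \<le> c * norm v"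
    using M_bound[of "cball z0 1 \<inter> ?S"] clS compact_cball compact_Int_closed by blast
  define p where "p = M (fst z0) (snd z0) *v v"
  have Wp: "W (fst z0) (snd z0) *v p = v"
    unfolding p_def using z0 by (intro pos_def_inv(1) W_pos_def) auto
  have "((\<lambda>z. W (fst z) (snd z) *v p) \<longlongrightarrow> W (fst z0) (snd z0) *v p) (at z0 within ?S)"
    using continuous_on_matrix_vector_mult[OF W_cont continuous_on_const[of _ p]] z0 unfolding continuous_on_def by blast
  then have "((\<lambda>z. c * norm (v - W (fst z) (snd z) *v p)) \<longlongrightarrow> c * norm (v - v)) (at z0 within ?S)"
    unfolding Wp by (intro tendsto_intros)
  then have lim: "((\<lambda>z. c * norm (v - W (fst z) (snd z) *v p)) \<longlongrightarrow> 0) (at z0 within ?S)" by simp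
  have "\<forall>\<^sub>F z in at z0 within ?S. norm (M (fst z) (snd z) *v v - p) \<le> c * norm (v - W (fst z) (snd z) *v p)"
    unfolding eventually_at
  proof (intro exI[of _ 1] conjI ballI impI)
    fix z assume z: "z \<in> ?S" "z \<noteq> z0 \<and> dist z z0 < 1"
    then have "snd z \<ge> 0" by auto
    have "M (fst z) (snd z) *v v - p = M (fst z) (snd z) *v (v - W (fst z) (snd z) *v p)"
      using pos_def_inv(2)[OF W_pos_def[OF \<open>snd z \<ge> 0\<close>]] by (simp add: matrix_vector_mult_diff_distrib)
    moreover have "(fst z, snd z) \<in> cball z0 1 \<inter> ?S" using z by (auto simp: dist_commute)
    ultimately show "norm (M (fst z) (snd z) *v v - p) \<le> c * norm (v - W (fst z) (snd z) *v p)"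
      using c(2) by metis
  qed simp
  from Lim_null_comparison[OF this lim] show "((\<lambda>z. M (fst z) (snd z) *v v) \<longlongrightarrow> M (fst z0) (snd z0) *v v) (at z0 within ?S)"
    unfolding p_def[symmetric] by (rule LIM_zero_cancel)
qed

lemma d_le_norm:
  obtains C where "C \<ge> 0" "\<And>t a b. t \<in> {0..T} \<Longrightarrow> norm a \<le> R \<Longrightarrow> norm b \<le> R \<Longrightarrow> d t a b \<le> C * norm (b - a)"
proof -
  have "compact (cball (0::real^'n) R \<times> {0..T})" by (intro compact_Times) auto
  moreover have "cball (0::real^'n) R \<times> {0..T} \<subseteq> UNIV \<times> {0..}" by auto
  ultimately obtain c where c: "c > 0" "\<And>x t v. (x, t) \<in> cball 0 R \<times> {0..T} \<Longrightarrow> norm (M x t *v v) \<le> c * norm v"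
    using M_bound by metis
  show thesis
  proof (rule that[of "sqrt c"])
    fix t :: real and a b :: "real^'n" assume t: "t \<in> {0..T}" and ab: "norm a \<le> R" "norm b \<le> R"
    show "d t a b \<le> sqrt c * norm (b - a)"
      unfolding d_def
    proof (rule riem_dist_le_norm[OF _ _ _ _ ab])
      fix x v :: "real^'n" assume x: "norm x \<le> R"
      have "v \<bullet> (M x t *v v) \<le> norm v * norm (M x t *v v)" by (rule norm_cauchy_schwarz)
      also have "\<dots> \<le> norm v * (c * norm v)" using c(2)[of x t v] x t by (intro mult_left_mono) auto
      finally show "v \<bullet> (M x t *v v) \<le> (sqrt c)\<^sup>2 * (norm v)\<^sup>2" using c(1) by (simp add: power2_eq_square algebra_simps)
    qed (use t c M_cont M_nonneg in auto)
  qed (use c in auto)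
qed

text \<open>The triangle inequality inserts a short detour at each end, and each detour is at most a
  constant times its Euclidean length, uniformly in time.\<close>

lemma d_lipschitz:
  obtains C where "C \<ge> 0"
    "\<And>t a b a' b'. t \<in> {0..T} \<Longrightarrow> norm a \<le> R \<Longrightarrow> norm b \<le> R \<Longrightarrow> norm a' \<le> R \<Longrightarrow> norm b' \<le> R \<Longrightarrow>
       d t a' b' \<le> d t a b + C * (norm (a' - a) + norm (b' - b))"
proof -
  obtain C where C: "C \<ge> 0" "\<And>t a b. t \<in> {0..T} \<Longrightarrow> norm a \<le> R \<Longrightarrow> norm b \<le> R \<Longrightarrow> d t a b \<le> C * norm (b - a)"
    using d_le_norm by blast
  show thesis
  proof (rule that[OF C(1)])
    fix t :: real and a b a' b' :: "real^'n" assume *: "t \<in> {0..T}" "norm a \<le> R" "norm b \<le> R" "norm a' \<le> R" "norm b' \<le> R"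
    have "d t a' b' \<le> d t a' a + (d t a b + d t b b')"
      using d_triangle[of t a' b' a] d_triangle[of t a b' b] * by auto
    moreover have "d t a' a \<le> C * norm (a' - a)" "d t b b' \<le> C * norm (b' - b)"
      using C(2)[of t a' a] C(2)[of t b b'] * by (auto simp: norm_minus_commute)
    ultimately show "d t a' b' \<le> d t a b + C * (norm (a' - a) + norm (b' - b))" by (simp add: distrib_left)
  qed
qed

text \<open>The Lipschitz bound in the two points is locally uniform in time, which reduces joint
  continuity to \<open>dist_continuous_in_time\<close>. It is used for the continuity of the storage
  function and for the measurability of the feedback.\<close>

lemma d_continuous: "continuous_on (UNIV \<times> UNIV \<times> {0..}) (\<lambda>z. d (snd (snd z)) (fst z) (fst (snd z)))"
  unfolding continuous_on_def
proof
  let ?S = "UNIV \<times> UNIV \<times> {0..} :: ((real^'n) \<times> (real^'n) \<times> real) set"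
  fix z0 assume z0: "z0 \<in> ?S"
  obtain a0 b0 t0 where z0_eq: "z0 = (a0, b0, t0)" and t0: "t0 \<ge> 0" using z0 by (cases z0) auto
  define R where "R = max (norm a0) (norm b0) + 1"
  obtain C where C: "C \<ge> 0"
    "\<And>t a b a' b'. t \<in> {0..t0 + 1} \<Longrightarrow> norm a \<le> R \<Longrightarrow> norm b \<le> R \<Longrightarrow> norm a' \<le> R \<Longrightarrow> norm b' \<le> R \<Longrightarrow>
       d t a' b' \<le> d t a b + C * (norm (a' - a) + norm (b' - b))"
    using d_lipschitz[of "t0 + 1" R] by blast
  let ?B = "\<lambda>z. C * (norm (fst z - a0) + norm (fst (snd z) - b0)) + \<bar>d (snd (snd z)) a0 b0 - d t0 a0 b0\<bar>"
  have "continuous_on ?S (\<lambda>z. d (snd (snd z)) a0 b0)"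
    unfolding d_def
    by (rule continuous_on_compose2[OF dist_continuous_in_time[of a0 b0], where f = "\<lambda>z. snd (snd z)"])
      (auto intro!: continuous_intros)
  then have "continuous_on ?S ?B" by (intro continuous_intros)
  then have "(?B \<longlongrightarrow> ?B z0) (at z0 within ?S)" using z0 unfolding continuous_on_def by blast
  then have lim: "(?B \<longlongrightarrow> 0) (at z0 within ?S)" by (simp add: z0_eq)
  have "\<forall>\<^sub>F z in at z0 within ?S. norm (d (snd (snd z)) (fst z) (fst (snd z)) - d t0 a0 b0) \<le> ?B z"
    unfolding eventually_at
  proof (intro exI[of _ 1] conjI ballI impI)
    fix z assume z: "z \<in> ?S" "z \<noteq> z0 \<and> dist z z0 < 1"
    obtain a b t where z_eq: "z = (a, b, t)" and t: "t \<ge> 0" using z by (cases z) auto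
    have "dist a a0 \<le> dist z z0" "dist b b0 \<le> dist z z0" "dist t t0 \<le> dist z z0"
      using dist_fst_le[of z z0] dist_fst_le[of "snd z" "snd z0"] dist_snd_le[of "snd z" "snd z0"] dist_snd_le[of z z0]
      unfolding z_eq z0_eq by auto
    then have near: "norm (a - a0) < 1" "norm (b - b0) < 1" "\<bar>t - t0\<bar> < 1" using z by (auto simp: dist_norm)
    have "norm a \<le> norm (a - a0) + norm a0" "norm b \<le> norm (b - b0) + norm b0"
      using norm_triangle_ineq[of "a - a0" a0] norm_triangle_ineq[of "b - b0" b0] by auto
    then have *: "t \<in> {0..t0 + 1}" "norm a \<le> R" "norm b \<le> R" "norm a0 \<le> R" "norm b0 \<le> R"
      using near t unfolding R_def by auto
    have "d t a b \<le> d t a0 b0 + C * (norm (a - a0) + norm (b - b0))"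
      "d t a0 b0 \<le> d t a b + C * (norm (a - a0) + norm (b - b0))"
      using C(2)[of t a0 b0 a b] C(2)[of t a b a0 b0] * by (auto simp: norm_minus_commute)
    then show "norm (d (snd (snd z)) (fst z) (fst (snd z)) - d t0 a0 b0) \<le> ?B z"
      unfolding z_eq real_norm_def by simp
  qed simp
  from Lim_null_comparison[OF this lim]
  show "((\<lambda>z. d (snd (snd z)) (fst z) (fst (snd z))) \<longlongrightarrow> d (snd (snd z0)) (fst z0) (fst (snd z0))) (at z0 within ?S)"
    unfolding z0_eq fst_conv snd_conv by (rule LIM_zero_cancel)
qed

section \<open>Lifting paths to control paths\<close>

text \<open>
  \<open>((a, b, t, u\<^sub>0, D), \<kappa>)\<close> belongs to \<open>lifted m\<close> if some path from \<open>a\<close> to \<open>b\<close> of speed at most \<open>D\<close>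
  at time \<open>t\<close> lifts, through the differential feedback \<open>\<delta>\<^sub>u = Y W\<inverse> \<delta>\<^sub>x\<close>, to a control path from
  \<open>u\<^sub>0\<close> to \<open>\<kappa>\<close>, everything staying in the ball of radius \<open>m\<close>.
\<close>

definition lifted :: "nat \<Rightarrow> (((real^'n) \<times> (real^'n) \<times> real \<times> (real^'m) \<times> real) \<times> (real^'m)) set" where
  "lifted m = {((a, b, t, u0, D), \<kappa>) | a b t u0 D \<kappa>. \<exists>\<gamma> \<gamma>' u u'. t \<ge> 0 \<and> D \<ge> 0 \<and> C1_path \<gamma> \<gamma>' \<and> C1_path u u' \<and>
     \<gamma> 0 = a \<and> \<gamma> 1 = b \<and> u 0 = u0 \<and> u 1 = \<kappa> \<and>
     (\<forall>s\<in>{0..1}. norm (\<gamma> s) \<le> real m \<and> norm (u s) \<le> real m \<and>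
       \<gamma>' s \<bullet> (M (\<gamma> s) t *v \<gamma>' s) \<le> D\<^sup>2 \<and> u' s = Y (\<gamma> s) t (u s) *v (M (\<gamma> s) t *v \<gamma>' s))}"

text \<open>As \<open>Y\<close> is affine in \<open>u\<close>, the right-hand side is affine in the
  unknown, and compactness of the path makes its linear part \<open>H\<close> uniformly bounded.
  Hence the Lipschitz bound is global and the lift reaches the parameter 1.\<close>

lemma lift_exists:
  assumes t: "t \<ge> 0" and g: "C1_path \<gamma> \<gamma>'"
  obtains u where "u 0 = u0" "C1_path u (\<lambda>s. Y (\<gamma> s) t (u s) *v (M (\<gamma> s) t *v \<gamma>' s))"
proof -
  define p where "p s = M (\<gamma> s) t *v \<gamma>' s" for s
  have cg: "continuous_on {0..1} \<gamma>" "continuous_on {0..1} \<gamma>'" using g C1_path_continuous[OF g] unfolding C1_path_def by auto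
  have cp: "continuous_on {0..1} p" unfolding p_def
    using cg t by (intro continuous_on_matrix_vector_mult continuous_on_compose2[OF M_cont[OF t] cg(1)]) auto
  have Ycont: "continuous_on (UNIV \<times> {0..} \<times> UNIV) (\<lambda>(x, t, u). Y x t u)" using smooth_on_continuous[OF Y_smooth] .
  have contG: "continuous_on ({0..1} \<times> UNIV) (\<lambda>(s, u). Y (\<gamma> s) t u *v p s)"
  proof -
    have "continuous_on ({0..1} \<times> UNIV) (\<lambda>z. \<gamma> (fst z))"
      by (rule continuous_on_compose2[OF cg(1)]) (auto intro!: continuous_intros)
    then have "continuous_on ({0..1} \<times> UNIV) (\<lambda>z. Y (\<gamma> (fst z)) t (snd z))"
      using t by (intro continuous_on_compose2[OF Ycont, where f = "\<lambda>z. (\<gamma> (fst z), t, snd z)", simplified])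
        (auto intro!: continuous_intros)
    moreover have "continuous_on ({0..1} \<times> UNIV) (\<lambda>z. p (fst z))"
      by (rule continuous_on_compose2[OF cp]) (auto intro!: continuous_intros)
    ultimately show ?thesis unfolding split_beta by (rule continuous_on_matrix_vector_mult)
  qed
  define H where "H s u = (Y (\<gamma> s) t u - Y (\<gamma> s) t 0) *v p s" for s u
  have linH: "linear (H s)" for s
    using linear_compose[OF Y_affine[OF t, of "\<gamma> s"]
        bounded_linear.linear[OF bounded_bilinear.bounded_linear_left[OF bounded_bilinear_matrix_vector_mult, of "p s"]]]
    unfolding H_def o_def .
  have contH: "continuous_on {0..1} (\<lambda>s. H s u)" for u
  proof -
    have "continuous_on {0..1} (\<lambda>s. Y (\<gamma> s) t v *v p s)" for v
    proof -
      have "continuous_on {0..1} (\<lambda>s::real. (s, v))" by (intro continuous_intros)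
      from continuous_on_compose2[OF contG this] show ?thesis by (simp add: image_subset_iff)
    qed
    then show ?thesis unfolding H_def matrix_vector_mult_diff_rdistrib by (intro continuous_on_diff)
  qed
  obtain L where L: "L > 0" "\<And>s u. s \<in> {0..1} \<Longrightarrow> norm (H s u) \<le> L * norm u"
    using linear_family_bounded[of "{0..1}" H "{0..1}"] linH contH by auto
  have lip: "norm (Y (\<gamma> s) t u *v p s - Y (\<gamma> s) t v *v p s) \<le> L * norm (u - v)" if s: "s \<in> {0..1}" for s u v
  proof -
    have "Y (\<gamma> s) t u *v p s - Y (\<gamma> s) t v *v p s = H s u - H s v"
      unfolding H_def by (simp add: matrix_vector_mult_diff_rdistrib)
    also have "\<dots> = H s (u - v)" using linear_diff[OF linH] by metis
    finally show ?thesis using L(2)[OF s] by simp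
  qed
  show thesis using global_lipschitz_ode[OF contG lip] that unfolding p_def by blast
qed

text \<open>The lift equation is homogeneous in the velocity, so reparametrizing the geodesic
  reparametrizes its lift and changes neither the final control nor the bounds. This is why
  \<open>\<kappa>\<close> and \<open>m\<close> come before \<open>\<epsilon>\<close>: letting
  \<open>\<epsilon>\<close> tend to 0 then places \<open>\<kappa>\<close>, with \<open>D\<close> the
  exact distance, in the closure of a single \<open>lifted m\<close>.\<close>

lemma lifted_near_geodesic:
  assumes t: "t \<ge> 0"
  obtains \<kappa> m where "\<And>\<epsilon>. \<epsilon> > 0 \<Longrightarrow> ((a, b, t, u0, d t a b + \<epsilon>), \<kappa>) \<in> lifted m"
proof -
  obtain \<gamma> where geo: "minimal_geodesic (\<lambda>x. M x t) a b \<gamma>" using geodesics[OF t] by blast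
  then have sp: "smooth_path a b \<gamma>" unfolding minimal_geodesic_def by blast
  obtain \<gamma>' where g: "C1_path \<gamma> \<gamma>'" using smooth_path_C1[OF sp] .
  have ends: "\<gamma> 0 = a" "\<gamma> 1 = b" using sp unfolding smooth_path_def by auto
  obtain u where u: "u 0 = u0" "C1_path u (\<lambda>s. Y (\<gamma> s) t (u s) *v (M (\<gamma> s) t *v \<gamma>' s))" using lift_exists[OF t g] .
  define \<sigma> where "\<sigma> s = sqrt (\<gamma>' s \<bullet> (M (\<gamma> s) t *v \<gamma>' s))" for s
  have cont\<sigma>: "continuous_on {0..1} \<sigma>" unfolding \<sigma>_def using continuous_on_speed(1)[OF M_cont[OF t] g] .
  have \<sigma>0: "\<sigma> s \<ge> 0" for s unfolding \<sigma>_def using M_nonneg[OF t] by simp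
  have len: "integral {0..1} \<sigma> = d t a b"
  proof (rule antisym)
    have L: "riem_length (\<lambda>x. M x t) \<gamma> = integral {0..1} \<sigma>" unfolding \<sigma>_def by (rule riem_length_C1[OF g])
    show "integral {0..1} \<sigma> \<le> d t a b" unfolding d_def riem_dist_def
      using sp geo L unfolding minimal_geodesic_def by (intro cInf_greatest) auto
    show "d t a b \<le> integral {0..1} \<sigma>"
      unfolding d_def L[symmetric] by (rule riem_dist_le_smooth[OF M_cont[OF t] M_nonneg[OF t] sp])
  qed
  obtain C1 where C1: "\<And>s. s \<in> {0..1} \<Longrightarrow> norm (\<gamma> s) \<le> C1" using compact_norm_bound[OF compact_Icc C1_path_continuous[OF g]] by metis
  obtain C2 where C2: "\<And>s. s \<in> {0..1} \<Longrightarrow> norm (u s) \<le> C2" using compact_norm_bound[OF compact_Icc C1_path_continuous[OF u(2)]] by metis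
  define m where "m = nat \<lceil>max C1 C2\<rceil>"
  have m: "norm (\<gamma> s) \<le> real m" "norm (u s) \<le> real m" if "s \<in> {0..1}" for s
    using C1[OF that] C2[OF that] real_nat_ceiling_ge[of "max C1 C2"] unfolding m_def by linarith+
  show thesis
  proof (rule that[of "u 1" m])
    fix \<epsilon> :: real assume e: "\<epsilon> > 0"
    obtain \<psi> \<psi>' where \<psi>: "C1_path \<psi> \<psi>'" "\<psi> 0 = 0" "\<psi> 1 = 1" "\<And>s. s \<in> {0..1} \<Longrightarrow> \<psi> s \<in> {0..1}"
      "\<And>s. s \<in> {0..1} \<Longrightarrow> \<psi>' s = (integral {0..1} \<sigma> + \<epsilon>) / (\<sigma> (\<psi> s) + \<epsilon>)"
      using reparametrization_by_weight[OF cont\<sigma> \<sigma>0 e] by metis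
    have speed: "(\<psi>' s *\<^sub>R \<gamma>' (\<psi> s)) \<bullet> (M (\<gamma> (\<psi> s)) t *v (\<psi>' s *\<^sub>R \<gamma>' (\<psi> s))) \<le> (d t a b + \<epsilon>)\<^sup>2" if s: "s \<in> {0..1}" for s
    proof -
      have l: "d t a b + \<epsilon> > 0" using d_nonneg[OF t, of a b] e by simp
      have "\<psi>' s * \<sigma> (\<psi> s) \<le> d t a b + \<epsilon>"
      proof -
        have "(d t a b + \<epsilon>) * (\<sigma> (\<psi> s) / (\<sigma> (\<psi> s) + \<epsilon>)) \<le> (d t a b + \<epsilon>) * 1"
          using \<sigma>0[of "\<psi> s"] e l by (intro mult_left_mono) auto
        then show ?thesis unfolding \<psi>(5)[OF s] len by simp
      qed
      moreover have "0 \<le> \<psi>' s * \<sigma> (\<psi> s)" unfolding \<psi>(5)[OF s] len using \<sigma>0[of "\<psi> s"] e l by simp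
      ultimately have le: "(\<psi>' s * \<sigma> (\<psi> s))\<^sup>2 \<le> (d t a b + \<epsilon>)\<^sup>2" by (intro power_mono)
      have "(\<sigma> (\<psi> s))\<^sup>2 = \<gamma>' (\<psi> s) \<bullet> (M (\<gamma> (\<psi> s)) t *v \<gamma>' (\<psi> s))"
        unfolding \<sigma>_def using M_nonneg[OF t] by simp
      then have sq: "(\<psi>' s *\<^sub>R \<gamma>' (\<psi> s)) \<bullet> (M (\<gamma> (\<psi> s)) t *v (\<psi>' s *\<^sub>R \<gamma>' (\<psi> s))) = (\<psi>' s)\<^sup>2 * (\<sigma> (\<psi> s))\<^sup>2"
        by (simp add: matrix_vector_mult_scaleR power2_eq_square[of "\<psi>' s"] mult.assoc)
      show ?thesis using le unfolding sq power_mult_distrib .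
    qed
    show "((a, b, t, u0, d t a b + \<epsilon>), u 1) \<in> lifted m"
      unfolding lifted_def mem_Collect_eq
    proof (intro exI conjI ballI)
      show "C1_path (\<lambda>s. \<gamma> (\<psi> s)) (\<lambda>s. \<psi>' s *\<^sub>R \<gamma>' (\<psi> s))" by (rule C1_path_compose[OF g \<psi>(1,4)])
      show "C1_path (\<lambda>s. u (\<psi> s)) (\<lambda>s. \<psi>' s *\<^sub>R (Y (\<gamma> (\<psi> s)) t (u (\<psi> s)) *v (M (\<gamma> (\<psi> s)) t *v \<gamma>' (\<psi> s))))"
        by (rule C1_path_compose[OF u(2) \<psi>(1,4)])
      fix s :: real assume s: "s \<in> {0..1}"
      show "norm (\<gamma> (\<psi> s)) \<le> real m" "norm (u (\<psi> s)) \<le> real m" using m \<psi>(4)[OF s] by blast+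
      show "(\<psi>' s *\<^sub>R \<gamma>' (\<psi> s)) \<bullet> (M (\<gamma> (\<psi> s)) t *v (\<psi>' s *\<^sub>R \<gamma>' (\<psi> s))) \<le> (d t a b + \<epsilon>)\<^sup>2" using speed[OF s] .
    qed (use t e d_nonneg[OF t, of a b] \<psi> ends u in \<open>auto simp: matrix_vector_mult_scaleR\<close>)
  qed
qed

end

section \<open>The dissipation inequality\<close>

lemma norm_matrix_vector_mult_le:
  fixes A :: "real^'n^'m"
  shows "norm (A *v x) \<le> norm A * norm x"
proof -
  have "norm (A *v x) = L2_set (\<lambda>i. norm ((A *v x) $ i)) UNIV" by (simp add: norm_vec_def)
  also have "\<dots> \<le> L2_set (\<lambda>i. norm (A $ i) * norm x) UNIV"
    by (intro L2_set_mono) (simp_all add: matrix_vector_mul_component Cauchy_Schwarz_ineq2)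
  also have "\<dots> = norm A * norm x" by (simp add: norm_vec_def L2_set_left_distrib)
  finally show ?thesis .
qed

section \<open>Calculus of C1 paths\<close>

lemma C1_path_const: "C1_path (\<lambda>s. c) (\<lambda>s. 0)"
  unfolding C1_path_def by auto

lemma C1_path_affine: "C1_path (\<lambda>s. a + s *\<^sub>R b) (\<lambda>s. b)"
  unfolding C1_path_def by (auto intro!: derivative_eq_intros)

lemma C1_path_add: "C1_path \<gamma> \<gamma>' \<Longrightarrow> C1_path \<eta> \<eta>' \<Longrightarrow> C1_path (\<lambda>s. \<gamma> s + \<eta> s) (\<lambda>s. \<gamma>' s + \<eta>' s)"
  unfolding C1_path_def by (auto intro!: has_vector_derivative_add continuous_on_add)

lemma C1_path_scaleR: "C1_path \<gamma> \<gamma>' \<Longrightarrow> C1_path (\<lambda>s. (c::real) *\<^sub>R \<gamma> s) (\<lambda>s. c *\<^sub>R \<gamma>' s)"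
  unfolding C1_path_def
  by (auto intro!: bounded_linear.has_vector_derivative[OF bounded_linear_scaleR_right] continuous_intros)

lemma C1_path_Pair: "C1_path \<gamma> \<gamma>' \<Longrightarrow> C1_path \<eta> \<eta>' \<Longrightarrow> C1_path (\<lambda>s. (\<gamma> s, \<eta> s)) (\<lambda>s. (\<gamma>' s, \<eta>' s))"
  unfolding C1_path_def by (auto intro!: has_vector_derivative_Pair continuous_on_Pair)

lemma C1_path_matrix_vector_mult:
  fixes A :: "real \<Rightarrow> real^'n^'m"
  assumes "C1_path A A'" "C1_path u u'"
  shows "C1_path (\<lambda>s. A s *v u s) (\<lambda>s. A s *v u' s + A' s *v u s)"
  using assms C1_path_continuous[OF assms(1)] C1_path_continuous[OF assms(2)] unfolding C1_path_def
  by (auto intro!: bounded_bilinear.has_vector_derivative[OF bounded_bilinear_matrix_vector_mult]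
      continuous_on_add continuous_on_matrix_vector_mult)

lemma C1_path_map:
  fixes \<zeta> :: "real \<Rightarrow> 'a::euclidean_space"
  assumes der: "\<And>z. z \<in> S \<Longrightarrow> (F has_derivative F' z) (at z within S)"
    and cont: "\<And>v. continuous_on S (\<lambda>z. F' z v)"
    and z: "C1_path \<zeta> \<zeta>'" "\<And>s. s \<in> {0..1} \<Longrightarrow> \<zeta> s \<in> S"
  shows "C1_path (\<lambda>s. F (\<zeta> s)) (\<lambda>s. F' (\<zeta> s) (\<zeta>' s))"
proof -
  have lin: "linear (F' x)" if "x \<in> S" for x using der[OF that] has_derivative_linear by blast
  have "((\<lambda>s. F (\<zeta> s)) has_vector_derivative F' (\<zeta> s) (\<zeta>' s)) (at s within {0..1})" if s: "s \<in> {0..1}" for s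
  proof -
    have "(\<zeta> has_derivative (\<lambda>r. r *\<^sub>R \<zeta>' s)) (at s within {0..1})"
      using z(1) s unfolding C1_path_def has_vector_derivative_def by blast
    from has_derivative_along[OF der this s] z(2)
    have "((\<lambda>s. F (\<zeta> s)) has_derivative (\<lambda>r. F' (\<zeta> s) (r *\<^sub>R \<zeta>' s))) (at s within {0..1})" by blast
    then show ?thesis unfolding has_vector_derivative_def linear_cmul[OF lin[OF z(2)[OF s]]] .
  qed
  moreover have "continuous_on {0..1} (\<lambda>s. F' (\<zeta> s) (\<zeta>' s))"
  proof -
    have "continuous_on {0..1} (\<lambda>s. (\<zeta> s, \<zeta>' s))"
      using z(1) C1_path_continuous[OF z(1)] unfolding C1_path_def by (auto intro: continuous_on_Pair)
    from continuous_on_compose2[OF linear_family_continuous[OF lin cont] this] z(2)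
    show ?thesis by (simp add: image_subset_iff)
  qed
  ultimately show ?thesis unfolding C1_path_def by blast
qed

context rccm
begin

text \<open>
  First-order expansion, uniform on compacts, of the squared length of a vector \<open>\<delta> = W p\<close>
  transported for time \<open>h\<close> by the differential dynamics under the lifted control.
\<close>

lemma transported_length:
  fixes R T P c0 :: real and \<omega> :: "real^'p"
  assumes c0: "c0 > 0" and R: "R \<ge> 0" and T: "T \<ge> 0" and P: "P \<ge> 0"
  obtains e h0 where "e > 0" "h0 > 0"
    "\<And>x u w t p h ra rb \<tau> v \<delta> v'. norm x \<le> R \<Longrightarrow> norm u \<le> R \<Longrightarrow> norm w \<le> R \<Longrightarrow> t \<in> {0..T} \<Longrightarrow> norm p \<le> P \<Longrightarrow>
       0 < h \<Longrightarrow> h < h0 \<Longrightarrow> norm ra \<le> e * h \<Longrightarrow> norm rb \<le> e * h \<Longrightarrow> \<bar>\<tau> - (t + h)\<bar> \<le> e * h \<Longrightarrow>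
       \<delta> = W x t *v p \<Longrightarrow> v = vfield f B x u w t \<Longrightarrow>
       v' = fD (x, w, t) (\<delta>, \<omega>, 0) + BD (x, t) (\<delta>, 0) *v u + B x t *v (Y x t u *v p) \<Longrightarrow>
       (\<delta> + h *\<^sub>R v' + rb) \<bullet> (M (x + h *\<^sub>R v + ra) \<tau> *v (\<delta> + h *\<^sub>R v' + rb))
       \<le> \<delta> \<bullet> (M x t *v \<delta>) + h * (\<alpha>\<^sup>2 * (norm \<omega>)\<^sup>2 - (norm (gD (x, u, t) (\<delta>, Y x t u *v p, 0)))\<^sup>2) + c0 * h"
proof -
  let ?K = "cball (0::real^'n) R \<times> {0..T}"
  let ?Kf = "cball (0::real^'n) R \<times> cball (0::real^'p) R \<times> {0..T}"
  let ?S = "UNIV \<times> {0..} :: ((real^'n) \<times> real) set"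
  have K: "compact ?K" "?K \<subseteq> ?S" by (auto intro!: compact_Times)
  have Kf: "compact ?Kf" "?Kf \<subseteq> UNIV \<times> UNIV \<times> {0..}" by (auto intro!: compact_Times)
  have KY: "compact (cball (0::real^'n) R \<times> {0..T} \<times> cball (0::real^'m) R)" by (auto intro!: compact_Times)
  obtain CW where CW: "CW > 0" "\<And>z. z \<in> ?K \<Longrightarrow> norm (case z of (x, t) \<Rightarrow> W x t) \<le> CW"
    using compact_norm_bound[OF K(1) continuous_on_subset[OF smooth_on_continuous[OF W_smooth] K(2)]] by blast
  obtain CB where CB: "CB > 0" "\<And>z. z \<in> ?K \<Longrightarrow> norm (case z of (x, t) \<Rightarrow> B x t) \<le> CB"
    using compact_norm_bound[OF K(1) continuous_on_subset[OF smooth_on_continuous[OF B_smooth] K(2)]] by blast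
  obtain Cf where Cf: "Cf > 0" "\<And>z. z \<in> ?Kf \<Longrightarrow> norm (case z of (x, w, t) \<Rightarrow> f x w t) \<le> Cf"
    using compact_norm_bound[OF Kf(1) continuous_on_subset[OF smooth_on_continuous[OF f_smooth] Kf(2)]] by blast
  have KYs: "cball (0::real^'n) R \<times> {0..T} \<times> cball (0::real^'m) R \<subseteq> UNIV \<times> {0..} \<times> UNIV" by auto
  obtain CY where CY: "CY > 0" "\<And>z. z \<in> cball (0::real^'n) R \<times> {0..T} \<times> cball (0::real^'m) R \<Longrightarrow> norm (case z of (x, t, u) \<Rightarrow> Y x t u) \<le> CY"
    using compact_norm_bound[OF KY continuous_on_subset[OF smooth_on_continuous[OF Y_smooth] KYs]] by blast
  obtain CWD where CWD: "CWD > 0" "\<And>z v. z \<in> ?K \<Longrightarrow> norm (WD z v) \<le> CWD * norm v"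
    using linear_family_bounded[OF WD(3) WD(2) K] by blast
  obtain CBD where CBD: "CBD > 0" "\<And>z v. z \<in> ?K \<Longrightarrow> norm (BD z v) \<le> CBD * norm v"
    using linear_family_bounded[OF BD(3) BD(2) K] by blast
  obtain CfD where CfD: "CfD > 0" "\<And>z v. z \<in> ?Kf \<Longrightarrow> norm (fD z v) \<le> CfD * norm v"
    using linear_family_bounded[OF fD(3) fD(2) Kf] by blast
  have "compact (cball (0::real^'n) (R + 1) \<times> {0..T + 2})" "cball (0::real^'n) (R + 1) \<times> {0..T + 2} \<subseteq> ?S"
    by (auto intro!: compact_Times)
  then obtain c where c: "c > 0" "\<And>x t v. (x, t) \<in> cball (0::real^'n) (R + 1) \<times> {0..T + 2} \<Longrightarrow> norm (M x t *v v) \<le> c * norm v"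
    using M_bound by metis
  \<comment> \<open>\<open>\<Delta>\<close>, \<open>V\<close>, \<open>V'\<close> bound
    \<open>\<delta>\<close>, \<open>v\<close>, \<open>v'\<close>. For the increment of
    \<open>W\<close>, \<open>A1\<close> scales the linearisation error and \<open>A2\<close> the
    size; \<open>A3\<close> scales the residual \<open>res\<close>.\<close>
  define \<Delta> where "\<Delta> = CW * P"
  define V where "V = Cf + CB * R"
  define V' where "V' = CfD * (\<Delta> + norm \<omega>) + CBD * \<Delta> * R + CB * (CY * P)"
  define A1 where "A1 = 2 * CWD + V + 3"
  define A2 where "A2 = (V + 3) * (CWD + 1)"
  define A3 where "A3 = V' + 1 + A2 * P"
  have pos: "\<Delta> \<ge> 0" "V \<ge> 0" "V' \<ge> 0" "A1 \<ge> 0" "A2 \<ge> 0" "A3 \<ge> 0"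
    using CW(1) CB(1) Cf(1) CY(1) CWD(1) CBD(1) CfD(1) R P
    unfolding A3_def A2_def A1_def V'_def V_def \<Delta>_def by auto
  \<comment> \<open>The errors of first order in \<open>h\<close> add up to
    \<open>(2 * P + P\<^sup>2 * A1) * e * h\<close>, the summand 1 makes \<open>q\<close> positive,
    and \<open>e\<close> lets them use half of \<open>c0\<close>. The bound \<open>e \<le> 1\<close>
    ensures \<open>\<tau> \<ge> t\<close>, so that no negative time occurs.\<close>
  define q where "q = 2 * P + P\<^sup>2 * A1 + 1"
  have q: "q > 0" unfolding q_def using P pos by (intro add_nonneg_pos) auto
  define e where "e = min 1 (c0 / (2 * q))"
  have e: "e > 0" "e \<le> 1" "q * e \<le> c0 / 2"
  proof -
    show "e > 0" "e \<le> 1" unfolding e_def using c0 q by auto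
    have "q * e \<le> q * (c0 / (2 * q))" unfolding e_def using q by (intro mult_left_mono) auto
    also have "\<dots> = c0 / 2" using q by simp
    finally show "q * e \<le> c0 / 2" .
  qed
  have "convex ?S" "closed ?S" by (auto intro!: convex_Times closed_Times)
  then obtain \<rho> where \<rho>: "\<rho> > 0" "\<And>x y. x \<in> ?K \<Longrightarrow> y \<in> ?S \<Longrightarrow> norm (y - x) < \<rho> \<Longrightarrow>
      norm ((case y of (x, t) \<Rightarrow> W x t) - (case x of (x, t) \<Rightarrow> W x t) - WD x (y - x)) \<le> e * norm (y - x)"
    using C1_uniform_linearization[OF _ _ WD(1) WD(2) K e(1)] by blast
  define r where "r = c * A3\<^sup>2 + 1"
  have r: "r > 0" unfolding r_def using c by (intro add_nonneg_pos) auto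
  \<comment> \<open>The bounds keep, in this order, \<open>\<tau>\<close> below
    \<open>T + 2\<close>, the increment within the linearisation radius \<open>\<rho>\<close>, the
    new point in the ball of radius \<open>R + 1\<close>, and the quadratic error within the other
    half of \<open>c0\<close>.\<close>
  define h0 where "h0 = min (min 1 (\<rho> / (V + 3))) (min (1 / (V + 1)) (c0 / (2 * r)))"
  have h0: "h0 > 0" unfolding h0_def using \<rho>(1) pos c0 r by auto
  show thesis
  proof (rule that[OF e(1) h0])
    fix x :: "real^'n" and u :: "real^'m" and w :: "real^'p" and t h \<tau> :: real and p ra rb v \<delta> v' :: "real^'n"
    assume x: "norm x \<le> R" and u: "norm u \<le> R" and w: "norm w \<le> R" and t: "t \<in> {0..T}" and p: "norm p \<le> P"
      and h: "0 < h" "h < h0" and ra: "norm ra \<le> e * h" and rb: "norm rb \<le> e * h" and \<tau>: "\<bar>\<tau> - (t + h)\<bar> \<le> e * h"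
      and \<delta>: "\<delta> = W x t *v p" and v: "v = vfield f B x u w t"
      and v': "v' = fD (x, w, t) (\<delta>, \<omega>, 0) + BD (x, t) (\<delta>, 0) *v u + B x t *v (Y x t u *v p)"
    have hh: "h \<le> 1" "h * (V + 3) < \<rho>" "h * (V + 1) \<le> 1" "r * h \<le> c0 / 2"
    proof -
      have *: "h < 1" "h < \<rho> / (V + 3)" "h < 1 / (V + 1)" "h < c0 / (2 * r)" using h unfolding h0_def by auto
      then show "h \<le> 1" "h * (V + 3) < \<rho>" "h * (V + 1) \<le> 1" using pos by (auto simp: pos_less_divide_eq)
      show "r * h \<le> c0 / 2" using * r by (simp add: pos_less_divide_eq algebra_simps)
    qed
    have eh: "e * h \<le> h" using e h by simp
    have xt: "(x, t) \<in> ?K" and xwt: "(x, w, t) \<in> ?Kf" using x w t by auto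
    have t0: "t \<ge> 0" using t by simp
    have nW: "norm (W x t) \<le> CW" and nB: "norm (B x t) \<le> CB" and nf: "norm (f x w t) \<le> Cf" and nY: "norm (Y x t u) \<le> CY"
      using CW(2)[OF xt] CB(2)[OF xt] Cf(2)[OF xwt] CY(2)[of "(x, t, u)"] x u t by auto
    have n\<delta>: "norm \<delta> \<le> \<Delta>"
      unfolding \<delta> \<Delta>_def using norm_matrix_vector_mult_le[of "W x t" p] mult_mono[OF nW p] CW(1) by force
    have nv: "norm v \<le> V"
    proof -
      have "norm (B x t *v u) \<le> CB * R"
        using norm_matrix_vector_mult_le[of "B x t" u] mult_mono[OF nB u] CB(1) by force
      then show ?thesis unfolding v vfield_def V_def using nf norm_triangle_le by (smt (verit))
    qed
    have nv': "norm v' \<le> V'"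
    proof -
      have "norm (\<delta>, \<omega>, 0::real) \<le> norm \<delta> + norm \<omega>"
        using norm_Pair_le[of \<delta> "(\<omega>, 0::real)"] norm_Pair_le[of \<omega> "0::real"] by simp
      then have 1: "norm (fD (x, w, t) (\<delta>, \<omega>, 0)) \<le> CfD * (\<Delta> + norm \<omega>)"
        using CfD(2)[OF xwt, of "(\<delta>, \<omega>, 0)"] n\<delta> CfD(1) by (smt (verit) mult_left_mono)
      have "norm (BD (x, t) (\<delta>, 0)) \<le> CBD * \<Delta>"
        using CBD(2)[OF xt, of "(\<delta>, 0)"] n\<delta> CBD(1) by (smt (verit) mult_left_mono norm_Pair_le norm_zero)
      then have 2: "norm (BD (x, t) (\<delta>, 0) *v u) \<le> CBD * \<Delta> * R"
        using norm_matrix_vector_mult_le[of "BD (x, t) (\<delta>, 0)" u] mult_mono[of "norm (BD (x, t) (\<delta>, 0))" "CBD * \<Delta>" "norm u" R]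
          u CBD(1) pos by force
      have "norm (Y x t u *v p) \<le> CY * P"
        using norm_matrix_vector_mult_le[of "Y x t u" p] mult_mono[OF nY p] CY(1) by force
      then have 3: "norm (B x t *v (Y x t u *v p)) \<le> CB * (CY * P)"
        using norm_matrix_vector_mult_le[of "B x t" "Y x t u *v p"] mult_mono[OF nB, of "norm (Y x t u *v p)" "CY * P"] CB(1) by force
      show ?thesis unfolding v' V'_def by (intro norm_triangle_le add_mono 1 2 3)
    qed
    define \<eta> where "\<eta> = x + h *\<^sub>R v + ra"
    define \<zeta> where "\<zeta> = \<delta> + h *\<^sub>R v' + rb"
    have hv: "norm (h *\<^sub>R v) \<le> h * V" using nv h by simp
    have \<tau>0: "\<tau> \<ge> 0" using \<tau> eh t0 h by linarith
    have in2: "(\<eta>, \<tau>) \<in> cball 0 (R + 1) \<times> {0..T + 2}"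
    proof -
      have "norm \<eta> \<le> norm x + norm (h *\<^sub>R v) + norm ra" unfolding \<eta>_def by (meson add_mono norm_triangle_le order_refl)
      also have "\<dots> \<le> R + h * V + h" using x hv ra eh by linarith
      also have "\<dots> \<le> R + 1" using hh(3) by (simp add: distrib_left)
      finally have "norm \<eta> \<le> R + 1" .
      moreover have "\<tau> \<le> T + 2" using \<tau> eh t hh(1) by auto
      ultimately show ?thesis using \<tau>0 by simp
    qed
    define dz where "dz = (\<eta>, \<tau>) - (x, t)"
    have dz: "dz = h *\<^sub>R (v, 1) + (ra, \<tau> - (t + h))" unfolding dz_def \<eta>_def by simp
    have nr: "norm (ra, \<tau> - (t + h)) \<le> 2 * e * h"
      using norm_Pair_le[of ra "\<tau> - (t + h)"] ra \<tau> by simp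
    have ndz: "norm dz \<le> h * (V + 3)"
    proof -
      have "norm (h *\<^sub>R (v, 1::real)) \<le> h * (V + 1)"
      proof -
        have "norm (v, 1::real) \<le> V + 1" using norm_Pair_le[of v "1::real"] nv by simp
        then show ?thesis unfolding norm_scaleR using h by (intro mult_mono) auto
      qed
      then have "norm dz \<le> h * (V + 1) + 2 * e * h" unfolding dz using nr by (intro norm_triangle_le add_mono)
      also have "\<dots> \<le> h * (V + 1) + 2 * h" using eh by simp
      also have "\<dots> = h * (V + 3)" by (simp add: algebra_simps)
      finally show ?thesis .
    qed
    define DW where "DW = W \<eta> \<tau> - W x t"
    have lin: "norm (DW - WD (x, t) dz) \<le> e * (h * (V + 3))"
    proof -
      have "norm (DW - WD (x, t) dz) \<le> e * norm dz"
        using \<rho>(2)[OF xt, of "(\<eta>, \<tau>)"] \<tau>0 ndz hh(2) unfolding DW_def dz_def by simp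
      also have "\<dots> \<le> e * (h * (V + 3))" using ndz e(1) by (intro mult_left_mono) auto
      finally show ?thesis .
    qed
    have linWD: "linear (WD (x, t))" using t0 by (intro WD(3)) auto
    have D1: "norm (DW - h *\<^sub>R WD (x, t) (v, 1)) \<le> e * h * A1"
    proof -
      have "WD (x, t) dz = h *\<^sub>R WD (x, t) (v, 1) + WD (x, t) (ra, \<tau> - (t + h))"
        unfolding dz linear_add[OF linWD] linear_cmul[OF linWD] ..
      then have "DW - h *\<^sub>R WD (x, t) (v, 1) = (DW - WD (x, t) dz) + WD (x, t) (ra, \<tau> - (t + h))" by simp
      moreover have "norm (WD (x, t) (ra, \<tau> - (t + h))) \<le> CWD * (2 * e * h)"
        using CWD(2)[OF xt, of "(ra, \<tau> - (t + h))"] mult_left_mono[OF nr, of CWD] CWD(1) by linarith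
      ultimately have "norm (DW - h *\<^sub>R WD (x, t) (v, 1)) \<le> e * (h * (V + 3)) + CWD * (2 * e * h)"
        using lin by (metis add_mono norm_triangle_le)
      then show ?thesis unfolding A1_def by (simp add: algebra_simps)
    qed
    have D2: "norm DW \<le> h * A2"
    proof -
      have "norm (WD (x, t) dz) \<le> CWD * (h * (V + 3))"
        using CWD(2)[OF xt, of dz] mult_left_mono[OF ndz, of CWD] CWD(1) by linarith
      moreover have "e * (h * (V + 3)) \<le> 1 * (h * (V + 3))" using e h pos by (intro mult_right_mono) auto
      moreover have "norm DW \<le> norm (DW - WD (x, t) dz) + norm (WD (x, t) dz)"
        using norm_triangle_ineq[of "DW - WD (x, t) dz" "WD (x, t) dz"] by simp
      ultimately show ?thesis unfolding A2_def using lin by (simp add: algebra_simps)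
    qed
    \<comment> \<open>\<open>p\<close> is frozen at the old point. It fails to be the covector of
      the new vector only by \<open>res\<close>, which is of order \<open>h\<close>, so
      \<open>pos_def_inv_quadratic\<close> contributes an error of order
      \<open>h * h\<close>.\<close>
    define res where "res = \<zeta> - W \<eta> \<tau> *v p"
    have nres: "norm res \<le> h * A3"
    proof -
      have "res = h *\<^sub>R v' + rb - DW *v p"
        unfolding res_def \<zeta>_def DW_def \<delta> by (simp add: matrix_vector_mult_diff_rdistrib)
      then have "norm res \<le> norm (h *\<^sub>R v') + norm rb + norm (DW *v p)"
        by (smt (verit) norm_triangle_ineq norm_triangle_ineq4)
      moreover have "norm (h *\<^sub>R v') \<le> h * V'" using nv' h by simp
      moreover have "norm (DW *v p) \<le> h * A2 * P"
        using norm_matrix_vector_mult_le[of DW p] mult_mono[OF D2 p] h pos by force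
      ultimately show ?thesis unfolding A3_def using rb eh by (simp add: algebra_simps)
    qed
    have rMr: "res \<bullet> (M \<eta> \<tau> *v res) \<le> c * A3\<^sup>2 * h * h"
    proof -
      have "res \<bullet> (M \<eta> \<tau> *v res) \<le> norm res * norm (M \<eta> \<tau> *v res)" by (rule norm_cauchy_schwarz)
      also have "\<dots> \<le> norm res * (c * norm res)" using c(2)[OF in2] by (intro mult_left_mono) auto
      also have "\<dots> = c * (norm res)\<^sup>2" by (simp add: power2_eq_square)
      also have "\<dots> \<le> c * (h * A3)\<^sup>2" using nres c(1) by (intro mult_left_mono power_mono) auto
      finally show ?thesis by (simp add: power_mult_distrib power2_eq_square algebra_simps)
    qed
    have pDWp: "h * (p \<bullet> (WD (x, t) (v, 1) *v p)) - P\<^sup>2 * (e * h * A1) \<le> p \<bullet> (DW *v p)"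
    proof -
      define E where "E = DW - h *\<^sub>R WD (x, t) (v, 1)"
      have "\<bar>p \<bullet> (E *v p)\<bar> \<le> norm p * norm (E *v p)" by (rule Cauchy_Schwarz_ineq2)
      also have "\<dots> \<le> norm p * (norm E * norm p)" using norm_matrix_vector_mult_le[of E p] by (intro mult_left_mono) auto
      also have "\<dots> = (norm p)\<^sup>2 * norm E" by (simp add: power2_eq_square)
      also have "\<dots> \<le> P\<^sup>2 * (e * h * A1)" using D1 p unfolding E_def by (intro mult_mono power_mono) auto
      finally have "- (P\<^sup>2 * (e * h * A1)) \<le> p \<bullet> (E *v p)" by linarith
      moreover have "p \<bullet> (DW *v p) = h * (p \<bullet> (WD (x, t) (v, 1) *v p)) + p \<bullet> (E *v p)"
        unfolding E_def by (simp add: matrix_vector_mult_diff_rdistrib inner_diff_right scaleR_matrix_vector_assoc[symmetric])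
      ultimately show ?thesis by linarith
    qed
    have prb: "p \<bullet> rb \<le> P * (e * h)"
      using norm_cauchy_schwarz[of p rb] mult_mono[OF p rb] P by force
    have base: "\<delta> \<bullet> (M x t *v \<delta>) = p \<bullet> \<delta>" "p \<bullet> (W x t *v p) = p \<bullet> \<delta>"
      unfolding \<delta> using pos_def_inv(2)[OF W_pos_def[OF t0]] by (simp_all add: inner_commute)
    have "\<zeta> \<bullet> (M \<eta> \<tau> *v \<zeta>) = 2 * (p \<bullet> \<zeta>) - p \<bullet> (W \<eta> \<tau> *v p) + res \<bullet> (M \<eta> \<tau> *v res)"
      unfolding res_def by (rule pos_def_inv_quadratic[OF W_pos_def[OF \<tau>0]])
    also have "p \<bullet> (W \<eta> \<tau> *v p) = p \<bullet> \<delta> + p \<bullet> (DW *v p)"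
      unfolding base(2)[symmetric] DW_def by (simp add: matrix_vector_mult_diff_rdistrib inner_diff_right)
    also have "p \<bullet> \<zeta> = p \<bullet> \<delta> + h * (p \<bullet> v') + p \<bullet> rb"
      unfolding \<zeta>_def by (simp add: inner_add_right)
    finally have eq: "\<zeta> \<bullet> (M \<eta> \<tau> *v \<zeta>) = p \<bullet> \<delta> + 2 * (h * (p \<bullet> v')) + 2 * (p \<bullet> rb) - p \<bullet> (DW *v p) + res \<bullet> (M \<eta> \<tau> *v res)"
      by simp
    define G where "G = \<alpha>\<^sup>2 * (norm \<omega>)\<^sup>2 - (norm (gD (x, u, t) (\<delta>, Y x t u *v p, 0)))\<^sup>2"
    have "2 * (p \<bullet> v') - p \<bullet> (WD (x, t) (v, 1) *v p) \<le> G"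
      unfolding v' v G_def using LMI_dissipation[OF t0 \<delta> refl] by simp
    then have "h * (2 * (p \<bullet> v') - p \<bullet> (WD (x, t) (v, 1) *v p)) \<le> h * G" using h by (intro mult_left_mono) auto
    then have main: "2 * (h * (p \<bullet> v')) - h * (p \<bullet> (WD (x, t) (v, 1) *v p)) \<le> h * G" by (simp add: algebra_simps)
    have "\<zeta> \<bullet> (M \<eta> \<tau> *v \<zeta>) \<le> p \<bullet> \<delta> + h * G + (2 * (P * (e * h)) + P\<^sup>2 * (e * h * A1)) + c * A3\<^sup>2 * h * h"
      using eq main prb pDWp rMr by linarith
    also have "2 * (P * (e * h)) + P\<^sup>2 * (e * h * A1) \<le> c0 / 2 * h"
    proof -
      have "2 * (P * (e * h)) + P\<^sup>2 * (e * h * A1) + e * h = q * e * h" unfolding q_def by (simp add: algebra_simps)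
      moreover have "q * e * h \<le> c0 / 2 * h" using e(3) h by (intro mult_right_mono) auto
      moreover have "0 \<le> e * h" using e h by simp
      ultimately show ?thesis by linarith
    qed
    also have "c * A3\<^sup>2 * h * h \<le> c0 / 2 * h"
    proof -
      have "c * A3\<^sup>2 * h \<le> r * h" unfolding r_def using h by (simp add: distrib_right)
      from order_trans[OF this hh(4)] show ?thesis using h by (intro mult_right_mono) auto
    qed
    finally show "(\<delta> + h *\<^sub>R v' + rb) \<bullet> (M (x + h *\<^sub>R v + ra) \<tau> *v (\<delta> + h *\<^sub>R v' + rb))
       \<le> \<delta> \<bullet> (M x t *v \<delta>) + h * (\<alpha>\<^sup>2 * (norm \<omega>)\<^sup>2 - (norm (gD (x, u, t) (\<delta>, Y x t u *v p, 0)))\<^sup>2) + c0 * h"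
      unfolding \<zeta>_def[symmetric] \<eta>_def[symmetric] G_def[symmetric] base(1) by simp
  qed
qed

lemma vfield_continuous: "continuous_on (UNIV \<times> UNIV \<times> {0..}) (\<lambda>(x, u, t). vfield f B x u w t)"
proof -
  have 1: "continuous_on (UNIV \<times> UNIV \<times> {0..}) (\<lambda>z :: (real^'n) \<times> (real^'m) \<times> real. f (fst z) w (snd (snd z)))"
    using continuous_on_compose2[OF smooth_on_continuous[OF f_smooth],
      of "UNIV \<times> UNIV \<times> {0..}" "\<lambda>z :: (real^'n) \<times> (real^'m) \<times> real. (fst z, w, snd (snd z))"]
    by (simp add: continuous_on_Pair continuous_on_fst continuous_on_snd continuous_on_const image_subset_iff)
  have 2: "continuous_on (UNIV \<times> UNIV \<times> {0..}) (\<lambda>z :: (real^'n) \<times> (real^'m) \<times> real. B (fst z) (snd (snd z)))"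
    using continuous_on_compose2[OF smooth_on_continuous[OF B_smooth],
      of "UNIV \<times> UNIV \<times> {0..}" "\<lambda>z :: (real^'n) \<times> (real^'m) \<times> real. (fst z, snd (snd z))"]
    by (simp add: continuous_on_Pair continuous_on_fst continuous_on_snd continuous_on_const image_subset_iff)
  show ?thesis unfolding vfield_def split_beta
    using 1 2 by (intro continuous_on_add continuous_on_matrix_vector_mult)
      (simp_all add: continuous_on_fst continuous_on_snd)
qed

lemma continuous_on_near:
  fixes F :: "'x::metric_space \<Rightarrow> 'y::metric_space"
  assumes "continuous_on S F" "z \<in> S" "\<epsilon> > 0"
  obtains \<rho> where "\<rho> > 0" "\<And>z'. z' \<in> S \<Longrightarrow> dist z' z < \<rho> \<Longrightarrow> dist (F z') (F z) < \<epsilon>"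
  using assms unfolding continuous_on_iff by blast

text \<open>
  Transport a nearly shortest lifted path by the flow for time \<open>h\<close>, correct its end points
  affinely, and compare energies. Integrating the speed of the output path is where
  \<open>\<bar>y - y\<^sup>\<star>\<bar>\<^sup>2\<close> enters.
\<close>

lemma dissipation_step:
  assumes t: "t \<ge> 0" and D: "D \<ge> 0" and cl: "((a, b, t, u0, D), \<kappa>) \<in> closure (lifted m)" and c0: "c0 > 0"
  obtains e h0 where "e > 0" "h0 > 0"
    "\<And>h a' b'. 0 < h \<Longrightarrow> h < h0 \<Longrightarrow> norm (a' - a - h *\<^sub>R vfield f B a u0 ws t) \<le> e * h \<Longrightarrow>
       norm (b' - b - h *\<^sub>R vfield f B b \<kappa> w t) \<le> e * h \<Longrightarrow>
       (d (t + h) a' b')\<^sup>2 \<le> D\<^sup>2 + h * (\<alpha>\<^sup>2 * (norm (w - ws))\<^sup>2 - (norm (g b \<kappa> t - g a u0 t))\<^sup>2 + c0)"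
proof -
  \<comment> \<open>The velocity of the disturbance path. \<open>R\<close> bounds that path together
    with all members of \<open>lifted m\<close>, and \<open>T\<close> leaves room for approximants
    at times later than \<open>t\<close>.\<close>
  define \<omega> where "\<omega> = w - ws"
  define R where "R = max (real m) (norm ws + norm \<omega>)"
  define T where "T = t + 1"
  have R: "R \<ge> 0" "real m \<le> R" "norm ws + norm \<omega> \<le> R" and T: "T \<ge> 0" using t unfolding R_def T_def by auto
  have "compact (cball (0::real^'n) R \<times> {0..T})" "cball (0::real^'n) R \<times> {0..T} \<subseteq> UNIV \<times> {0..}"
    by (auto intro!: compact_Times)
  then obtain c where c: "c > 0" "\<And>x t v. (x, t) \<in> cball (0::real^'n) R \<times> {0..T} \<Longrightarrow> (norm (M x t *v v))\<^sup>2 \<le> c * (v \<bullet> (M x t *v v))"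
    using M_bound_sq by metis
  \<comment> \<open>Bounds the covectors of paths of speed at most \<open>D + 1\<close>; the extra 1
    admits the approximate \<open>D'\<close>.\<close>
  define P where "P = sqrt (c * (D + 1)\<^sup>2)"
  have P: "P \<ge> 0" "P\<^sup>2 = c * (D + 1)\<^sup>2" unfolding P_def using c by auto
  have c04: "c0 / 4 > 0" using c0 by simp
  \<comment> \<open>The constants depend only on the bounds, so they fit every member of
    \<open>lifted m\<close> near the limit point and can be fixed before such a member is
    chosen.\<close>
  show thesis
  proof (rule transported_length[OF c04 R(1) T P(1), of \<omega>])
    fix e1 h1 :: real assume e1: "e1 > 0" "h1 > 0" and
      core: "\<And>x u w t p h ra rb \<tau> v \<delta> v'. norm x \<le> R \<Longrightarrow> norm u \<le> R \<Longrightarrow> norm w \<le> R \<Longrightarrow> t \<in> {0..T} \<Longrightarrow> norm p \<le> P \<Longrightarrow>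
         0 < h \<Longrightarrow> h < h1 \<Longrightarrow> norm ra \<le> e1 * h \<Longrightarrow> norm rb \<le> e1 * h \<Longrightarrow> \<bar>\<tau> - (t + h)\<bar> \<le> e1 * h \<Longrightarrow>
         \<delta> = W x t *v p \<Longrightarrow> v = vfield f B x u w t \<Longrightarrow>
         v' = fD (x, w, t) (\<delta>, \<omega>, 0) + BD (x, t) (\<delta>, 0) *v u + B x t *v (Y x t u *v p) \<Longrightarrow>
         (\<delta> + h *\<^sub>R v' + rb) \<bullet> (M (x + h *\<^sub>R v + ra) \<tau> *v (\<delta> + h *\<^sub>R v' + rb))
         \<le> \<delta> \<bullet> (M x t *v \<delta>) + h * (\<alpha>\<^sup>2 * (norm \<omega>)\<^sup>2 - (norm (gD (x, u, t) (\<delta>, Y x t u *v p, 0)))\<^sup>2) + c0/4 * h"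
    \<comment> \<open>Each end contributes \<open>3 * e * h\<close>: the given defect, the
      approximation of the point and the change of the vector field. The affine correction adds at
      most \<open>6 * e * h\<close>, nine in all.\<close>
    define e where "e = e1 / 9"
    have e: "e > 0" "9 * e = e1" unfolding e_def using e1 by auto
    let ?S = "UNIV \<times> UNIV \<times> {0..} :: ((real^'n) \<times> (real^'m) \<times> real) set"
    let ?v0 = "vfield f B a u0 ws t" and ?v1 = "vfield f B b \<kappa> w t"
    have S: "(a, u0, t) \<in> ?S" "(b, \<kappa>, t) \<in> ?S" using t by auto
    obtain \<rho>0 where \<rho>0: "\<rho>0 > 0" "\<And>z'. z' \<in> ?S \<Longrightarrow> dist z' (a, u0, t) < \<rho>0 \<Longrightarrow>
        dist ((\<lambda>(x, u, t). vfield f B x u ws t) z') ((\<lambda>(x, u, t). vfield f B x u ws t) (a, u0, t)) < e"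
      using continuous_on_near[OF vfield_continuous S(1) e(1)] by blast
    obtain \<rho>1 where \<rho>1: "\<rho>1 > 0" "\<And>z'. z' \<in> ?S \<Longrightarrow> dist z' (b, \<kappa>, t) < \<rho>1 \<Longrightarrow>
        dist ((\<lambda>(x, u, t). vfield f B x u w t) z') ((\<lambda>(x, u, t). vfield f B x u w t) (b, \<kappa>, t)) < e"
      using continuous_on_near[OF vfield_continuous S(2) e(1)] by blast
    define Q where "Q z = (norm ((\<lambda>(x, u, t). g x u t) (fst z) - (\<lambda>(x, u, t). g x u t) (snd z)))\<^sup>2" for z
    have "continuous_on (?S \<times> ?S) Q" unfolding Q_def
      by (intro continuous_intros continuous_on_compose2[OF smooth_on_continuous[OF g_smooth]]) auto
    moreover have "((b, \<kappa>, t), (a, u0, t)) \<in> ?S \<times> ?S" using S by blast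
    ultimately obtain \<rho>2 where \<rho>2: "\<rho>2 > 0" "\<And>z'. z' \<in> ?S \<times> ?S \<Longrightarrow> dist z' ((b, \<kappa>, t), (a, u0, t)) < \<rho>2 \<Longrightarrow>
        dist (Q z') (Q ((b, \<kappa>, t), (a, u0, t))) < c0/4"
      using continuous_on_near[of "?S \<times> ?S" Q _ "c0/4"] c0 by (metis divide_pos_pos zero_less_numeral)
    show thesis
    proof (rule that[OF e(1) e1(2)])
      fix h a'' b'' assume h: "0 < h" "h < h1" and a'': "norm (a'' - a - h *\<^sub>R ?v0) \<le> e * h" and b'': "norm (b'' - b - h *\<^sub>R ?v1) \<le> e * h"
      \<comment> \<open>The approximant is chosen after \<open>h\<close>, so its distance from the
        limit may be required to be of order \<open>h\<close>. The entries control the ends and the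
        time, the two vector fields, \<open>D' \<le> D + 1\<close>, the output, and the error of
        \<open>D'\<^sup>2\<close>.\<close>
      define \<mu> where "\<mu> = min (min (e * h) (min (\<rho>0/3) (\<rho>1/3))) (min (min 1 (\<rho>2/6)) (c0 * h / (4 * (2 * D + 1))))"
      have "\<mu> > 0" unfolding \<mu>_def using e h \<rho>0(1) \<rho>1(1) \<rho>2(1) c0 D by (auto intro!: divide_pos_pos mult_pos_pos)
      then obtain z' where z': "z' \<in> lifted m" "dist z' ((a, b, t, u0, D), \<kappa>) < \<mu>"
        using cl unfolding closure_approachable by blast
      from z'(1) obtain a' b' t' u0' D' \<kappa>' \<gamma> \<gamma>' u u' where z'_eq: "z' = ((a', b', t', u0', D'), \<kappa>')"
        and t': "t' \<ge> 0" and D': "D' \<ge> 0" and C1: "C1_path \<gamma> \<gamma>'" "C1_path u u'"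
        and ends: "\<gamma> 0 = a'" "\<gamma> 1 = b'" "u 0 = u0'" "u 1 = \<kappa>'"
        and bnd: "\<And>s. s \<in> {0..1} \<Longrightarrow> norm (\<gamma> s) \<le> real m" "\<And>s. s \<in> {0..1} \<Longrightarrow> norm (u s) \<le> real m"
        and speed: "\<And>s. s \<in> {0..1} \<Longrightarrow> \<gamma>' s \<bullet> (M (\<gamma> s) t' *v \<gamma>' s) \<le> D'\<^sup>2"
        and lift: "\<And>s. s \<in> {0..1} \<Longrightarrow> u' s = Y (\<gamma> s) t' (u s) *v (M (\<gamma> s) t' *v \<gamma>' s)"
        unfolding lifted_def by blast
      have near: "dist a' a < \<mu>" "dist b' b < \<mu>" "dist t' t < \<mu>" "dist u0' u0 < \<mu>" "dist D' D < \<mu>" "dist \<kappa>' \<kappa> < \<mu>"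
        using z'(2) dist_fst_le[of z' "((a, b, t, u0, D), \<kappa>)"] dist_snd_le[of z' "((a, b, t, u0, D), \<kappa>)"]
          dist_fst_le[of "(a', b', t', u0', D')" "(a, b, t, u0, D)"] dist_snd_le[of "(a', b', t', u0', D')" "(a, b, t, u0, D)"]
          dist_fst_le[of "(b', t', u0', D')" "(b, t, u0, D)"] dist_snd_le[of "(b', t', u0', D')" "(b, t, u0, D)"]
          dist_fst_le[of "(t', u0', D')" "(t, u0, D)"] dist_snd_le[of "(t', u0', D')" "(t, u0, D)"]
          dist_fst_le[of "(u0', D')" "(u0, D)"] dist_snd_le[of "(u0', D')" "(u0, D)"]
        unfolding z'_eq fst_conv snd_conv by linarith+
      have \<mu>: "\<mu> \<le> e * h" "3 * \<mu> \<le> \<rho>0" "3 * \<mu> \<le> \<rho>1" "\<mu> \<le> 1" "6 * \<mu> \<le> \<rho>2" "\<mu> \<le> c0 * h / (4 * (2 * D + 1))"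
        unfolding \<mu>_def by auto
      have d3: "dist (p, q, r) (p', q', r') < 3 * \<mu>" if "dist p p' < \<mu>" "dist q q' < \<mu>" "dist r r' < \<mu>"
        for p p' :: "real^'n" and q q' :: "real^'m" and r r' :: real
      proof -
        have "dist (p, q, r) (p', q', r') \<le> dist p p' + dist (q, r) (q', r')"
          unfolding dist_prod_def[of "(p, q, r)"] by (simp add: sqrt_sum_squares_le_sum)
        also have "dist (q, r) (q', r') \<le> dist q q' + dist r r'"
          unfolding dist_prod_def[of "(q, r)"] by (simp add: sqrt_sum_squares_le_sum)
        finally show ?thesis using that by linarith
      qed
      have S': "(a', u0', t') \<in> ?S" "(b', \<kappa>', t') \<in> ?S" using t' by auto
      have near0: "dist (a', u0', t') (a, u0, t) < 3 * \<mu>" and near1: "dist (b', \<kappa>', t') (b, \<kappa>, t) < 3 * \<mu>"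
        using near by (auto intro: d3)
      have vf0: "norm (vfield f B a' u0' ws t' - ?v0) \<le> e" using \<rho>0(2)[OF S'(1)] near0 \<mu>(2) by (simp add: dist_norm)
      have vf1: "norm (vfield f B b' \<kappa>' w t' - ?v1) \<le> e" using \<rho>1(2)[OF S'(2)] near1 \<mu>(3) by (simp add: dist_norm)
      have out: "(norm (g b \<kappa> t - g a u0 t))\<^sup>2 - c0/4 \<le> (norm (g b' \<kappa>' t' - g a' u0' t'))\<^sup>2"
      proof -
        have "dist ((b', \<kappa>', t'), (a', u0', t')) ((b, \<kappa>, t), (a, u0, t)) \<le> dist (b', \<kappa>', t') (b, \<kappa>, t) + dist (a', u0', t') (a, u0, t)"
          unfolding dist_prod_def[of "((b', \<kappa>', t'), (a', u0', t'))"] by (simp add: sqrt_sum_squares_le_sum)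
        also have "\<dots> < \<rho>2" using near0 near1 \<mu>(5) by linarith
        finally have "dist (Q ((b', \<kappa>', t'), (a', u0', t'))) (Q ((b, \<kappa>, t), (a, u0, t))) < c0/4"
          using S' by (intro \<rho>2(2)) auto
        then show ?thesis unfolding Q_def dist_real_def prod.case fst_conv snd_conv by linarith
      qed
      have D'sq: "D'\<^sup>2 \<le> D\<^sup>2 + c0/4 * h" and D'1: "D' \<le> D + 1"
      proof -
        have "\<bar>D' - D\<bar> < \<mu>" using near(5) by (simp add: dist_real_def)
        then show D'1: "D' \<le> D + 1" using \<mu>(4) by linarith
        have "D'\<^sup>2 - D\<^sup>2 = (D' - D) * (D' + D)" by (simp add: power2_eq_square algebra_simps)
        also have "\<dots> \<le> \<mu> * (2 * D + 1)" using \<open>\<bar>D' - D\<bar> < \<mu>\<close> D'1 D D' by (intro mult_mono) auto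
        also have "\<dots> \<le> c0 * h / (4 * (2 * D + 1)) * (2 * D + 1)" using \<mu>(6) D by (intro mult_right_mono) auto
        also have "\<dots> = c0 * h / 4"
        proof -
          have "X / (4 * q) * q = X / 4" if "q > 0" for X q :: real using that by simp
          then show ?thesis using D by (metis add_nonneg_pos mult_nonneg_nonneg zero_le_numeral zero_less_one)
        qed
        finally show "D'\<^sup>2 \<le> D\<^sup>2 + c0/4 * h" by simp
      qed
      have t'T: "t' \<in> {0..T}" using t' near(3) \<mu>(4) unfolding T_def dist_real_def by auto
      define wp where "wp s = ws + s *\<^sub>R \<omega>" for s :: real
      define v where "v s = vfield f B (\<gamma> s) (u s) (wp s) t'" for s
      define v' where "v' s = fD (\<gamma> s, wp s, t') (\<gamma>' s, \<omega>, 0) + (B (\<gamma> s) t' *v u' s + BD (\<gamma> s, t') (\<gamma>' s, 0) *v u s)" for s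
      have Cv: "C1_path v v'"
      proof -
        have "C1_path (\<lambda>s. (\<gamma> s, wp s, t')) (\<lambda>s. (\<gamma>' s, \<omega>, 0))"
          unfolding wp_def by (intro C1_path_Pair C1 C1_path_affine C1_path_const)
        from C1_path_map[OF fD(1) fD(2) this] t'
        have 1: "C1_path (\<lambda>s. f (\<gamma> s) (wp s) t') (\<lambda>s. fD (\<gamma> s, wp s, t') (\<gamma>' s, \<omega>, 0))" by simp
        have "C1_path (\<lambda>s. (\<gamma> s, t')) (\<lambda>s. (\<gamma>' s, 0))" by (intro C1_path_Pair C1 C1_path_const)
        from C1_path_map[OF BD(1) BD(2) this] t'
        have 2: "C1_path (\<lambda>s. B (\<gamma> s) t') (\<lambda>s. BD (\<gamma> s, t') (\<gamma>' s, 0))" by simp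
        show ?thesis unfolding v_def v'_def vfield_def
          by (intro C1_path_add 1 C1_path_matrix_vector_mult 2 C1)
      qed
      define y where "y s = g (\<gamma> s) (u s) t'" for s
      define y' where "y' s = gD (\<gamma> s, u s, t') (\<gamma>' s, u' s, 0)" for s
      have Cy: "C1_path y y'"
      proof -
        have "C1_path (\<lambda>s. (\<gamma> s, u s, t')) (\<lambda>s. (\<gamma>' s, u' s, 0))" by (intro C1_path_Pair C1 C1_path_const)
        from C1_path_map[OF gD(1) gD(2) this] t' show ?thesis unfolding y_def y'_def by simp
      qed
      \<comment> \<open>Defects of the transported ends against the prescribed ones. Interpolating
        them affinely changes the velocity of the path by the constant \<open>r1 - r0\<close>
        only.\<close>
      define r0 where "r0 = a'' - a' - h *\<^sub>R v 0"
      define r1 where "r1 = b'' - b' - h *\<^sub>R v 1"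
      have v01: "v 0 = vfield f B a' u0' ws t'" "v 1 = vfield f B b' \<kappa>' w t'"
        unfolding v_def wp_def \<omega>_def by (simp_all add: ends)
      have r0: "norm r0 \<le> 3 * e * h"
      proof -
        have "r0 = (a'' - a - h *\<^sub>R ?v0) + (a - a') + h *\<^sub>R (?v0 - vfield f B a' u0' ws t')"
          unfolding r0_def v01 by (simp add: algebra_simps)
        then have "norm r0 \<le> norm (a'' - a - h *\<^sub>R ?v0) + norm (a - a') + norm (h *\<^sub>R (?v0 - vfield f B a' u0' ws t'))"
          by (metis add_mono norm_triangle_le order_refl)
        moreover have "norm (h *\<^sub>R (?v0 - vfield f B a' u0' ws t')) \<le> h * e"
          unfolding norm_scaleR using vf0 h by (intro mult_mono) (auto simp: norm_minus_commute)
        moreover have "norm (a - a') \<le> e * h" using near(1) \<mu>(1) by (simp add: dist_norm norm_minus_commute)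
        ultimately show ?thesis using a'' by (simp add: algebra_simps)
      qed
      have r1: "norm r1 \<le> 3 * e * h"
      proof -
        have "r1 = (b'' - b - h *\<^sub>R ?v1) + (b - b') + h *\<^sub>R (?v1 - vfield f B b' \<kappa>' w t')"
          unfolding r1_def v01 by (simp add: algebra_simps)
        then have "norm r1 \<le> norm (b'' - b - h *\<^sub>R ?v1) + norm (b - b') + norm (h *\<^sub>R (?v1 - vfield f B b' \<kappa>' w t'))"
          by (metis add_mono norm_triangle_le order_refl)
        moreover have "norm (h *\<^sub>R (?v1 - vfield f B b' \<kappa>' w t')) \<le> h * e"
          unfolding norm_scaleR using vf1 h by (intro mult_mono) (auto simp: norm_minus_commute)
        moreover have "norm (b - b') \<le> e * h" using near(2) \<mu>(1) by (simp add: dist_norm norm_minus_commute)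
        ultimately show ?thesis using b'' by (simp add: algebra_simps)
      qed
      define ra where "ra s = r0 + s *\<^sub>R (r1 - r0)" for s :: real
      have rb: "norm (r1 - r0) \<le> 6 * e * h" using norm_triangle_ineq4[of r1 r0] r0 r1 by linarith
      have eh0: "0 \<le> e * h" using e h by simp
      have rb': "norm (r1 - r0) \<le> e1 * h" using rb eh0 unfolding e(2)[symmetric] by simp
      have ra: "norm (ra s) \<le> e1 * h" if s: "s \<in> {0..1}" for s
      proof -
        have "norm (s *\<^sub>R (r1 - r0)) \<le> 1 * (6 * e * h)" unfolding norm_scaleR using s rb by (intro mult_mono) auto
        then have "norm (ra s) \<le> 3 * e * h + 6 * e * h" unfolding ra_def using r0 by (intro norm_triangle_le) linarith
        then show ?thesis unfolding e(2)[symmetric] by simp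
      qed
      define \<eta> where "\<eta> s = \<gamma> s + h *\<^sub>R v s + ra s" for s
      define \<eta>' where "\<eta>' s = \<gamma>' s + h *\<^sub>R v' s + (r1 - r0)" for s
      have C\<eta>: "C1_path \<eta> \<eta>'" unfolding \<eta>_def \<eta>'_def ra_def
        by (intro C1_path_add C1 C1_path_scaleR Cv C1_path_affine)
      have \<eta>01: "\<eta> 0 = a''" "\<eta> 1 = b''" unfolding \<eta>_def ra_def by (simp_all add: ends r0_def r1_def)
      have th: "t + h \<ge> 0" using t h by simp
      have pt: "\<eta>' s \<bullet> (M (\<eta> s) (t + h) *v \<eta>' s) \<le> D'\<^sup>2 + h * (\<alpha>\<^sup>2 * (norm \<omega>)\<^sup>2 - (norm (y' s))\<^sup>2) + c0/4 * h"
        if s: "s \<in> {0..1}" for s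
      proof -
        define p where "p = M (\<gamma> s) t' *v \<gamma>' s"
        have gW: "\<gamma>' s = W (\<gamma> s) t' *v p" unfolding p_def using pos_def_inv(1)[OF W_pos_def[OF t']] by metis
        have \<gamma>R: "norm (\<gamma> s) \<le> R" "norm (u s) \<le> R" using bnd[OF s] R by auto
        have "norm (s *\<^sub>R \<omega>) \<le> 1 * norm \<omega>" unfolding norm_scaleR using s by (intro mult_right_mono) auto
        then have wR: "norm (wp s) \<le> R" unfolding wp_def using R(3) by (intro norm_triangle_le) linarith
        have "(norm p)\<^sup>2 \<le> P\<^sup>2"
        proof -
          have "(norm p)\<^sup>2 \<le> c * (\<gamma>' s \<bullet> (M (\<gamma> s) t' *v \<gamma>' s))" unfolding p_def using \<gamma>R t'T by (intro c(2)) auto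
          also have "\<dots> \<le> c * (D + 1)\<^sup>2"
            using speed[OF s] power_mono[OF D'1 D', of 2] c(1) by (intro mult_left_mono) auto
          finally show ?thesis unfolding P(2) .
        qed
        then have pP: "norm p \<le> P" using P(1) by (rule power2_le_imp_le)
        have "\<mu> \<le> e1 * h" using \<mu>(1) eh0 unfolding e(2)[symmetric] by linarith
        \<comment> \<open>The path lives at time \<open>t'\<close>, but its transport is measured at
          \<open>t + h\<close> instead of \<open>t' + h\<close>; the separate time argument of
          \<open>transported_length\<close> absorbs this shift.\<close>
        then have tt: "\<bar>(t + h) - (t' + h)\<bar> \<le> e1 * h" using near(3) by (simp add: dist_real_def)
        have v's: "v' s = fD (\<gamma> s, wp s, t') (\<gamma>' s, \<omega>, 0) + BD (\<gamma> s, t') (\<gamma>' s, 0) *v u s + B (\<gamma> s) t' *v (Y (\<gamma> s) t' (u s) *v p)"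
          unfolding v'_def lift[OF s] p_def by (simp add: algebra_simps)
        have "y' s = gD (\<gamma> s, u s, t') (\<gamma>' s, Y (\<gamma> s) t' (u s) *v p, 0)" unfolding y'_def lift[OF s] p_def ..
        with core[OF \<gamma>R wR t'T pP h ra[OF s] rb' tt gW v_def v's] speed[OF s]
        show ?thesis unfolding \<eta>_def \<eta>'_def by simp
      qed
      have cy': "continuous_on {0..1} (\<lambda>s. (norm (y' s))\<^sup>2)"
        using Cy unfolding C1_path_def by (auto intro!: continuous_intros)
      define A where "A = D'\<^sup>2 + h * (\<alpha>\<^sup>2 * (norm \<omega>)\<^sup>2) + c0/4 * h"
      have ptA: "\<eta>' s \<bullet> (M (\<eta> s) (t + h) *v \<eta>' s) \<le> A - h * (norm (y' s))\<^sup>2" if "s \<in> {0..1}" for s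
        using pt[OF that] unfolding A_def by (simp add: right_diff_distrib)
      have "(d (t + h) a'' b'')\<^sup>2 \<le> integral {0..1} (\<lambda>s. \<eta>' s \<bullet> (M (\<eta> s) (t + h) *v \<eta>' s))"
        using riem_dist_sq_le_energy[OF M_cont[OF th] M_nonneg[OF th] C\<eta>] d_nonneg[OF th, of a'' b'']
        unfolding d_def \<eta>01 by simp
      also have "\<dots> \<le> integral {0..1} (\<lambda>s. A - h * (norm (y' s))\<^sup>2)"
        using ptA continuous_on_speed(2)[OF M_cont[OF th] C\<eta>] cy'
        by (intro integral_le integrable_continuous_real) (auto intro!: continuous_on_diff continuous_on_mult_left)
      also have "\<dots> = A - h * integral {0..1} (\<lambda>s. (norm (y' s))\<^sup>2)"
        using cy' by (subst integral_diff) (auto intro!: integrable_continuous_real continuous_on_mult_left)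
      also have "h * (norm (y 1 - y 0))\<^sup>2 \<le> h * integral {0..1} (\<lambda>s. (norm (y' s))\<^sup>2)"
        using C1_path_increment_le[OF Cy] h by (intro mult_left_mono) auto
      then have "A - h * integral {0..1} (\<lambda>s. (norm (y' s))\<^sup>2) \<le> A - h * (norm (y 1 - y 0))\<^sup>2" by simp
      also have "y 1 - y 0 = g b' \<kappa>' t' - g a' u0' t'" unfolding y_def ends ..
      finally have "(d (t + h) a'' b'')\<^sup>2 \<le> A - h * (norm (g b' \<kappa>' t' - g a' u0' t'))\<^sup>2" .
      moreover have "h * ((norm (g b \<kappa> t - g a u0 t))\<^sup>2 - c0/4) \<le> h * (norm (g b' \<kappa>' t' - g a' u0' t'))\<^sup>2"
        using out h by (intro mult_left_mono) auto
      \<comment> \<open>A quarter of \<open>c0\<close> went to each of the transport,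
        \<open>D'\<^sup>2\<close> and the output; the last quarter is slack.\<close>
      moreover have "0 \<le> c0 * h" using c0 h by simp
      ultimately show "(d (t + h) a'' b'')\<^sup>2 \<le> D\<^sup>2 + h * (\<alpha>\<^sup>2 * (norm (w - ws))\<^sup>2 - (norm (g b \<kappa> t - g a u0 t))\<^sup>2 + c0)"
        using D'sq unfolding A_def \<omega>_def[symmetric] by (simp add: algebra_simps)
    qed
  qed
qed

end

section \<open>The controller\<close>

text \<open>Projecting a closed set along a compact factor gives a closed set, so all hitting sets
  of a single \<open>Z m\<close> are closed. Selecting at the least level with a point over
  \<open>\<theta>\<close> keeps the sections compact, and its hitting sets are built from countably
  many differences of closed sets.\<close>

lemma borel_selection_union_compact:
  fixes Z :: "nat \<Rightarrow> ('a::euclidean_space \<times> (real^'m)) set"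
  assumes cl: "\<And>m. closed (Z m)" and bnd: "\<And>m \<theta> \<kappa>. (\<theta>, \<kappa>) \<in> Z m \<Longrightarrow> norm \<kappa> \<le> real m"
  obtains k where "k \<in> borel_measurable borel" "\<And>\<theta> m \<kappa>. (\<theta>, \<kappa>) \<in> Z m \<Longrightarrow> \<exists>m. (\<theta>, k \<theta>) \<in> Z m"
proof -
  define Hit where "Hit m C = {\<theta>. \<exists>\<kappa>\<in>C. (\<theta>, \<kappa>) \<in> Z m}" for m C
  have closed_Hit: "closed (Hit m C)" if "closed C" for m C
  proof -
    have "closed ({(\<kappa>, \<theta>). (\<theta>, \<kappa>) \<in> Z m} \<inter> C \<times> UNIV)"
    proof (intro closed_Int closed_Times that)
      have "closed ((\<lambda>z. (snd z, fst z)) -` Z m)"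
        by (intro continuous_closed_vimage cl) (intro continuous_intros)
      moreover have "(\<lambda>z. (snd z, fst z)) -` Z m = {(\<kappa>, \<theta>). (\<theta>, \<kappa>) \<in> Z m}" by auto
      ultimately show "closed {(\<kappa>, \<theta>). (\<theta>, \<kappa>) \<in> Z m}" by simp
    qed auto
    from closed_compact_projection[OF compact_cball[of 0 "real m"] this]
    have "closed {\<theta>. \<exists>\<kappa>. \<kappa> \<in> cball 0 (real m) \<and> (\<kappa>, \<theta>) \<in> {(\<kappa>, \<theta>). (\<theta>, \<kappa>) \<in> Z m} \<inter> C \<times> UNIV}" .
    moreover have "{\<theta>. \<exists>\<kappa>. \<kappa> \<in> cball 0 (real m) \<and> (\<kappa>, \<theta>) \<in> {(\<kappa>, \<theta>). (\<theta>, \<kappa>) \<in> Z m} \<inter> C \<times> UNIV} = Hit m C"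
      unfolding Hit_def using bnd by fastforce
    ultimately show ?thesis by simp
  qed
  define N where "N \<theta> = (LEAST m. \<theta> \<in> Hit m UNIV)" for \<theta>
  \<comment> \<open>The default 0 only makes every section nonempty; the selection is claimed to lie
    in some \<open>Z m\<close> only where one has a point over \<open>\<theta>\<close>.\<close>
  define S where "S \<theta> = (if \<exists>m. \<theta> \<in> Hit m UNIV then {\<kappa>. (\<theta>, \<kappa>) \<in> Z (N \<theta>)} else {0})" for \<theta>
  have N: "\<theta> \<in> Hit (N \<theta>) UNIV" if "\<theta> \<in> Hit m UNIV" for \<theta> m
    unfolding N_def using that by (rule LeastI)
  have comp: "compact (S \<theta>) \<and> S \<theta> \<noteq> {}" for \<theta>
  proof (cases "\<exists>m. \<theta> \<in> Hit m UNIV")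
    case True
    then have "\<theta> \<in> Hit (N \<theta>) UNIV" using N by blast
    then have "S \<theta> \<noteq> {}" unfolding S_def Hit_def by auto
    moreover have "compact {\<kappa>. (\<theta>, \<kappa>) \<in> Z (N \<theta>)}"
    proof -
      have "closed (Pair \<theta> -` Z (N \<theta>))" by (intro continuous_closed_vimage cl) (intro continuous_intros)
      moreover have "bounded (Pair \<theta> -` Z (N \<theta>))" using bnd by (auto simp: bounded_iff)
      ultimately show ?thesis by (simp add: compact_eq_bounded_closed vimage_def)
    qed
    ultimately show ?thesis using True unfolding S_def by simp
  qed (simp add: S_def)
  have hit: "{\<theta> \<in> space borel. S \<theta> \<inter> C \<noteq> {}} \<in> sets borel" if C: "closed C" for C
  proof -
    have "{\<theta> \<in> space borel. S \<theta> \<inter> C \<noteq> {}} =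
      (\<Union>m. Hit m C - (\<Union>j<m. Hit j UNIV)) \<union> (if 0 \<in> C then UNIV - (\<Union>m. Hit m UNIV) else {})"
      (is "?L = ?R")
    proof (intro set_eqI)
      fix \<theta>
      show "\<theta> \<in> ?L \<longleftrightarrow> \<theta> \<in> ?R"
      proof (cases "\<exists>m. \<theta> \<in> Hit m UNIV")
        case True
        have least: "\<theta> \<in> Hit m C - (\<Union>j<m. Hit j UNIV) \<longleftrightarrow> m = N \<theta> \<and> \<theta> \<in> Hit m C" for m
        proof
          assume m: "\<theta> \<in> Hit m C - (\<Union>j<m. Hit j UNIV)"
          then have "\<theta> \<in> Hit m UNIV" unfolding Hit_def by blast
          then have "N \<theta> = m" unfolding N_def using m by (intro Least_equality) (auto simp: not_less[symmetric])
          then show "m = N \<theta> \<and> \<theta> \<in> Hit m C" using m by blast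
        next
          assume m: "m = N \<theta> \<and> \<theta> \<in> Hit m C"
          then show "\<theta> \<in> Hit m C - (\<Union>j<m. Hit j UNIV)" unfolding N_def using not_less_Least by blast
        qed
        have "\<theta> \<in> ?L \<longleftrightarrow> \<theta> \<in> Hit (N \<theta>) C" using True unfolding S_def Hit_def by auto
        also have "\<dots> \<longleftrightarrow> (\<exists>m. \<theta> \<in> Hit m C - (\<Union>j<m. Hit j UNIV))" unfolding least by blast
        also have "\<dots> \<longleftrightarrow> \<theta> \<in> ?R" using True by auto
        finally show ?thesis .
      next
        case False
        then have "\<theta> \<notin> Hit m C" for m unfolding Hit_def by blast
        then show ?thesis using False unfolding S_def by auto
      qed
    qed
    also have "\<dots> \<in> sets borel"
    proof -
      have H: "Hit m C \<in> sets borel" "Hit m UNIV \<in> sets borel" for m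
        by (intro borel_closed closed_Hit C closed_UNIV)+
      then show ?thesis by (intro sets.Un sets.countable_UN sets.Diff) auto
    qed
    finally show ?thesis .
  qed
  show thesis
  proof (rule measurable_selection_compact[of borel S, OF comp hit])
    fix k assume k: "k \<in> borel_measurable borel" and kS: "\<And>\<theta>. \<theta> \<in> space borel \<Longrightarrow> k \<theta> \<in> S \<theta>"
    show thesis
    proof (rule that[OF k])
      fix \<theta> m \<kappa> assume "(\<theta>, \<kappa>) \<in> Z m"
      then have "\<theta> \<in> Hit m UNIV" unfolding Hit_def by blast
      then have "S \<theta> = {\<kappa>. (\<theta>, \<kappa>) \<in> Z (N \<theta>)}" unfolding S_def by auto
      then show "\<exists>m. (\<theta>, k \<theta>) \<in> Z m" using kS[of \<theta>] by auto
    qed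
  qed
qed

context rccm
begin

lemma closure_lifted_bound: "(\<theta>, \<kappa>) \<in> closure (lifted m) \<Longrightarrow> norm \<kappa> \<le> real m"
proof -
  assume *: "(\<theta>, \<kappa>) \<in> closure (lifted m)"
  have "norm \<kappa> \<le> real m" if "((a, b, t, u0, D), \<kappa>) \<in> lifted m" for a b t u0 D \<kappa>
  proof -
    from that obtain u :: "real \<Rightarrow> real^'m" where "u 1 = \<kappa>" "\<forall>s\<in>{0..1}. norm (u s) \<le> real m"
      unfolding lifted_def by blast
    then show ?thesis by (metis atLeastAtMost_iff order_refl zero_le_one)
  qed
  then have "lifted m \<subseteq> UNIV \<times> cball 0 (real m)" by auto
  then have "closure (lifted m) \<subseteq> UNIV \<times> cball 0 (real m)" by (intro closure_minimal closed_Times) auto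
  then show ?thesis using * by auto
qed

lemma closure_lifted_ex:
  assumes t: "t \<ge> 0"
  shows "\<exists>m \<kappa>. ((a, b, t, u0, d t a b), \<kappa>) \<in> closure (lifted m)"
proof -
  obtain \<kappa> m where *: "\<And>\<epsilon>. \<epsilon> > 0 \<Longrightarrow> ((a, b, t, u0, d t a b + \<epsilon>), \<kappa>) \<in> lifted m"
    using lifted_near_geodesic[OF t] by blast
  have "((a, b, t, u0, d t a b), \<kappa>) \<in> closure (lifted m)"
    unfolding closure_approachable
  proof (intro allI impI)
    fix e :: real assume "e > 0"
    then have "dist ((a, b, t, u0, d t a b + e/2), \<kappa>) ((a, b, t, u0, d t a b), \<kappa>) < e"
      by (simp add: dist_prod_def dist_real_def)
    then show "\<exists>y\<in>lifted m. dist y ((a, b, t, u0, d t a b), \<kappa>) < e" using *[of "e/2"] \<open>e > 0\<close> by (meson half_gt_zero)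
  qed
  then show ?thesis by blast
qed

lemma d_self: "t \<ge> 0 \<Longrightarrow> d t a a = 0"
proof -
  assume t: "t \<ge> 0"
  obtain C where C: "C \<ge> 0" "\<And>s a' b. s \<in> {0..t} \<Longrightarrow> norm a' \<le> norm a \<Longrightarrow> norm b \<le> norm a \<Longrightarrow> d s a' b \<le> C * norm (b - a')"
    using d_le_norm[of t "norm a"] by blast
  from C(2)[of t a a] show ?thesis using d_nonneg[OF t, of a a] t by simp
qed

lemma lifted_trivial:
  assumes t: "t \<ge> 0"
  shows "\<exists>m. ((a, a, t, u0, 0), u0) \<in> closure (lifted m)"
proof -
  define m where "m = nat \<lceil>max (norm a) (norm u0)\<rceil>"
  have m: "norm a \<le> real m" "norm u0 \<le> real m"
    using real_nat_ceiling_ge[of "max (norm a) (norm u0)"] unfolding m_def by linarith+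
  have "((a, a, t, u0, 0), u0) \<in> lifted m"
    unfolding lifted_def mem_Collect_eq
    by (rule exI[of _ a], rule exI[of _ a], rule exI[of _ t], rule exI[of _ u0], rule exI[of _ 0], rule exI[of _ u0],
        rule conjI[OF refl], rule exI[of _ "\<lambda>_. a"], rule exI[of _ "\<lambda>_. 0"], rule exI[of _ "\<lambda>_. u0"],
        rule exI[of _ "\<lambda>_. 0"]) (simp add: t m C1_path_const)
  then show ?thesis using closure_subset by blast
qed

text \<open>The distance is a separate argument, so the selection is a Borel function on a Euclidean
  space; measurability of the feedback then reduces to that of its five arguments.\<close>

lemma borel_controller:
  obtains k where "k \<in> borel_measurable borel"
    "\<And>t a b u0. t \<ge> 0 \<Longrightarrow> \<exists>m. ((a, b, t, u0, d t a b), k (a, b, t, u0, d t a b)) \<in> closure (lifted m)"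
    "\<And>t a u0. k (a, a, t, u0, d t a a) = u0"
proof -
  show thesis
  proof (rule borel_selection_union_compact[of "\<lambda>m. closure (lifted m)", OF closed_closure closure_lifted_bound])
    fix k assume k: "k \<in> borel_measurable borel"
      "\<And>\<theta> m \<kappa>. (\<theta>, \<kappa>) \<in> closure (lifted m) \<Longrightarrow> \<exists>m. (\<theta>, k \<theta>) \<in> closure (lifted m)"
    \<comment> \<open>On the diagonal the value is set to \<open>u0\<close>, so that the feedback
      reproduces \<open>us\<close> along \<open>xs\<close>. By \<open>lifted_trivial\<close> the
      constant path keeps this a legitimate selection.\<close>
    define k' where "k' \<theta> = (if \<theta> \<in> {\<theta>. fst \<theta> = fst (snd \<theta>)} then fst (snd (snd (snd \<theta>))) else k \<theta>)" for \<theta>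
    have cl: "closed {\<theta> :: (real^'n) \<times> (real^'n) \<times> real \<times> (real^'m) \<times> real. fst \<theta> = fst (snd \<theta>)}"
      by (intro closed_Collect_eq continuous_intros)
    have meas: "k' \<in> borel_measurable borel"
      unfolding k'_def
    proof (rule measurable_If_set)
      show "(\<lambda>\<theta> :: (real^'n) \<times> (real^'n) \<times> real \<times> (real^'m) \<times> real. fst (snd (snd (snd \<theta>)))) \<in> borel_measurable borel"
        by (intro borel_measurable_continuous_onI continuous_intros)
      show "{\<theta> :: (real^'n) \<times> (real^'n) \<times> real \<times> (real^'m) \<times> real. fst \<theta> = fst (snd \<theta>)} \<inter> space borel \<in> sets borel"
        using borel_closed[OF cl] by simp
    qed (rule k(1))
    show thesis
    proof (rule that[OF meas])
      fix t :: real and a b :: "real^'n" and u0 :: "real^'m" assume t: "t \<ge> 0"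
      show "\<exists>m. ((a, b, t, u0, d t a b), k' (a, b, t, u0, d t a b)) \<in> closure (lifted m)"
      proof (cases "a = b")
        case True
        then show ?thesis using lifted_trivial[OF t, of a u0] d_self[OF t, of a] by (simp add: k'_def)
      next
        case False
        then show ?thesis using closure_lifted_ex[OF t, of a b u0] k(2) by (simp add: k'_def) blast
      qed
    qed (simp add: k'_def)
  qed
qed

end

section \<open>The storage function\<close>

lemma solution_onD:
  assumes "solution_on f B T u x w" "t \<in> {0..T}"
  shows "x t = x 0 + integral {0..t} (\<lambda>s. vfield f B (x s) (u s) (w s) s)"
  using assms(1) unfolding solution_on_def by (elim conjE) (rule bspec[OF _ assms(2)])

lemma solution_continuous:
  assumes "solution_on f B T u x w"
  shows "continuous_on {0..T} x"
proof -
  let ?v = "\<lambda>s. vfield f B (x s) (u s) (w s) s"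
  have "?v integrable_on {0..T}" using assms unfolding solution_on_def absolutely_integrable_on_def by blast
  then have "continuous_on {0..T} (\<lambda>t. x 0 + integral {0..t} ?v)"
    by (intro continuous_on_add continuous_on_const indefinite_integral_continuous_1)
  then show ?thesis
    by (rule continuous_on_eq) (rule solution_onD[OF assms, symmetric])
qed

lemma solution_increment:
  assumes sol: "solution_on f B T u x w" and th: "0 \<le> t" "0 \<le> h" "t + h \<le> T"
  shows "x (t + h) - x t = integral {t..t+h} (\<lambda>s. vfield f B (x s) (u s) (w s) s)"
    and "norm (x (t + h) - x t) \<le> integral {t..t+h} (\<lambda>s. norm (vfield f B (x s) (u s) (w s) s))"
proof -
  let ?v = "\<lambda>s. vfield f B (x s) (u s) (w s) s"
  have int: "?v integrable_on {0..T}" "(\<lambda>s. norm (?v s)) integrable_on {0..T}"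
    using sol unfolding solution_on_def absolutely_integrable_on_def by blast+
  have c: "integral {0..t} ?v + integral {t..t+h} ?v = integral {0..t+h} ?v"
    using th by (intro Henstock_Kurzweil_Integration.integral_combine integrable_subinterval_real[OF int(1)]) auto
  have a: "x (t + h) = x 0 + integral {0..t+h} ?v" by (rule solution_onD[OF sol]) (use th in simp)
  have b: "x t = x 0 + integral {0..t} ?v" by (rule solution_onD[OF sol]) (use th in simp)
  show eq: "x (t + h) - x t = integral {t..t+h} ?v" unfolding a b c[symmetric] by simp
  show "norm (x (t + h) - x t) \<le> integral {t..t+h} (\<lambda>s. norm (?v s))"
    unfolding eq using th
    by (intro integral_norm_bound_integral integrable_subinterval_real[OF int(1)] integrable_subinterval_real[OF int(2)]) auto
qed

context rccm
begin

text \<open>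
  \<open>V t = (d t (xs t) (x t))\<^sup>2\<close> satisfies the dissipation inequality almost everywhere and is
  controlled by an absolutely continuous function everywhere, which is what \<open>dini_integral_bound\<close> needs.
\<close>

lemma storage_inequality:
  assumes k: "\<And>t a b u0. t \<ge> 0 \<Longrightarrow> \<exists>m. ((a, b, t, u0, d t a b), k (a, b, t, u0, d t a b)) \<in> closure (lifted m)"
    and K: "\<And>t x. t \<ge> 0 \<Longrightarrow> K x t = k (xs t, x, t, us t, d t (xs t) x)"
    and T: "T > 0" and sols: "solution_on f B T us xs ws" and sol: "solution_on f B T (\<lambda>t. K (x t) t) x w"
    and x0: "x 0 = xs 0"
    and \<psi>: "\<psi> integrable_on {0..T}"
    and \<psi>_ge: "\<And>t. t \<in> {0..T} \<Longrightarrow>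
      \<alpha>\<^sup>2 * (norm (w t - ws t))\<^sup>2 - (norm (g (x t) (K (x t) t) t - g (xs t) (us t) t))\<^sup>2 \<le> \<psi> t"
  shows "0 \<le> integral {0..T} \<psi>"
proof -
  define vx where "vx s = vfield f B (x s) (K (x s) s) (w s) s" for s
  define vs where "vs s = vfield f B (xs s) (us s) (ws s) s" for s
  define gg where "gg s = norm (vx s) + norm (vs s)" for s
  have ivx: "vx integrable_on {0..T}" "(\<lambda>s. norm (vx s)) integrable_on {0..T}"
    using sol unfolding solution_on_def absolutely_integrable_on_def vx_def by blast+
  have ivs: "vs integrable_on {0..T}" "(\<lambda>s. norm (vs s)) integrable_on {0..T}"
    using sols unfolding solution_on_def absolutely_integrable_on_def vs_def by blast+
  have igg: "gg integrable_on {0..T}" unfolding gg_def using ivx ivs by (intro integrable_add)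
  have cx: "continuous_on {0..T} x" and cxs: "continuous_on {0..T} xs"
    using solution_continuous sol sols by blast+
  define G where "G t = integral {0..t} gg" for t
  define dd where "dd t = d t (xs t) (x t)" for t
  define V where "V t = (dd t)\<^sup>2" for t
  have cdd: "continuous_on {0..T} dd"
  proof -
    have "continuous_on {0..T} (\<lambda>t. (xs t, x t, t))" using cx cxs by (intro continuous_on_Pair continuous_on_id)
    from continuous_on_compose2[OF d_continuous this] show ?thesis unfolding dd_def by (simp add: image_subset_iff)
  qed
  obtain R1 where R1: "R1 > 0" "\<And>t. t \<in> {0..T} \<Longrightarrow> norm (x t) \<le> R1" using compact_norm_bound[OF compact_Icc cx] by blast
  obtain R2 where R2: "R2 > 0" "\<And>t. t \<in> {0..T} \<Longrightarrow> norm (xs t) \<le> R2" using compact_norm_bound[OF compact_Icc cxs] by blast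
  obtain Dm where Dm: "Dm > 0" "\<And>t. t \<in> {0..T} \<Longrightarrow> norm (dd t) \<le> Dm" using compact_norm_bound[OF compact_Icc cdd] by blast
  \<comment> \<open>The extra 1 makes room for the auxiliary points \<open>a''\<close> and
    \<open>b''\<close>; \<open>h1\<close> limits their displacement to 1.\<close>
  define R where "R = max R1 R2 + 1"
  obtain C where C: "C \<ge> 0"
    "\<And>t a b a' b'. t \<in> {0..T} \<Longrightarrow> norm a \<le> R \<Longrightarrow> norm b \<le> R \<Longrightarrow> norm a' \<le> R \<Longrightarrow> norm b' \<le> R \<Longrightarrow>
       d t a' b' \<le> d t a b + C * (norm (a' - a) + norm (b' - b))"
    using d_lipschitz[of T R] by blast
  \<comment> \<open>\<open>C\<close> is the Lipschitz constant of the distance; squaring brings in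
    the factor \<open>2 * Dm\<close>.\<close>
  define L where "L = 2 * Dm * C"
  have L: "L \<ge> 0" unfolding L_def using Dm C by simp
  have dG: "norm (x (t + h) - x t) + norm (xs (t + h) - xs t) \<le> G (t + h) - G t" if th: "0 \<le> t" "0 \<le> h" "t + h \<le> T" for t h
  proof -
    have "norm (x (t + h) - x t) + norm (xs (t + h) - xs t) \<le> integral {t..t+h} (\<lambda>s. norm (vx s)) + integral {t..t+h} (\<lambda>s. norm (vs s))"
      using solution_increment(2)[OF sol th] solution_increment(2)[OF sols th] unfolding vx_def vs_def by linarith
    also have "\<dots> = integral {t..t+h} gg"
      unfolding gg_def using th
      by (intro integral_add[symmetric] integrable_subinterval_real[OF ivx(2)] integrable_subinterval_real[OF ivs(2)]) auto
    also have "\<dots> = G (t + h) - G t"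
      using Henstock_Kurzweil_Integration.integral_combine[of 0 t "t + h" gg] th integrable_subinterval_real[OF igg, of 0 "t + h"]
      unfolding G_def by auto
    finally show ?thesis .
  qed
  \<comment> \<open>This must hold at every \<open>t\<close>, also where the trajectories have no
    derivative. The dissipation step is applied to the fictitious points that move straight with
    both disturbances set to 0, and the Lipschitz bound corrects them to the true points.
    \<open>c\<close> may depend on \<open>t\<close>, \<open>L\<close> does not.\<close>
  have rough: "\<exists>c\<ge>0. \<exists>h1>0. \<forall>h. 0 < h \<and> h < h1 \<and> t + h \<le> T \<longrightarrow> V (t + h) \<le> V t + h * c + L * (G (t + h) - G t)"
    if t: "t \<in> {0..<T}" for t
  proof -
    have t0: "t \<ge> 0" using t by simp
    obtain m where cl: "((xs t, x t, t, us t, dd t), K (x t) t) \<in> closure (lifted m)"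
      using k[OF t0, of "xs t" "x t" "us t"] unfolding K[OF t0] dd_def by blast
    define v0 where "v0 = vfield f B (xs t) (us t) 0 t"
    define v1 where "v1 = vfield f B (x t) (K (x t) t) 0 t"
    have dd0: "dd t \<ge> 0" unfolding dd_def using d_nonneg[OF t0] .
    obtain e h0 where h0: "e > 0" "h0 > 0"
      "\<And>h a' b'. 0 < h \<Longrightarrow> h < h0 \<Longrightarrow> norm (a' - xs t - h *\<^sub>R vfield f B (xs t) (us t) 0 t) \<le> e * h \<Longrightarrow>
       norm (b' - x t - h *\<^sub>R vfield f B (x t) (K (x t) t) 0 t) \<le> e * h \<Longrightarrow>
       (d (t + h) a' b')\<^sup>2 \<le> (dd t)\<^sup>2 + h * (\<alpha>\<^sup>2 * (norm (0 - 0 :: real^'p))\<^sup>2 - (norm (g (x t) (K (x t) t) t - g (xs t) (us t) t))\<^sup>2 + 1)"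
      by (rule dissipation_step[OF t0 dd0 cl zero_less_one]) blast
    define c where "c = 1 + 2 * Dm * C * (norm v0 + norm v1)"
    have c: "c \<ge> 0" unfolding c_def using Dm C by simp
    define h1 where "h1 = min h0 (1 / (norm v0 + norm v1 + 1))"
    have h1: "h1 > 0" unfolding h1_def using h0(2) by (simp add: add_nonneg_pos)
    show ?thesis
    proof (rule exI[of _ c], rule conjI[OF c], rule exI[of _ h1], rule conjI[OF h1], intro allI impI)
      fix h assume h: "0 < h \<and> h < h1 \<and> t + h \<le> T"
      have hv: "h * (norm v0 + norm v1) \<le> 1"
      proof -
        have "h \<le> 1 / (norm v0 + norm v1 + 1)" using h unfolding h1_def by simp
        then have "h * (norm v0 + norm v1 + 1) \<le> 1" by (simp add: pos_le_divide_eq add_nonneg_pos)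
        then show ?thesis using h by (simp add: algebra_simps)
      qed
      define a'' where "a'' = xs t + h *\<^sub>R v0"
      define b'' where "b'' = x t + h *\<^sub>R v1"
      define s where "s = d (t + h) a'' b''"
      have s: "s \<ge> 0" unfolding s_def using t0 h by (intro d_nonneg) auto
      have "s\<^sup>2 \<le> V t + h * (0 - (norm (g (x t) (K (x t) t) t - g (xs t) (us t) t))\<^sup>2 + 1)"
        using h0(3)[of h a'' b''] h h0(1) unfolding s_def a''_def b''_def v0_def v1_def V_def h1_def by simp
      also have "\<dots> \<le> V t + h * 1" using h by (intro add_left_mono mult_left_mono) auto
      finally have s2: "s\<^sup>2 \<le> V t + h" by simp
      have tT: "t \<in> {0..T}" "t + h \<in> {0..T}" using t h by auto
      have "norm a'' \<le> norm (xs t) + h * norm v0" "norm b'' \<le> norm (x t) + h * norm v1"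
        unfolding a''_def b''_def using h norm_triangle_ineq[of "xs t" "h *\<^sub>R v0"] norm_triangle_ineq[of "x t" "h *\<^sub>R v1"] by auto
      moreover have "h * norm v0 \<le> 1" "h * norm v1 \<le> 1"
      proof -
        have "0 \<le> h * norm v0" "0 \<le> h * norm v1" using h by auto
        then show "h * norm v0 \<le> 1" "h * norm v1 \<le> 1" using hv unfolding distrib_left by linarith+
      qed
      ultimately have nR: "norm a'' \<le> R" "norm b'' \<le> R" "norm (xs (t + h)) \<le> R" "norm (x (t + h)) \<le> R"
        using R1(2)[OF tT(1)] R2(2)[OF tT(1)] R1(2)[OF tT(2)] R2(2)[OF tT(2)] unfolding R_def by linarith+
      define X where "X = C * ((G (t + h) - G t) + h * (norm v0 + norm v1))"
      have "norm (xs (t + h) - a'') \<le> norm (xs (t + h) - xs t) + h * norm v0"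
        using norm_triangle_ineq4[of "xs (t + h) - xs t" "h *\<^sub>R v0"] h unfolding a''_def by (simp add: algebra_simps)
      moreover have "norm (x (t + h) - b'') \<le> norm (x (t + h) - x t) + h * norm v1"
        using norm_triangle_ineq4[of "x (t + h) - x t" "h *\<^sub>R v1"] h unfolding b''_def by (simp add: algebra_simps)
      ultimately have "norm (xs (t + h) - a'') + norm (x (t + h) - b'') \<le> (G (t + h) - G t) + h * (norm v0 + norm v1)"
        using dG[of t h] t0 h by (simp add: distrib_left)
      then have "C * (norm (xs (t + h) - a'') + norm (x (t + h) - b'')) \<le> X"
        unfolding X_def using C(1) by (rule mult_left_mono)
      then have y: "dd (t + h) \<le> s + X"
        using C(2)[OF tT(2) nR] unfolding dd_def s_def by linarith
      have X: "X \<ge> 0"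
      proof -
        have "norm (x (t + h) - x t) + norm (xs (t + h) - xs t) \<le> G (t + h) - G t" by (rule dG) (use t0 h in auto)
        then have "0 \<le> G (t + h) - G t"
          using norm_ge_zero[of "x (t + h) - x t"] norm_ge_zero[of "xs (t + h) - xs t"] by linarith
        then show ?thesis unfolding X_def using C(1) h by simp
      qed
      have y0: "dd (t + h) \<ge> 0" "dd (t + h) \<le> Dm"
        using d_nonneg[of "t + h"] Dm(2)[OF tT(2)] t0 h unfolding dd_def by auto
      have "(dd (t + h))\<^sup>2 \<le> s\<^sup>2 + 2 * Dm * X"
      \<comment> \<open>Factoring the difference of squares into monotone bounds needs a nonnegative
        difference.\<close>
      proof (cases "s \<le> dd (t + h)")
        case True
        have "(dd (t + h))\<^sup>2 - s\<^sup>2 = (dd (t + h) - s) * (dd (t + h) + s)" by (simp add: power2_eq_square algebra_simps)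
        also have "\<dots> \<le> X * (2 * Dm)" using True y y0 s X by (intro mult_mono) auto
        finally show ?thesis by (simp add: algebra_simps)
      next
        case False
        then have "(dd (t + h))\<^sup>2 \<le> s\<^sup>2" using y0 by (intro power_mono) auto
        moreover have "0 \<le> 2 * Dm * X" using Dm X by simp
        ultimately show ?thesis by linarith
      qed
      moreover have "2 * Dm * X = L * (G (t + h) - G t) + h * (2 * Dm * C * (norm v0 + norm v1))"
        unfolding X_def L_def by (simp add: algebra_simps)
      ultimately show "V (t + h) \<le> V t + h * c + L * (G (t + h) - G t)"
        using s2 unfolding V_def[of "t + h"] c_def by (simp add: distrib_left)
    qed
  qed
  obtain N1 where N1: "negligible N1" "\<And>t e. t \<in> {0..<T} - N1 \<Longrightarrow> e > 0 \<Longrightarrow> \<exists>d>0. \<forall>h. 0 < h \<and> h < d \<and> t + h \<le> T \<longrightarrow>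
       norm (integral {0..t+h} vx - integral {0..t} vx - h *\<^sub>R vx t) \<le> e * h"
    using indefinite_integral_right_derivative_ae[OF ivx(1)] by blast
  obtain N2 where N2: "negligible N2" "\<And>t e. t \<in> {0..<T} - N2 \<Longrightarrow> e > 0 \<Longrightarrow> \<exists>d>0. \<forall>h. 0 < h \<and> h < d \<and> t + h \<le> T \<longrightarrow>
       norm (integral {0..t+h} vs - integral {0..t} vs - h *\<^sub>R vs t) \<le> e * h"
    using indefinite_integral_right_derivative_ae[OF ivs(1)] by blast
  obtain N3 where N3: "negligible N3" "\<And>t e. t \<in> {0..<T} - N3 \<Longrightarrow> e > 0 \<Longrightarrow> \<exists>d>0. \<forall>h. 0 < h \<and> h < d \<and> t + h \<le> T \<longrightarrow>
       norm (integral {0..t+h} gg - integral {0..t} gg - h *\<^sub>R gg t) \<le> e * h"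
    using indefinite_integral_right_derivative_ae[OF igg] by blast
  define N where "N = N1 \<union> N2 \<union> N3"
  have N: "negligible N" unfolding N_def using N1(1) N2(1) N3(1) by simp
  obtain c where c: "\<And>t. t \<in> {0..<T} \<Longrightarrow> \<exists>h1>0. \<forall>h. 0 < h \<and> h < h1 \<and> t + h \<le> T \<longrightarrow> V (t + h) \<le> V t + h * c t + L * (G (t + h) - G t)"
    using rough by metis
  \<comment> \<open>On the null set \<open>N\<close> the finite but uncontrolled slope
    \<open>c t\<close> is used; it does not affect the integral.\<close>
  define \<phi> where "\<phi> t = (if t \<in> N then c t else \<psi> t - L * gg t)" for t
  \<comment> \<open>Subtracting \<open>L * G\<close> removes the uncontrolled increment from
    \<open>rough\<close>; off \<open>N\<close> it subtracts \<open>L * gg t\<close> from the slope,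
    and it cancels after integration.\<close>
  define F where "F t = V t - L * G t" for t
  have iL: "(\<lambda>t. L * gg t) integrable_on {0..T}" using integrable_cmul[OF igg, of L] by simp
  have i0: "(\<lambda>t. \<psi> t - L * gg t) integrable_on {0..T}"
    using \<psi> iL by (rule integrable_diff)
  have i\<phi>: "\<phi> integrable_on {0..T}" "integral {0..T} \<phi> = integral {0..T} \<psi> - L * integral {0..T} gg"
  proof -
    show "\<phi> integrable_on {0..T}" by (rule integrable_spike[OF i0 N]) (simp add: \<phi>_def)
    have "integral {0..T} \<phi> = integral {0..T} (\<lambda>t. \<psi> t - L * gg t)" by (rule integral_spike[OF N]) (simp add: \<phi>_def)
    also have "\<dots> = integral {0..T} \<psi> - integral {0..T} (\<lambda>t. L * gg t)"
      using \<psi> iL by (rule integral_diff)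
    finally show "integral {0..T} \<phi> = integral {0..T} \<psi> - L * integral {0..T} gg" by simp
  qed
  have "F T - F 0 \<le> integral {0..T} \<phi>"
  proof (rule dini_integral_bound[OF _ _ i\<phi>(1)])
    show "0 \<le> T" using T by simp
    show "continuous_on {0..T} F"
      unfolding F_def V_def G_def using cdd igg
      by (intro continuous_on_diff continuous_on_mult continuous_on_const continuous_on_power indefinite_integral_continuous_1)
    fix t e :: real assume t: "t \<in> {0..<T}" and e: "e > 0"
    then have t0: "t \<ge> 0" by simp
    show "\<exists>d>0. \<forall>h. 0 < h \<and> h < d \<and> t + h \<le> T \<longrightarrow> F (t + h) \<le> F t + h * (\<phi> t + e)"
    proof (cases "t \<in> N")
      case True
      obtain h1 where h1: "h1 > 0" "\<And>h. 0 < h \<and> h < h1 \<and> t + h \<le> T \<Longrightarrow> V (t + h) \<le> V t + h * c t + L * (G (t + h) - G t)"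
        using c[OF t] by blast
      show ?thesis
      proof (intro exI[of _ h1] conjI allI impI h1(1))
        fix h assume h: "0 < h \<and> h < h1 \<and> t + h \<le> T"
        have "0 \<le> h * e" using h e by simp
        then show "F (t + h) \<le> F t + h * (\<phi> t + e)"
          using h1(2)[OF h] True unfolding F_def \<phi>_def by (simp add: algebra_simps)
      qed
    next
      case False
      then have tN: "t \<in> {0..<T} - N1" "t \<in> {0..<T} - N2" "t \<in> {0..<T} - N3" using t unfolding N_def by auto
      obtain m where cl: "((xs t, x t, t, us t, dd t), K (x t) t) \<in> closure (lifted m)"
        using k[OF t0, of "xs t" "x t" "us t"] unfolding K[OF t0] dd_def by blast
      have dd0: "dd t \<ge> 0" unfolding dd_def using d_nonneg[OF t0] .
      have e2: "e / 2 > 0" using e by simp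
      obtain e' h0 where h0: "e' > 0" "h0 > 0"
        "\<And>h a' b'. 0 < h \<Longrightarrow> h < h0 \<Longrightarrow> norm (a' - xs t - h *\<^sub>R vfield f B (xs t) (us t) (ws t) t) \<le> e' * h \<Longrightarrow>
         norm (b' - x t - h *\<^sub>R vfield f B (x t) (K (x t) t) (w t) t) \<le> e' * h \<Longrightarrow>
         (d (t + h) a' b')\<^sup>2 \<le> (dd t)\<^sup>2 + h * (\<alpha>\<^sup>2 * (norm (w t - ws t))\<^sup>2 - (norm (g (x t) (K (x t) t) t - g (xs t) (us t) t))\<^sup>2 + e / 2)"
        by (rule dissipation_step[OF t0 dd0 cl e2]) blast
      obtain d1 where d1: "d1 > 0" "\<And>h. 0 < h \<and> h < d1 \<and> t + h \<le> T \<Longrightarrow> norm (integral {0..t+h} vx - integral {0..t} vx - h *\<^sub>R vx t) \<le> e' * h"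
        using N1(2)[OF tN(1) h0(1)] by blast
      obtain d2 where d2: "d2 > 0" "\<And>h. 0 < h \<and> h < d2 \<and> t + h \<le> T \<Longrightarrow> norm (integral {0..t+h} vs - integral {0..t} vs - h *\<^sub>R vs t) \<le> e' * h"
        using N2(2)[OF tN(2) h0(1)] by blast
      \<comment> \<open>Half of \<open>e\<close> is spent in the dissipation step, half on the
        derivative of \<open>L * G\<close>.\<close>
      define e3 where "e3 = e / (2 * (L + 1))"
      have e3: "e3 > 0" "L * e3 \<le> e / 2"
      proof -
        show "e3 > 0" unfolding e3_def using e L by simp
        have "L * e3 \<le> (L + 1) * e3" using \<open>e3 > 0\<close> by simp
        also have "\<dots> = e / 2"
        proof -
          have "q * (e / (2 * q)) = e / 2" if "q > 0" for q :: real using that by simp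
          then show ?thesis unfolding e3_def using L by (metis add_nonneg_pos zero_less_one)
        qed
        finally show "L * e3 \<le> e / 2" .
      qed
      obtain d3 where d3: "d3 > 0" "\<And>h. 0 < h \<and> h < d3 \<and> t + h \<le> T \<Longrightarrow> norm (integral {0..t+h} gg - integral {0..t} gg - h *\<^sub>R gg t) \<le> e3 * h"
        using N3(2)[OF tN(3) e3(1)] by blast
      define dl where "dl = min (min h0 d1) (min d2 d3)"
      have dl: "dl > 0" unfolding dl_def using h0 d1 d2 d3 by simp
      show ?thesis
      proof (intro exI[of _ dl] conjI allI impI dl)
        fix h assume h: "0 < h \<and> h < dl \<and> t + h \<le> T"
        then have hs: "h < h0" "h < d1" "h < d2" "h < d3" unfolding dl_def by auto
        have tT: "t \<in> {0..T}" "t + h \<in> {0..T}" using t h by auto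
        have xt: "x (t + h) - x t = integral {0..t+h} vx - integral {0..t} vx"
          unfolding solution_onD[OF sol tT(1)] solution_onD[OF sol tT(2)] vx_def by simp
        have xst: "xs (t + h) - xs t = integral {0..t+h} vs - integral {0..t} vs"
          unfolding solution_onD[OF sols tT(1)] solution_onD[OF sols tT(2)] vs_def by simp
        have "norm (xs (t + h) - xs t - h *\<^sub>R vfield f B (xs t) (us t) (ws t) t) \<le> e' * h"
          unfolding xst using d2(2)[of h] h hs unfolding vs_def by blast
        moreover have "norm (x (t + h) - x t - h *\<^sub>R vfield f B (x t) (K (x t) t) (w t) t) \<le> e' * h"
          unfolding xt using d1(2)[of h] h hs unfolding vx_def by blast
        ultimately have "V (t + h) \<le> V t + h * (\<alpha>\<^sup>2 * (norm (w t - ws t))\<^sup>2 - (norm (g (x t) (K (x t) t) t - g (xs t) (us t) t))\<^sup>2 + e / 2)"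
          unfolding V_def dd_def[of "t + h"] using h0(3) h hs by blast
        also have "\<dots> \<le> V t + h * (\<psi> t + e / 2)"
          using \<psi>_ge[of t] t h by (intro add_left_mono mult_left_mono) auto
        finally have 1: "V (t + h) \<le> V t + h * (\<psi> t + e / 2)" .
        have "\<bar>G (t + h) - G t - h * gg t\<bar> \<le> e3 * h" using d3(2)[of h] h hs unfolding G_def by simp
        then have "h * gg t - e3 * h \<le> G (t + h) - G t" by linarith
        then have "L * (h * gg t - e3 * h) \<le> L * (G (t + h) - G t)" using L by (rule mult_left_mono)
        moreover have "L * e3 * h \<le> e / 2 * h" using e3(2) h by (intro mult_right_mono) auto
        ultimately have "L * (h * gg t) - e / 2 * h \<le> L * (G (t + h) - G t)" by (simp add: algebra_simps)
        then show "F (t + h) \<le> F t + h * (\<phi> t + e)"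
          using 1 False unfolding F_def \<phi>_def by (simp add: algebra_simps)
      qed
    qed
  qed
  moreover have "F 0 = 0" unfolding F_def V_def dd_def G_def using x0 d_self[of 0 "xs 0"] by simp
  \<comment> \<open>Here \<open>V T \<ge> 0\<close> is used; the two multiples of the integral of
    \<open>gg\<close> cancel.\<close>
  moreover have "F T \<ge> - L * integral {0..T} gg" unfolding F_def V_def G_def by simp
  ultimately show ?thesis unfolding i\<phi>(2) by simp
qed

end

section \<open>Truncated outputs and measurability of the closed loop\<close>

lemma integrable_truncation:
  fixes h :: "real \<Rightarrow> real"
  assumes "h \<in> borel_measurable (lebesgue_on {0..T})" and "\<And>t. h t \<ge> 0"
  shows "integrable (lebesgue_on {0..T}) (\<lambda>t. min (h t) (real n))"
proof (rule finite_measure.integrable_const_bound[where B = "real n"])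
  show "finite_measure (lebesgue_on {0..T})" by (rule finite_measure_lebesgue_on) simp
  show "AE t in lebesgue_on {0..T}. norm (min (h t) (real n)) \<le> real n" using assms(2) by (intro AE_I2) auto
  show "(\<lambda>t. min (h t) (real n)) \<in> borel_measurable (lebesgue_on {0..T})" using assms(1) by (intro borel_measurable_min) auto
qed

text \<open>Bounded truncations are integrable without any assumption on the size of
  \<open>h\<close>, and monotone convergence carries their common bound over to \<open>h\<close>,
  which thereby has finite integral.\<close>

lemma nn_integral_le_truncations:
  fixes h :: "real \<Rightarrow> real"
  assumes meas: "h \<in> borel_measurable (lebesgue_on {0..T})" and nonneg: "\<And>t. h t \<ge> 0"
    and le: "\<And>n::nat. integral {0..T} (\<lambda>t. min (h t) (real n)) \<le> c"
  shows "(\<integral>\<^sup>+ t. ennreal (h t) \<partial>lebesgue_on {0..T}) \<le> ennreal c"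
proof -
  let ?L = "lebesgue_on {0..T}"
  have "ennreal (h t) = (SUP n::nat. ennreal (min (h t) (real n)))" for t
  proof (rule antisym)
    obtain n :: nat where "h t \<le> real n" using real_arch_simple by blast
    then have "ennreal (h t) = ennreal (min (h t) (real n))" by simp
    also have "\<dots> \<le> (SUP n::nat. ennreal (min (h t) (real n)))" by (rule SUP_upper) simp
    finally show "ennreal (h t) \<le> (SUP n::nat. ennreal (min (h t) (real n)))" .
    show "(SUP n::nat. ennreal (min (h t) (real n))) \<le> ennreal (h t)"
      by (intro SUP_least ennreal_leI) simp
  qed
  then have "(\<integral>\<^sup>+ t. ennreal (h t) \<partial>?L) = (\<integral>\<^sup>+ t. (SUP n::nat. ennreal (min (h t) (real n))) \<partial>?L)" by simp
  also have "\<dots> = (SUP n::nat. \<integral>\<^sup>+ t. ennreal (min (h t) (real n)) \<partial>?L)"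
  proof (rule nn_integral_monotone_convergence_SUP)
    show "incseq (\<lambda>n t. ennreal (min (h t) (real n)))"
      by (intro incseq_SucI le_funI ennreal_leI) auto
    show "\<And>n. (\<lambda>t. ennreal (min (h t) (real n))) \<in> borel_measurable ?L"
      using meas by (intro measurable_compose[OF _ measurable_ennreal] borel_measurable_min) auto
  qed
  also have "\<dots> \<le> ennreal c"
  proof (rule SUP_least)
    fix n :: nat
    note int = integrable_truncation[OF meas nonneg, of n]
    have "(\<integral>\<^sup>+ t. ennreal (min (h t) (real n)) \<partial>?L) = ennreal (integral\<^sup>L ?L (\<lambda>t. min (h t) (real n)))"
      using nonneg by (intro nn_integral_eq_integral[OF int] AE_I2) auto
    also have "\<dots> = ennreal (integral {0..T} (\<lambda>t. min (h t) (real n)))"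
      using lebesgue_integral_eq_integral[OF int] by simp
    finally show "(\<integral>\<^sup>+ t. ennreal (min (h t) (real n)) \<partial>?L) \<le> ennreal c"
      using le[of n] by (simp add: ennreal_leI)
  qed
  finally show ?thesis .
qed

text \<open>Data continuous only for nonnegative times become Borel functions on the whole space
  when extended by zero off \<open>S\<close>.\<close>

lemma borel_measurable_on_closed_compose:
  fixes F :: "'a::second_countable_topology \<Rightarrow> 'b::real_normed_vector"
  assumes "closed S" "continuous_on S F" "p \<in> borel_measurable N" "\<And>z. z \<in> space N \<Longrightarrow> p z \<in> S"
  shows "(\<lambda>z. F (p z)) \<in> borel_measurable N"
proof -
  have "(\<lambda>x. indicator S x *\<^sub>R F x) \<in> borel_measurable borel"
    using assms(1,2) by (intro borel_measurable_continuous_on_indicator borel_closed)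
  then have "(\<lambda>z. indicator S (p z) *\<^sub>R F (p z)) \<in> borel_measurable N"
    by (rule measurable_compose[OF assms(3)])
  then show ?thesis
    by (rule measurable_cong[THEN iffD1, rotated]) (use assms(4) in simp)
qed

lemma target_solution_continuous:
  assumes "target_solution f B us xs ws"
  shows "continuous_on {0..} xs"
  unfolding continuous_on_eq_continuous_within
proof
  fix t :: real assume t: "t \<in> {0..}"
  then have "solution_on f B (t + 1) us xs ws" using assms unfolding target_solution_def by auto
  from solution_continuous[OF this] have "continuous (at t within {0..t+1}) xs"
    using t by (simp add: continuous_on_eq_continuous_within)
  moreover have "at t within {0..} = at t within {0..t+1}"
    by (rule at_within_nhd[where S = "{..<t+1}"]) (use t in auto)
  ultimately show "continuous (at t within {0..}) xs" by simp
qed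

theorem theorem4:
  fixes f :: "real^'n \<Rightarrow> real^'p \<Rightarrow> real \<Rightarrow> real^'n"
    and B :: "real^'n \<Rightarrow> real \<Rightarrow> real^'m^'n"
    and g :: "real^'n \<Rightarrow> real^'m \<Rightarrow> real \<Rightarrow> real^'q"
    and W :: "real^'n \<Rightarrow> real \<Rightarrow> real^'n^'n"
    and Y :: "real^'n \<Rightarrow> real \<Rightarrow> real^'m \<Rightarrow> real^'n^'m"
    and \<alpha> :: real
    and us :: "real \<Rightarrow> real^'m" and xs :: "real \<Rightarrow> real^'n" and ws :: "real \<Rightarrow> real^'p"
  assumes f_smooth: "smooth_on (UNIV \<times> UNIV \<times> {0..}) (\<lambda>(x, w, t). f x w t)"
    and B_smooth: "smooth_on (UNIV \<times> {0..}) (\<lambda>(x, t). B x t)"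
    and g_smooth: "smooth_on (UNIV \<times> UNIV \<times> {0..}) (\<lambda>(x, u, t). g x u t)"
    and W_smooth: "smooth_on (UNIV \<times> {0..}) (\<lambda>(x, t). W x t)"
    and Y_smooth: "smooth_on (UNIV \<times> {0..} \<times> UNIV) (\<lambda>(x, t, u). Y x t u)"
    and alpha_pos: "\<alpha> > 0"
    and W_pos_def: "\<And>x t. t \<ge> 0 \<Longrightarrow> pos_def (W x t)"
    and Y_affine: "\<And>x t. t \<ge> 0 \<Longrightarrow> linear (\<lambda>u. Y x t u - Y x t 0)"
    and LMI: "\<And>x u w t. t \<ge> 0 \<Longrightarrow> pos_semidef (lmi_matrix \<alpha> f B g W Y x u w t)"
    and metric: "\<And>t. t \<ge> 0 \<Longrightarrow> riemannian_metric (\<lambda>x. matrix_inv (W x t))"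
    and geodesics: "\<And>t a b. t \<ge> 0 \<Longrightarrow> \<exists>\<gamma>. minimal_geodesic (\<lambda>x. matrix_inv (W x t)) a b \<gamma>"
    and dist_continuous_in_time:
      "\<And>a b. continuous_on {0..} (\<lambda>t. riem_dist (\<lambda>x. matrix_inv (W x t)) a b)"
    and target: "target_solution f B us xs ws"
  shows "\<exists>k. state_feedback k \<and> (\<forall>t\<ge>0. k (xs t) t = us t) \<and>
    (\<forall>w T x. signal w \<longrightarrow> T > 0 \<longrightarrow> x 0 = xs 0 \<longrightarrow>
      solution_on f B T (\<lambda>t. k (x t) t) x w \<longrightarrow>
      sq_norm_upto T (\<lambda>t. g (x t) (k (x t) t) t - g (xs t) (us t) t)
        \<le> ennreal (\<alpha>\<^sup>2) * sq_norm_upto T (\<lambda>t. w t - ws t))"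
proof -
  interpret rccm f B g W Y \<alpha>
    by (rule rccm.intro[OF f_smooth B_smooth g_smooth W_smooth Y_smooth alpha_pos W_pos_def Y_affine LMI
          metric geodesics dist_continuous_in_time])
  have sig: "signal us" "signal ws" and sols: "T > 0 \<Longrightarrow> solution_on f B T us xs ws" for T
    using target unfolding target_solution_def by blast+
  let ?L = "lebesgue_on {0..}" and ?N = "borel \<Otimes>\<^sub>M lebesgue_on {0..} :: ((real^'n) \<times> real) measure"
  have cxs: "continuous_on {0..} xs" by (rule target_solution_continuous[OF target])
  have mxs: "xs \<in> borel_measurable ?L" by (rule continuous_imp_measurable_on_sets_lebesgue[OF cxs]) simp
  have mid: "(\<lambda>t. t) \<in> borel_measurable (lebesgue_on S)" if "S \<in> sets lebesgue" for S :: "real set"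
    by (rule continuous_imp_measurable_on_sets_lebesgue[OF continuous_on_id that])
  show ?thesis
  proof (rule borel_controller)
    fix kk assume kk: "kk \<in> borel_measurable borel"
      "\<And>t a b u0. t \<ge> 0 \<Longrightarrow> \<exists>m. ((a, b, t, u0, d t a b), kk (a, b, t, u0, d t a b)) \<in> closure (lifted m)"
      "\<And>t a u0. kk (a, a, t, u0, d t a a) = u0"
    \<comment> \<open>At time \<open>t\<close> only \<open>xs t\<close>, \<open>us t\<close> and the
      metric enter, neither \<open>w\<close> nor \<open>ws\<close>.\<close>
    define K where "K x t = kk (xs t, x, t, us t, d t (xs t) x)" for x t
    have mN: "(\<lambda>z. xs (snd z)) \<in> borel_measurable ?N" "(\<lambda>z. us (snd z)) \<in> borel_measurable ?N"
      "(\<lambda>z. snd z) \<in> borel_measurable ?N" "(\<lambda>z. fst z) \<in> borel_measurable ?N"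
      using measurable_compose[OF measurable_snd mxs] measurable_compose[OF measurable_snd sig(1)]
        measurable_compose[OF measurable_snd mid[of "{0..}"]] measurable_fst by auto
    have md: "(\<lambda>z. d (snd z) (xs (snd z)) (fst z)) \<in> borel_measurable ?N"
    proof -
      have "closed (UNIV \<times> UNIV \<times> {0..} :: ((real^'n) \<times> (real^'n) \<times> real) set)" by (intro closed_Times) auto
      moreover have "(\<lambda>z. (xs (snd z), fst z, snd z)) \<in> borel_measurable ?N"
        by (intro borel_measurable_Pair mN)
      ultimately have "(\<lambda>z. (\<lambda>z. d (snd (snd z)) (fst z) (fst (snd z))) (xs (snd z), fst z, snd z)) \<in> borel_measurable ?N"
        by (rule borel_measurable_on_closed_compose[OF _ d_continuous]) (auto simp: space_pair_measure)
      then show ?thesis by simp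
    qed
    have sf: "state_feedback K"
      unfolding state_feedback_def split_beta K_def
      by (rule measurable_compose[OF _ kk(1)]) (intro borel_measurable_Pair mN md)
    have Kxs: "\<forall>t\<ge>0. K (xs t) t = us t" unfolding K_def using kk(3) by simp
    have gain: "sq_norm_upto T (\<lambda>t. g (x t) (K (x t) t) t - g (xs t) (us t) t)
        \<le> ennreal (\<alpha>\<^sup>2) * sq_norm_upto T (\<lambda>t. w t - ws t)"
      if w: "signal w" and T: "T > 0" and x0: "x 0 = xs 0" and sol: "solution_on f B T (\<lambda>t. K (x t) t) x w" for w T x
    proof (cases "sq_norm_upto T (\<lambda>t. w t - ws t) = \<infinity>")
      case True
      \<comment> \<open>Because the gain is nonzero, an infinite disturbance norm makes the right
        side infinite; in the other case the squared disturbance is integrable.\<close>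
      have "ennreal (\<alpha>\<^sup>2) \<noteq> 0" using alpha_pos by simp
      then show ?thesis using True by (simp add: ennreal_mult_top)
    next
      case False
      let ?LT = "lebesgue_on {0..T}"
      have sub: "{0..T} \<subseteq> {0..}" by auto
      have mT: "w \<in> borel_measurable ?LT" "ws \<in> borel_measurable ?LT" "us \<in> borel_measurable ?LT" "xs \<in> borel_measurable ?LT"
        using measurable_restrict_mono[OF w sub] measurable_restrict_mono[OF sig(2) sub]
          measurable_restrict_mono[OF sig(1) sub] measurable_restrict_mono[OF mxs sub] by auto
      have mx: "x \<in> borel_measurable ?LT"
        by (rule continuous_imp_measurable_on_sets_lebesgue[OF solution_continuous[OF sol]]) simp
      have mt: "(\<lambda>t. t) \<in> borel_measurable ?LT" by (rule mid) simp
      have mK: "(\<lambda>t. K (x t) t) \<in> borel_measurable ?LT"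
      proof -
        have "(\<lambda>t. t) \<in> ?LT \<rightarrow>\<^sub>M ?L" by (rule measurable_restrict_mono[OF _ sub]) simp
        then have "(\<lambda>t. (x t, t)) \<in> ?LT \<rightarrow>\<^sub>M ?N" by (rule measurable_Pair[OF mx])
        from measurable_compose[OF this sf[unfolded state_feedback_def]] show ?thesis by (simp only: prod.case)
      qed
      have mg: "(\<lambda>t. g (a t) (b t) t) \<in> borel_measurable ?LT"
        if "a \<in> borel_measurable ?LT" "b \<in> borel_measurable ?LT" for a b
      proof -
        have "closed (UNIV \<times> UNIV \<times> {0..} :: ((real^'n) \<times> (real^'m) \<times> real) set)" by (intro closed_Times) auto
        moreover have "(\<lambda>t. (a t, b t, t)) \<in> borel_measurable ?LT" by (intro borel_measurable_Pair that mt)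
        ultimately have "(\<lambda>t. (\<lambda>(x, u, t). g x u t) (a t, b t, t)) \<in> borel_measurable ?LT"
          by (rule borel_measurable_on_closed_compose[OF _ smooth_on_continuous[OF g_smooth]]) auto
        then show ?thesis by simp
      qed
      define h where "h t = (norm (g (x t) (K (x t) t) t - g (xs t) (us t) t))\<^sup>2" for t
      define q where "q t = (norm (w t - ws t))\<^sup>2" for t
      have mh: "h \<in> borel_measurable ?LT" unfolding h_def
        by (rule measurable_compose[OF borel_measurable_diff[OF mg[OF mx mK] mg[OF mT(4) mT(3)]]])
          (intro borel_measurable_continuous_onI continuous_intros)
      have mq: "q \<in> borel_measurable ?LT" unfolding q_def
        by (rule measurable_compose[OF borel_measurable_diff[OF mT(1) mT(2)]])
          (intro borel_measurable_continuous_onI continuous_intros)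
      have fin: "(\<integral>\<^sup>+ t. ennreal (q t) \<partial>?LT) < \<infinity>"
        using False unfolding sq_norm_upto_def q_def by (simp add: top.not_eq_extremum)
      have intq: "integrable ?LT q"
        by (rule integrableI_nonneg[OF mq _ fin]) (simp add: q_def)
      have iq: "q integrable_on {0..T}" by (rule integrable_on_lebesgue_on[OF intq]) simp
      have iaq: "(\<lambda>t. \<alpha>\<^sup>2 * q t) integrable_on {0..T}" using integrable_cmul[OF iq, of "\<alpha>\<^sup>2"] by simp
      \<comment> \<open>Truncation lowers the output term and so raises the supply rate:
        \<open>storage_inequality\<close> accepts any integrable upper bound of it.\<close>
      have "integral {0..T} (\<lambda>t. min (h t) (real n)) \<le> \<alpha>\<^sup>2 * integral {0..T} q" for n
      proof -
        have ih: "(\<lambda>t. min (h t) (real n)) integrable_on {0..T}"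
          by (rule integrable_on_lebesgue_on[OF integrable_truncation[OF mh]]) (auto simp: h_def)
        have "0 \<le> integral {0..T} (\<lambda>t. \<alpha>\<^sup>2 * q t - min (h t) (real n))"
        proof (rule storage_inequality[OF kk(2) K_def T sols[OF T] sol x0])
          show "(\<lambda>t. \<alpha>\<^sup>2 * q t - min (h t) (real n)) integrable_on {0..T}"
            using iaq ih by (rule integrable_diff)
        qed (auto simp: q_def h_def)
        also have "\<dots> = \<alpha>\<^sup>2 * integral {0..T} q - integral {0..T} (\<lambda>t. min (h t) (real n))"
          using integral_diff[OF iaq ih] by simp
        finally show ?thesis by simp
      qed
      then have "(\<integral>\<^sup>+ t. ennreal (h t) \<partial>?LT) \<le> ennreal (\<alpha>\<^sup>2 * integral {0..T} q)"
        by (intro nn_integral_le_truncations mh) (auto simp: h_def)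
      also have "\<dots> = ennreal (\<alpha>\<^sup>2) * ennreal (integral {0..T} q)" by (rule ennreal_mult') simp
      also have "ennreal (integral {0..T} q) = (\<integral>\<^sup>+ t. ennreal (q t) \<partial>?LT)"
      proof -
        have "(\<integral>\<^sup>+ t. ennreal (q t) \<partial>?LT) = ennreal (integral\<^sup>L ?LT q)"
          by (rule nn_integral_eq_integral[OF intq]) (simp add: q_def)
        then show ?thesis using lebesgue_integral_eq_integral[OF intq] by simp
      qed
      finally show ?thesis unfolding sq_norm_upto_def h_def q_def .
    qed
    show ?thesis using sf Kxs gain by blast
  qed
qed

end
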